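(* Let $R$ be a skew-invertible Hecke symmetry and let $(\mathcal{D}(R^{-1}),\mathcal{M}(R))$ be the associated quantum double with its action $\triangleright$ of $\mathcal{D}(R^{-1})$ on $\mathcal{M}(R)$. For every integer $m\ge 1$ and every (noncommutative) polynomial $Q(R_1,\dots,R_{m-1})$ in the operators $R_1,\dots,R_{m-1}$, the action on $\mathcal{M}(R)$ of the generalized quantum Laplace operator $$D_Q^{(m)}=\mathrm{Tr}_{R(1\dots m)}\bigl(Q(R_1,\dots,R_{m-1})\,D_{\overline{1\to m}}\bigr)$$ maps the characteristic subalgebra of $\mathcal{M}(R)$ into itself.
   Context: **Hecke symmetry.** $V$ is a complex vector space of dimension $N$. $I$ is the identity operator on $V$ or the $N\times N$ unit matrix, and $P$ is the flip on $V^{\otimes 2}$. A Hecke symmetry is $R\in\mathrm{End}(V^{\otimes 2})$ satisfying $(R\otimes I)(I\otimes R)(R\otimes I)=(I\otimes R)(R\otimes I)(I\otimes R)$ and $(qI\otimes I-R)(q^{-1}I\otimes I+R)=0$. Here $q\in\mathbb{C}\setminus\{0,\pm1\}$ is generic: $q^n\neq1$ for all positive integers $n$. Standing assumptions: $R$ is skew-invertible, i.e. there is $\Psi\in\mathrm{End}(V^{\otimes2})$ with $\mathrm{Tr}_2R_{12}\Psi_{23}=\mathrm{Tr}_2\Psi_{12}R_{23}=P_{13}$; $R^{-1}$ is also skew-invertible; and $R$ is taken from a family having a limit as $q\to1$ which is an involutive symmetry ($R^2=I\otimes I$ in the limit). **Matrix notation.** $R_i=I^{\otimes(i-1)}\otimes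 R\otimes I^{\otimes(k-i-1)}$ acts on $V^{\otimes k}$, with $k$ sufficiently large. For an $N\times N$ matrix $X$ (possibly with noncommuting entries, row index lower and column index upper) put $X_{\overline1}=X_1=X\otimes I^{\otimes(k-1)}$, $X_{\overline{r+1}}=R_rX_{\overline r}R_r^{-1}$, and $X_{\overline{1\to n}}=X_{\overline1}X_{\overline2}\cdots X_{\overline n}$. **R-trace.** $C$ is the $N\times N$ matrix with entries $C_i^j=\sum_k\Psi_{ik}^{jk}$, and $\mathrm{Tr}_{R(1\dots n)}(X)=\mathrm{Tr}_1(\cdots\mathrm{Tr}_n(C_1C_2\cdots C_nX)\cdots)$ for $X\in(\mathrm{Mat}_N)^{\otimes n}$, where $C_i$ is $C$ placed in the $i$-th tensor factor. **Algebras.** $\mathcal{M}(R)$ is the unital associative algebra generated by the entries of $M=\|m_i^j\|$ with relations $R_1M_1R_1M_1=M_1R_1M_1R_1$. $\mathcal{D}(R^{-1})$ is the unital associative algebra generated by the entries of $D=\|\partial_i^j\|$ with relations $R_1^{-1}D_1R_1^{-1}D_1=D_1R_1^{-1}D_1R_1^{-1}$. The quantum double $(\mathcal{D}(R^{-1}),\mathcal{M}(R))$ is formed by these two algebras together with the permutation relations $D_1R_1M_1R_1=R_1M_1R_1^{-1}D_1+R_1$, which allow any product $ab$ with $a\in\mathcal{D}(R^{-1})$, $b\in\mathcal{M}(R)$ to be rewritten as $\sum_i b_ia_i$ with $b_i\in\mathcal{M}(R)$, $a_i\in\mathcal{D}(R^{-1})$. **Action.** Let $\varepsilon:\mathcal{D}(R^{-1})\to\mathbb{C}$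 be the one-dimensional representation with $\varepsilon(1)=1$, $\varepsilon(\partial_i^j)=0$. For $a\in\mathcal{D}(R^{-1})$ and $b\in\mathcal{M}(R)$, if the permutation relations $D_1R_1M_1R_1=R_1M_1R_1^{-1}D_1+R_1$ rewrite the product $ab$ as $ab=\sum_ib_ia_i$ with $b_i\in\mathcal{M}(R)$, $a_i\in\mathcal{D}(R^{-1})$, then $a\triangleright b=\sum_i\varepsilon(a_i)b_i$. This is a representation of $\mathcal{D}(R^{-1})$ on $\mathcal{M}(R)$. **Characteristic subalgebra.** $H_n(q)$ is the Hecke algebra with generators $\tau_1,\dots,\tau_{n-1}$ and relations $\tau_i\tau_{i+1}\tau_i=\tau_{i+1}\tau_i\tau_{i+1}$, $\tau_i\tau_j=\tau_j\tau_i$ for $|i-j|\ge2$, $(q-\tau_i)(q^{-1}+\tau_i)=0$; $H_1(q)=\mathbb{C}$. Its $R$-matrix representation is $\rho_R(\tau_i)=R_i$. For $z\in H_n(q)$ put $ch_n(z)=\mathrm{Tr}_{R(1\dots n)}(\rho_R(z)M_{\overline{1\to n}})$. The characteristic subalgebra of $\mathcal{M}(R)$ is the (central, unital) subalgebra consisting of finite linear combinations of the elements $ch_n(z)$, $n\ge1$, $z\in H_n(q)$, and of the unit $1$ (the degree-zero component). *)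

theory Defs
  imports
    "HOL-Analysis.Analysis"
    "HOL-Algebra.QuotRing"
    "HOL-Library.Poly_Mapping"
begin

section \<open>Free algebras and algebras given by generators and relations\<close>

text \<open>Words form the free monoid; it is written additively because the product of
  \<open>\<Rightarrow>\<^sub>0\<close> is convolution along \<open>+\<close>. Hence \<open>'g list \<Rightarrow>\<^sub>0 complex\<close> is the free unital
  associative complex algebra on \<open>'g\<close>.\<close>

instantiation list :: (type) monoid_add
begin

definition zero_list :: "'a list" where "zero_list = []"
definition plus_list :: "'a list \<Rightarrow> 'a list \<Rightarrow> 'a list" where "plus_list = (@)"

instance by standard (simp_all add: zero_list_def plus_list_def)

end

type_synonym 'g free = "'g list \<Rightarrow>\<^sub>0 complex"

definition const :: "complex \<Rightarrow> 'g free" where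
  "const c = Poly_Mapping.single [] c"

definition gen :: "'g \<Rightarrow> 'g free" where
  "gen g = Poly_Mapping.single [g] 1"

definition free_on :: "'g set \<Rightarrow> 'g free set" where
  "free_on A = {x. \<forall>w \<in> Poly_Mapping.keys x. set w \<subseteq> A}"

definition free_ring :: "'g set \<Rightarrow> 'g free ring" where
  "free_ring A = \<lparr>carrier = free_on A, mult = (*), one = 1, zero = 0, add = (+)\<rparr>"

lemma free_on_mult:
  assumes "x \<in> free_on A" "y \<in> free_on A" shows "x * y \<in> free_on A"
  using assms keys_mult[of x y] unfolding free_on_def plus_list_def by fastforce

lemma free_on_add:
  assumes "x \<in> free_on A" "y \<in> free_on A" shows "x + y \<in> free_on A"
  using assms Poly_Mapping.keys_add[of x y] unfolding free_on_def by blast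

lemma ring_free_ring: "ring (free_ring A)"
proof (rule ringI)
  show "abelian_group (free_ring A)"
  proof (rule abelian_groupI)
    fix x assume "x \<in> carrier (free_ring A)"
    then have "- x \<in> free_on A" by (simp add: free_ring_def free_on_def)
    then show "\<exists>y\<in>carrier (free_ring A). y \<oplus>\<^bsub>free_ring A\<^esub> x = \<zero>\<^bsub>free_ring A\<^esub>"
      by (intro bexI[of _ "- x"]) (simp_all add: free_ring_def)
  qed (auto simp: free_ring_def free_on_add add_ac, simp add: free_on_def)
  show "Group.monoid (free_ring A)"
    by unfold_locales
      (auto simp: free_ring_def free_on_mult mult.assoc,
       simp add: free_on_def zero_list_def)
qed (auto simp: free_ring_def algebra_simps)

text \<open>The constants are central in \<^term>\<open>free_ring A\<close>, so its two-sided ring ideals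
  are algebra ideals. Elements of a presented algebra are cosets.\<close>

definition rel_ideal :: "'g set \<Rightarrow> 'g free set \<Rightarrow> 'g free set" where
  "rel_ideal A S = Idl\<^bsub>free_ring A\<^esub> S"

definition presented :: "'g set \<Rightarrow> 'g free set \<Rightarrow> 'g free set ring" where
  "presented A S = free_ring A Quot rel_ideal A S"

definition cls :: "'g set \<Rightarrow> 'g free set \<Rightarrow> 'g free \<Rightarrow> 'g free set" where
  "cls A S x = rel_ideal A S +>\<^bsub>free_ring A\<^esub> x"

definition relabel :: "('g \<Rightarrow> 'h) \<Rightarrow> 'g free \<Rightarrow> 'h free" where
  "relabel f x = (\<Sum>w\<in>Poly_Mapping.keys x.
     Poly_Mapping.single (map f w) (Poly_Mapping.lookup x w))"


section \<open>Matrices on tensor powers\<close>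

text \<open>\<open>V\<close> has a basis indexed by \<open>'n\<close>, and the basis of the \<open>k\<close>-th tensor power of \<open>V\<close>
  consists of the lists of length \<open>k\<close>. In \<open>X u v\<close> the row (lower) multi-index is \<open>u\<close> and
  the column (upper) multi-index is \<open>v\<close>. Tensor factors are counted from 0, so that
  \<open>leg2 k i R\<close> is the operator usually written \<open>R\<^sub>i\<^sub>+\<^sub>1\<close>.\<close>

type_synonym 'n op2 = "complex ^ ('n \<times> 'n) ^ ('n \<times> 'n)"
type_synonym ('n, 'a) tmat = "'n list \<Rightarrow> 'n list \<Rightarrow> 'a"

definition tid :: "nat \<Rightarrow> ('n, 'a :: zero_neq_one) tmat" where
  "tid k u v = (if length u = k \<and> u = v then 1 else 0)"

definition tmul :: "nat \<Rightarrow> ('n :: finite, 'a :: semiring_0) tmat \<Rightarrow> ('n, 'a) tmat \<Rightarrow> ('n, 'a) tmat" where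
  "tmul k X Y u v = (\<Sum>w | length w = k. X u w * Y w v)"

definition tprod :: "nat \<Rightarrow> ('n :: finite, 'a :: semiring_1) tmat list \<Rightarrow> ('n, 'a) tmat" where
  "tprod k Xs = foldr (tmul k) Xs (tid k)"

definition leg1 :: "nat \<Rightarrow> nat \<Rightarrow> ('n \<Rightarrow> 'n \<Rightarrow> 'a :: zero) \<Rightarrow> ('n, 'a) tmat" where
  "leg1 k i X u v =
    (if length u = k \<and> length v = k \<and> (\<forall>p<k. p \<noteq> i \<longrightarrow> u ! p = v ! p)
     then X (u ! i) (v ! i) else 0)"

definition leg2 :: "nat \<Rightarrow> nat \<Rightarrow> 'n op2 \<Rightarrow> ('n :: finite, complex) tmat" where
  "leg2 k i T u v =
    (if length u = k \<and> length v = k \<and> (\<forall>p<k. p \<noteq> i \<and> p \<noteq> Suc i \<longrightarrow> u ! p = v ! p)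
     then T $ (u ! i, u ! Suc i) $ (v ! i, v ! Suc i) else 0)"

definition lift :: "('n, complex) tmat \<Rightarrow> ('n, 'g free) tmat" where
  "lift X u v = const (X u v)"

definition flip :: "'n :: finite op2" where
  "flip = (\<chi> a b. if fst a = snd b \<and> snd a = fst b then 1 else 0)"

text \<open>The partial trace over the middle factor of a threefold tensor power.\<close>

definition tr_mid :: "('n :: finite, complex) tmat \<Rightarrow> 'n op2" where
  "tr_mid X = (\<chi> a b. \<Sum>x\<in>UNIV. X [fst a, x, snd a] [fst b, x, snd b])"


section \<open>Hecke symmetries\<close>

definition braid_eq :: "'n :: finite op2 \<Rightarrow> bool" where
  "braid_eq R \<longleftrightarrow>
    tprod 3 [leg2 3 0 R, leg2 3 1 R, leg2 3 0 R] = tprod 3 [leg2 3 1 R, leg2 3 0 R, leg2 3 1 R]"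

definition hecke_symmetry :: "complex \<Rightarrow> 'n :: finite op2 \<Rightarrow> bool" where
  "hecke_symmetry q R \<longleftrightarrow> braid_eq R \<and> (mat q - R) ** (mat (inverse q) + R) = 0"

definition involutive_symmetry :: "'n :: finite op2 \<Rightarrow> bool" where
  "involutive_symmetry R \<longleftrightarrow> braid_eq R \<and> R ** R = mat 1"

definition generic :: "complex \<Rightarrow> bool" where
  "generic q \<longleftrightarrow> q \<notin> {0, 1, -1} \<and> (\<forall>n::nat. n > 0 \<longrightarrow> q ^ n \<noteq> 1)"

definition is_skew_inverse :: "'n :: finite op2 \<Rightarrow> 'n op2 \<Rightarrow> bool" where
  "is_skew_inverse R \<Psi> \<longleftrightarrow>
    tr_mid (tprod 3 [leg2 3 0 R, leg2 3 1 \<Psi>]) = flip \<and>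
    tr_mid (tprod 3 [leg2 3 0 \<Psi>, leg2 3 1 R]) = flip"

definition skew_invertible :: "'n :: finite op2 \<Rightarrow> bool" where
  "skew_invertible R \<longleftrightarrow> (\<exists>\<Psi>. is_skew_inverse R \<Psi>)"

text \<open>The skew inverse is unique when it exists.\<close>

definition skew_inv :: "'n :: finite op2 \<Rightarrow> 'n op2" where
  "skew_inv R = (SOME \<Psi>. is_skew_inverse R \<Psi>)"

text \<open>\<open>R\<close> is the member at parameter \<open>q\<close> of a continuous family of Hecke symmetries over a
  connected set of parameters that accumulates at 1. Continuity and connectedness tie the limit
  to \<open>R\<close>; otherwise the member at \<open>q\<close> could be replaced arbitrarily. The members other than \<open>R\<close>
  are not required to have a generic parameter or to be skew-invertible.\<close>

definition has_involutive_limit :: "complex \<Rightarrow> 'n :: finite op2 \<Rightarrow> bool" where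
  "has_involutive_limit q R \<longleftrightarrow>
    (\<exists>S F R0. connected S \<and> q \<in> S \<and> 0 \<notin> S \<and> 1 islimpt S \<and> continuous_on S F \<and>
       (\<forall>p\<in>S. hecke_symmetry p (F p)) \<and> F q = R \<and>
       (F \<longlongrightarrow> R0) (at 1 within S) \<and> involutive_symmetry R0)"


section \<open>R-trace and the matrix copies of a matrix\<close>

definition C_mat :: "'n :: finite op2 \<Rightarrow> 'n \<Rightarrow> 'n \<Rightarrow> complex" where
  "C_mat R i j = (\<Sum>k\<in>UNIV. skew_inv R $ (i, k) $ (j, k))"

definition trR :: "'n :: finite op2 \<Rightarrow> nat \<Rightarrow> ('n, 'g free) tmat \<Rightarrow> 'g free" where
  "trR R n X = (\<Sum>u | length u = n.
     tmul n (lift (tprod n (map (\<lambda>i. leg1 n i (C_mat R)) [0..<n]))) X u u)"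

text \<open>\<open>bar k R X r\<close> is the copy with index \<open>r + 1\<close>, and \<open>bar_prod k R X n\<close> is the ordered
  product of the copies with indices from 1 to \<open>n\<close>, both acting on the \<open>k\<close>-th tensor power.\<close>

primrec bar :: "nat \<Rightarrow> 'n :: finite op2 \<Rightarrow> ('n \<Rightarrow> 'n \<Rightarrow> 'g free) \<Rightarrow> nat \<Rightarrow> ('n, 'g free) tmat" where
  "bar k R X 0 = leg1 k 0 X"
| "bar k R X (Suc r) =
     tprod k [lift (leg2 k r R), bar k R X r, lift (leg2 k r (matrix_inv R))]"

definition bar_prod :: "nat \<Rightarrow> 'n :: finite op2 \<Rightarrow> ('n \<Rightarrow> 'n \<Rightarrow> 'g free) \<Rightarrow> nat \<Rightarrow> ('n, 'g free) tmat" where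
  "bar_prod k R X n = tprod k (map (bar k R X) [0..<n])"


section \<open>The algebras and the quantum double\<close>

text \<open>The entries of a matrix of generators are labelled by pairs (row, column). In the double,
  \<open>Inl\<close> marks the generators of \<open>\<M>(R)\<close> and \<open>Inr\<close> those of \<open>\<D>(R\<^sup>-\<^sup>1)\<close>.\<close>

definition gen_mat :: "('n \<times> 'n \<Rightarrow> 'g) \<Rightarrow> 'n \<Rightarrow> 'n \<Rightarrow> 'g free" where
  "gen_mat f i j = gen (f (i, j))"

definition entry_rels :: "nat \<Rightarrow> ('n, 'g free) tmat \<Rightarrow> ('n, 'g free) tmat \<Rightarrow> 'g free set" where
  "entry_rels k X Y = {X u v - Y u v | u v. length u = k \<and> length v = k}"

definition refl_rels :: "'n :: finite op2 \<Rightarrow> ('n \<Rightarrow> 'n \<Rightarrow> 'g free) \<Rightarrow> 'g free set" where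
  "refl_rels T X = (let T1 = lift (leg2 2 0 T); X1 = leg1 2 0 X in
     entry_rels 2 (tprod 2 [T1, X1, T1, X1]) (tprod 2 [X1, T1, X1, T1]))"

definition perm_rels :: "'n :: finite op2 \<Rightarrow> ('n \<times> 'n + 'n \<times> 'n) free set" where
  "perm_rels R =
    (let R1 = lift (leg2 2 0 R); R1' = lift (leg2 2 0 (matrix_inv R));
         M1 = leg1 2 0 (gen_mat Inl); D1 = leg1 2 0 (gen_mat Inr) in
     entry_rels 2 (tprod 2 [D1, R1, M1, R1])
       (\<lambda>u v. tprod 2 [R1, M1, R1', D1] u v + R1 u v))"

definition M_rels :: "'n :: finite op2 \<Rightarrow> ('n \<times> 'n) free set" where
  "M_rels R = refl_rels R (gen_mat id)"

definition D_rels :: "'n :: finite op2 \<Rightarrow> ('n \<times> 'n) free set" where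
  "D_rels R = refl_rels (matrix_inv R) (gen_mat id)"

definition double_rels :: "'n :: finite op2 \<Rightarrow> ('n \<times> 'n + 'n \<times> 'n) free set" where
  "double_rels R =
    refl_rels R (gen_mat Inl) \<union> refl_rels (matrix_inv R) (gen_mat Inr) \<union> perm_rels R"

definition M_alg :: "'n :: finite op2 \<Rightarrow> ('n \<times> 'n) free set ring" where
  "M_alg R = presented UNIV (M_rels R)"

definition M_cls :: "'n :: finite op2 \<Rightarrow> ('n \<times> 'n) free \<Rightarrow> ('n \<times> 'n) free set" where
  "M_cls R = cls UNIV (M_rels R)"

definition D_cls :: "'n :: finite op2 \<Rightarrow> ('n \<times> 'n) free \<Rightarrow> ('n \<times> 'n) free set" where
  "D_cls R = cls UNIV (D_rels R)"

definition double_cls ::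
  "'n :: finite op2 \<Rightarrow> ('n \<times> 'n + 'n \<times> 'n) free \<Rightarrow> ('n \<times> 'n + 'n \<times> 'n) free set" where
  "double_cls R = cls UNIV (double_rels R)"


section \<open>The action\<close>

text \<open>The algebra morphism to the complex numbers that kills all generators. It vanishes on
  \<^term>\<open>D_rels R\<close>, whose elements are homogeneous of degree 2, so it descends to \<open>\<D>(R\<^sup>-\<^sup>1)\<close>.\<close>

definition counit :: "'g free \<Rightarrow> complex" where
  "counit x = Poly_Mapping.lookup x []"

text \<open>\<open>reorders R x y ps\<close>: in the double, the product of \<open>x \<in> \<D>(R\<^sup>-\<^sup>1)\<close> and \<open>y \<in> \<M>(R)\<close> equals
  the sum of the products \<open>b a\<close> over the pairs \<open>(b, a)\<close> in \<open>ps\<close>, where \<open>b \<in> \<M>(R)\<close> and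
  \<open>a \<in> \<D>(R\<^sup>-\<^sup>1)\<close>.\<close>

definition reorders :: "'n :: finite op2 \<Rightarrow> ('n \<times> 'n) free \<Rightarrow> ('n \<times> 'n) free \<Rightarrow>
    (('n \<times> 'n) free \<times> ('n \<times> 'n) free) list \<Rightarrow> bool" where
  "reorders R x y ps \<longleftrightarrow>
    double_cls R (relabel Inr x * relabel Inl y) =
    double_cls R (\<Sum>(b, a)\<leftarrow>ps. relabel Inl b * relabel Inr a)"

definition act ::
  "'n :: finite op2 \<Rightarrow> ('n \<times> 'n) free set \<Rightarrow> ('n \<times> 'n) free set \<Rightarrow> ('n \<times> 'n) free set" where
  "act R a b = (THE c. \<exists>x\<in>a. \<exists>y\<in>b. \<exists>ps. reorders R x y ps \<and>
     c = M_cls R (\<Sum>(b', a')\<leftarrow>ps. const (counit a') * b'))"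


section \<open>Hecke algebra, characteristic subalgebra, quantum Laplace operators\<close>

text \<open>The letter \<open>i\<close> stands for the generator with index \<open>i + 1\<close>.\<close>

definition hecke_letters :: "nat \<Rightarrow> nat set" where
  "hecke_letters n = {i. Suc i < n}"

definition hecke_rels :: "complex \<Rightarrow> nat \<Rightarrow> nat free set" where
  "hecke_rels q n =
    {gen i * gen (Suc i) * gen i - gen (Suc i) * gen i * gen (Suc i) | i. Suc i \<in> hecke_letters n} \<union>
    {gen i * gen j - gen j * gen i | i j.
       i \<in> hecke_letters n \<and> j \<in> hecke_letters n \<and> (i + 2 \<le> j \<or> j + 2 \<le> i)} \<union>
    {(const q - gen i) * (const (inverse q) + gen i) | i. i \<in> hecke_letters n}"

definition hecke_alg :: "complex \<Rightarrow> nat \<Rightarrow> nat free set ring" where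
  "hecke_alg q n = presented (hecke_letters n) (hecke_rels q n)"

text \<open>The value of a noncommutative polynomial at the operators \<open>R\<^sub>1, \<dots>, R\<^sub>n\<^sub>-\<^sub>1\<close>.\<close>

definition poly_at :: "'n :: finite op2 \<Rightarrow> nat \<Rightarrow> nat free \<Rightarrow> ('n, complex) tmat" where
  "poly_at R n Q u v = (\<Sum>w\<in>Poly_Mapping.keys Q.
     Poly_Mapping.lookup Q w * tprod n (map (\<lambda>i. leg2 n i R) w) u v)"

text \<open>For a Hecke symmetry \<open>R\<close> the polynomials in a class \<open>z\<close> all have the same value.\<close>

definition hecke_rep :: "'n :: finite op2 \<Rightarrow> nat \<Rightarrow> nat free set \<Rightarrow> ('n, complex) tmat" where
  "hecke_rep R n z = the_elem (poly_at R n ` z)"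

definition ch :: "'n :: finite op2 \<Rightarrow> nat \<Rightarrow> nat free set \<Rightarrow> ('n \<times> 'n) free set" where
  "ch R n z = M_cls R (trR R n (tmul n (lift (hecke_rep R n z)) (bar_prod n R (gen_mat id) n)))"

inductive_set char_subalg :: "complex \<Rightarrow> 'n :: finite op2 \<Rightarrow> ('n \<times> 'n) free set set"
  for q :: complex and R :: "'n :: finite op2" where
  unit: "\<one>\<^bsub>M_alg R\<^esub> \<in> char_subalg q R"
| char: "n \<ge> 1 \<Longrightarrow> z \<in> carrier (hecke_alg q n) \<Longrightarrow> ch R n z \<in> char_subalg q R"
| add: "x \<in> char_subalg q R \<Longrightarrow> y \<in> char_subalg q R \<Longrightarrow> x \<oplus>\<^bsub>M_alg R\<^esub> y \<in> char_subalg q R"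
| scale: "x \<in> char_subalg q R \<Longrightarrow> M_cls R (const c) \<otimes>\<^bsub>M_alg R\<^esub> x \<in> char_subalg q R"

definition laplace :: "'n :: finite op2 \<Rightarrow> nat \<Rightarrow> nat free \<Rightarrow> ('n \<times> 'n) free set" where
  "laplace R m Q = D_cls R (trR R m (tmul m (lift (poly_at R m Q)) (bar_prod m R (gen_mat id) m)))"

end

theory Submission
  imports Defs
begin

text \<open>Both characters and Laplace operators are R-traces of products of copies of a matrix. The
  R-trace of \<open>z M\<^sub>1 \<cdots> M\<^sub>n\<close> does not change when all factors are moved \<open>m\<close> places to the right,
  so that \<open>D\<^sub>Q \<triangleright> ch\<^sub>n(z)\<close> is a single R-trace over \<open>m + n\<close> factors of
  \<open>Q z\<up>\<^sup>m D\<^sub>1 \<cdots> D\<^sub>m \<triangleright> M\<^sub>m\<^sub>+\<^sub>1 \<cdots> M\<^sub>m\<^sub>+\<^sub>n\<close>. Moving the \<open>D\<close>'s to the right by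
  \<open>D\<^sub>1 M\<^sub>a\<^sub>+\<^sub>1 = M\<^sub>a\<^sub>+\<^sub>1 D\<^sub>1 x + y\<close> with \<open>x, y\<close> in the Hecke algebra leaves terms
  \<open>g M\<^sub>1 \<cdots> M\<^sub>n\<^sub>-\<^sub>m h\<close> with \<open>g, h\<close> in the Hecke algebra of \<open>m + n\<close> strands. The R-trace is cyclic
  with respect to the Hecke algebra, and its partial traces map Hecke algebras to smaller Hecke
  algebras, so the result is a combination of characters of degree \<open>n - m\<close>.

  The computations take place in the ring of linear operators on functions from index sequences
  to a free algebra. It contains matrix units for every tensor factor, so all operators of the
  tower live in one ring and no size of a tensor power has to be fixed. The action is well
  defined because the permutation relations, solved for \<open>\<partial> m\<close> by means of the skew inverse, define
  operators on the free algebra that satisfy the relations of \<open>\<D>(R\<^sup>-\<^sup>1)\<close> and preserve the ideal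
  of relations of \<open>\<M>(R)\<close>.\<close>

section \<open>Evaluation of noncommutative polynomials\<close>

text \<open>The action is a definite description over all reorderings, so it has a value only if
  every product can be reordered and all reorderings agree modulo the relations of M(R). Agreement
  is the hard half. The derivatives are defined on the free algebra, where recursion over words
  always succeeds, and compatibility is proved afterwards: the reflection relation of D is moved
  through further copies of M until it meets the vacuum, and that of M is kept in the ideal when a
  derivative passes it. In both computations the inhomogeneous terms of the permutation relation
  cancel by the Hecke relation \<open>t i = t' i + cst lam\<close>, where \<open>lam\<close> is q -
  q^-1.

  Two consequences of skew invertibility carry the traces: Tr_2(C_2 R) is the identity, which keeps
  partial traces of Hecke elements inside the Hecke algebra, and conjugation by R moves a weighted
  trace from one factor to its neighbour. Degree counting leaves two boundary cases: for m > n only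
  operators that kill the vacuum remain, and for m = n a scalar remains, which is a multiple of the
  unit.\<close>

lemma free_induct [case_names zero monom add]:
  fixes x :: "'g free"
  assumes "P 0" "\<And>w c. P (Poly_Mapping.single w c)" "\<And>x y. P x \<Longrightarrow> P y \<Longrightarrow> P (x + y)"
  shows "P x"
proof -
  have "x = (\<Sum>w\<in>Poly_Mapping.keys x. Poly_Mapping.single w (Poly_Mapping.lookup x w))"
    by (rule poly_mapping_eqI) (auto simp: lookup_sum lookup_single when_def in_keys_iff)
  moreover have "P (\<Sum>w\<in>A. Poly_Mapping.single w (Poly_Mapping.lookup x w))" if "finite A" for A
    using that by induction (auto intro: assms)
  ultimately show ?thesis by (metis finite_keys)
qed

lemma free_on_induct [consumes 1, case_names zero monom add]:
  fixes x :: "'g free"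
  assumes "x \<in> free_on A"
    and "P 0" "\<And>w c. set w \<subseteq> A \<Longrightarrow> P (Poly_Mapping.single w c)"
    and "\<And>x y. P x \<Longrightarrow> P y \<Longrightarrow> P (x + y)"
  shows "P x"
proof -
  have x: "x = (\<Sum>w\<in>Poly_Mapping.keys x. Poly_Mapping.single w (Poly_Mapping.lookup x w))"
    by (rule poly_mapping_eqI) (auto simp: lookup_sum lookup_single when_def in_keys_iff)
  have "P (\<Sum>w\<in>B. Poly_Mapping.single w (Poly_Mapping.lookup x w))"
    if "finite B" "B \<subseteq> Poly_Mapping.keys x" for B
    using that assms(1) by induction (auto intro: assms(2-) simp: free_on_def)
  with x show ?thesis by (metis finite_keys order_refl)
qed

lemma const_add: "const (a + b) = const a + const b"
  by (simp add: const_def single_add)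

lemma const_mult: "const (a * b) = const a * const b"
  by (simp add: const_def mult_single plus_list_def)

lemma const_1 [simp]: "const 1 = 1"
  by (metis const_def single_one zero_list_def)

lemma const_0 [simp]: "const 0 = 0"
  by (simp add: const_def)

lemma const_central: "const c * x = x * const c"
  by (induction x rule: free_induct)
    (auto simp: const_def mult_single plus_list_def algebra_simps)

lemma const_mult_single: "const c * Poly_Mapping.single w d = Poly_Mapping.single w (c * d)"
  by (simp add: const_def mult_single plus_list_def)

lemma single_conv_const: "Poly_Mapping.single w c = const c * Poly_Mapping.single w 1"
  by (simp add: const_def mult_single plus_list_def)

lemma single_Cons_conv: "Poly_Mapping.single (g # w) c = gen g * Poly_Mapping.single w c"
  by (simp add: gen_def mult_single plus_list_def)

lemma lookup_const_mult: "Poly_Mapping.lookup (const c * x) w = c * Poly_Mapping.lookup x w"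
  by (induction x rule: free_induct)
    (auto simp: const_mult_single lookup_single when_def lookup_add algebra_simps)

lemma free_gen_induct [case_names zero one scale gen add]:
  fixes x :: "'g free"
  assumes "P 0" "P 1" "\<And>c x. P x \<Longrightarrow> P (const c * x)" "\<And>g x. P x \<Longrightarrow> P (gen g * x)"
    and "\<And>x y. P x \<Longrightarrow> P y \<Longrightarrow> P (x + y)"
  shows "P x"
proof (induction x rule: free_induct)
  case (monom w c)
  have "P (Poly_Mapping.single w 1)"
  proof (induction w)
    case Nil
    with assms(2) show ?case by (metis const_1 const_def)
  qed (simp add: single_Cons_conv assms)
  then show ?case by (subst single_conv_const) (rule assms)
qed (use assms in auto)

section \<open>Complex algebras, given as rings with a central copy of the scalars\<close>

locale central_scalars =
  fixes cst :: "complex \<Rightarrow> 't :: ring_1"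
  assumes cst_add: "cst (a + b) = cst a + cst b"
    and cst_mult: "cst (a * b) = cst a * cst b"
    and cst_1 [simp]: "cst 1 = 1"
    and cst_central: "cst a * x = x * cst a"
begin

lemma cst_0 [simp]: "cst 0 = 0"
  using cst_add[of 0 0] by simp

lemma cst_minus: "cst (- a) = - cst a"
  using cst_add[of a "- a"] by (simp add: eq_neg_iff_add_eq_0 add.commute)

lemma cst_diff: "cst (a - b) = cst a - cst b"
  using cst_add[of a "- b"] by (simp add: cst_minus)

lemma cst_sum: "cst (sum f A) = (\<Sum>x\<in>A. cst (f x))"
  by (induction A rule: infinite_finite_induct) (auto simp: cst_add)

lemma cst_left_commute: "x * (cst a * y) = cst a * (x * y)"
  by (metis cst_central mult.assoc)

definition ev :: "('g \<Rightarrow> 't) \<Rightarrow> 'g free \<Rightarrow> 't" where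
  "ev g x = (\<Sum>w\<in>Poly_Mapping.keys x. cst (Poly_Mapping.lookup x w) * prod_list (map g w))"

lemma ev_superset:
  assumes "finite A" "Poly_Mapping.keys x \<subseteq> A"
  shows "ev g x = (\<Sum>w\<in>A. cst (Poly_Mapping.lookup x w) * prod_list (map g w))"
  unfolding ev_def using assms by (intro sum.mono_neutral_left) (auto simp: in_keys_iff)

lemma ev_add: "ev g (x + y) = ev g x + ev g y"
proof -
  let ?A = "Poly_Mapping.keys x \<union> Poly_Mapping.keys y"
  have "Poly_Mapping.keys (x + y) \<subseteq> ?A" by (rule Poly_Mapping.keys_add)
  then show ?thesis
    by (simp add: ev_superset[of ?A] lookup_add cst_add sum.distrib ring_distribs)
qed

lemma ev_0 [simp]: "ev g 0 = 0"
  by (simp add: ev_def)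

lemma ev_minus: "ev g (- x) = - ev g x"
  using ev_add[of g x "- x"] by (simp add: eq_neg_iff_add_eq_0 add.commute)

lemma ev_diff: "ev g (x - y) = ev g x - ev g y"
  using ev_add[of g x "- y"] by (simp add: ev_minus)

lemma ev_sum: "ev g (sum f A) = (\<Sum>a\<in>A. ev g (f a))"
  by (induction A rule: infinite_finite_induct) (auto simp: ev_add)

lemma ev_single: "ev g (Poly_Mapping.single w c) = cst c * prod_list (map g w)"
  by (cases "c = 0") (auto simp: ev_def)

lemma ev_const [simp]: "ev g (const c) = cst c"
  by (simp add: const_def ev_single)

lemma ev_1 [simp]: "ev g 1 = 1"
  by (metis ev_const const_1 cst_1)

lemma ev_gen [simp]: "ev g (gen i) = g i"
  by (simp add: gen_def ev_single)

lemma ev_mult: "ev g (x * y) = ev g x * ev g y"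
proof (induction x rule: free_induct)
  case (monom w c)
  show ?case
  proof (induction y rule: free_induct)
    case (monom v d)
    have "(cst c * prod_list (map g w)) * (cst d * prod_list (map g v)) =
        cst c * cst d * (prod_list (map g w) * prod_list (map g v))"
      by (metis cst_left_commute mult.assoc)
    then show ?case
      by (simp add: mult_single ev_single plus_list_def cst_mult)
  qed (auto simp: algebra_simps ev_add)
qed (auto simp: algebra_simps ev_add)

text \<open>Universal property of the free algebra. It recognises a concretely given morphism, such
  as left multiplication or a relabelling, as an evaluation.\<close>

lemma ev_unique:
  assumes "\<And>x y. f (x + y) = f x + f y" "\<And>x y. f (x * y) = f x * f y"
    and "\<And>c. f (const c) = cst c" "\<And>i. f (gen i) = g i"
  shows "f x = ev g x"
proof (induction x rule: free_gen_induct)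
  case zero
  show ?case using assms(3)[of 0] by simp
next
  case one
  show ?case using assms(3)[of 1] by simp
qed (auto simp: assms ev_add ev_mult)

end

interpretation const: central_scalars const
  by unfold_locales (rule const_add const_mult const_1 const_central)+

lemma relabel_conv: "relabel f x = const.ev (\<lambda>g. gen (f g)) x"
proof -
  have "Poly_Mapping.single (map f w) 1 = prod_list (map (\<lambda>g. gen (f g)) w)" for w
    by (induction w) (auto simp: single_Cons_conv const_def[symmetric])
  then have "Poly_Mapping.single (map f w) c = const c * prod_list (map (\<lambda>g. gen (f g)) w)" for w c
    by (subst single_conv_const) simp
  then show ?thesis
    by (simp add: relabel_def const.ev_def)
qed

lemma (in central_scalars) ev_relabel: "ev g (relabel f x) = ev (\<lambda>i. g (f i)) x"
  by (rule ev_unique) (auto simp: relabel_conv const.ev_add const.ev_mult ev_add ev_mult)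

section \<open>Matrix units and partial traces\<close>

text \<open>Only the coefficients of the left factor have to pass matrix units, so nothing is asked
  of \<open>Y\<close>. The computation serves pairs of indices (\<open>Op_mult\<close>) and index
  lists (\<open>J_mult\<close>) alike.\<close>

lemma matrix_units_mult:
  fixes u :: "'i \<Rightarrow> 'i \<Rightarrow> 't :: ring"
  assumes "finite I"
    and u: "\<And>a b c d. a \<in> I \<Longrightarrow> b \<in> I \<Longrightarrow> c \<in> I \<Longrightarrow> d \<in> I \<Longrightarrow>
      u a b * u c d = (if b = c then u a d else 0)"
    and X: "\<And>a b c d. a \<in> I \<Longrightarrow> b \<in> I \<Longrightarrow> c \<in> I \<Longrightarrow> d \<in> I \<Longrightarrow> X a b * u c d = u c d * X a b"
  shows "(\<Sum>a\<in>I. \<Sum>b\<in>I. u a b * X a b) * (\<Sum>c\<in>I. \<Sum>d\<in>I. u c d * Y c d) =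
    (\<Sum>a\<in>I. \<Sum>d\<in>I. u a d * (\<Sum>b\<in>I. X a b * Y b d))"
proof -
  have "u a b * X a b * (\<Sum>c\<in>I. \<Sum>d\<in>I. u c d * Y c d) = (\<Sum>d\<in>I. u a d * (X a b * Y b d))"
    if "a \<in> I" "b \<in> I" for a b
  proof -
    have "u a b * X a b * (u c d * Y c d) = (if b = c then u a d * (X a b * Y c d) else 0)"
      if "c \<in> I" "d \<in> I" for c d
    proof -
      have "u a b * X a b * (u c d * Y c d) = u a b * (X a b * u c d) * Y c d"
        by (simp only: mult.assoc)
      also have "\<dots> = (u a b * u c d) * (X a b * Y c d)"
        using X[OF \<open>a \<in> I\<close> \<open>b \<in> I\<close> that] by (simp only: mult.assoc)
      finally show ?thesis using u \<open>a \<in> I\<close> \<open>b \<in> I\<close> that by simp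
    qed
    then have "u a b * X a b * (\<Sum>c\<in>I. \<Sum>d\<in>I. u c d * Y c d) =
        (\<Sum>c\<in>I. \<Sum>d\<in>I. if b = c then u a d * (X a b * Y c d) else 0)"
      by (simp add: sum_distrib_left)
    also have "\<dots> = (\<Sum>d\<in>I. \<Sum>c\<in>I. if b = c then u a d * (X a b * Y c d) else 0)"
      by (rule sum.swap)
    finally show ?thesis using that assms(1) by simp
  qed
  then have "(\<Sum>a\<in>I. \<Sum>b\<in>I. u a b * X a b) * (\<Sum>c\<in>I. \<Sum>d\<in>I. u c d * Y c d) =
      (\<Sum>a\<in>I. \<Sum>b\<in>I. \<Sum>d\<in>I. u a d * (X a b * Y b d))"
    by (simp add: sum_distrib_right)
  also have "\<dots> = (\<Sum>a\<in>I. \<Sum>d\<in>I. u a d * (\<Sum>b\<in>I. X a b * Y b d))"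
    by (simp add: sum_distrib_left) (intro sum.cong refl sum.swap)
  finally show ?thesis .
qed

lemma commute_mult:
  fixes X :: "'t :: semigroup_mult"
  assumes "a * X = X * a" "b * X = X * b"
  shows "a * b * X = X * (a * b)"
  by (metis assms mult.assoc)

lemma sum_UNIV_prod: "(\<Sum>a\<in>UNIV. f a) = (\<Sum>x\<in>UNIV. \<Sum>y\<in>UNIV. f (x, y))"
  by (simp add: sum.cartesian_product flip: UNIV_Times_UNIV)

lemma finite_lists_len [simp]: "finite {u :: 'n :: finite list. length u = k}"
  using finite_lists_length_eq[of "UNIV :: 'n set" k] by simp

lemma sum_lists_0: "(\<Sum>u | length u = 0. f u) = f []"
proof -
  have "{u :: 'a list. length u = 0} = {[]}" by auto
  then show ?thesis by simp
qed

lemma sum_lists_Suc: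
  fixes f :: "'n :: finite list \<Rightarrow> 'b :: comm_monoid_add"
  shows "(\<Sum>u | length u = Suc k. f u) = (\<Sum>x\<in>UNIV. \<Sum>u | length u = k. f (x # u))"
proof -
  have "{u :: 'n list. length u = Suc k} = (\<lambda>(x, u). x # u) ` (UNIV \<times> {u. length u = k})"
    by (auto simp: length_Suc_conv image_iff)
  then have "(\<Sum>u | length u = Suc k. f u) =
      (\<Sum>p\<in>UNIV \<times> {u :: 'n list. length u = k}. f ((\<lambda>(x, u). x # u) p))"
    by (simp add: sum.reindex inj_on_def)
  then show ?thesis
    by (simp add: sum.cartesian_product case_prod_unfold)
qed

lemma sum_eq_single:
  assumes "finite A" "a \<in> A" "\<And>x. x \<in> A \<Longrightarrow> x \<noteq> a \<Longrightarrow> f x = 0"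
  shows "sum f A = f a"
  using assms by (subst sum.mono_neutral_right[of A "{a}"]) auto

text \<open>The factors act on different legs, so their product is a tensor power of
  \<open>C\<close>. Peeling off the leftmost factor calls for the generalization to the legs from
  \<open>j\<close> on, where the indices below \<open>j\<close> must agree.\<close>

lemma tprod_leg1:
  fixes C :: "'n :: finite \<Rightarrow> 'n \<Rightarrow> complex"
  assumes "length u = n" "length v = n"
  shows "tprod n (map (\<lambda>i. leg1 n i C) [0..<n]) u v = (\<Prod>i<n. C (u ! i) (v ! i))"
proof -
  have "tprod n (map (\<lambda>i. leg1 n i C) [j..<n]) u v =
      (if \<forall>p<j. u ! p = v ! p then \<Prod>i\<in>{j..<n}. C (u ! i) (v ! i) else 0)"
    if "j \<le> n" "length u = n" "length v = n" for j u v
    using that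
  proof (induction j arbitrary: u rule: inc_induct)
    case base
    then show ?case by (auto simp: tprod_def tid_def list_eq_iff_nth_eq)
  next
    case (step j)
    let ?P = "tprod n (map (\<lambda>i. leg1 n i C) [Suc j..<n])"
    have "tprod n (map (\<lambda>i. leg1 n i C) [j..<n]) u v =
        (\<Sum>w | length w = n. leg1 n j C u w * ?P w v)"
      using step.hyps by (simp add: upt_conv_Cons tprod_def tmul_def)
    \<comment> \<open>The only intermediate index with a nonzero contribution agrees with
      \<open>u\<close> off leg \<open>j\<close> and with \<open>v\<close> on it.\<close>
    also have "\<dots> = leg1 n j C u (u[j := v ! j]) * ?P (u[j := v ! j]) v"
    proof (rule sum_eq_single)
      fix w assume w: "w \<in> {w. length w = n}" "w \<noteq> u[j := v ! j]"
      then obtain p where p: "p < n" "w ! p \<noteq> u[j := v ! j] ! p"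
        using step.prems by (auto simp: list_eq_iff_nth_eq)
      show "leg1 n j C u w * ?P w v = 0"
      proof (cases "p = j")
        case True
        with p w step show ?thesis by auto
      next
        case False
        with p w step show ?thesis by (auto simp: leg1_def)
      qed
    qed (use step.prems in auto)
    also have "\<dots> = (if \<forall>p<j. u ! p = v ! p then \<Prod>i\<in>{j..<n}. C (u ! i) (v ! i) else 0)"
    proof -
      have eq: "(\<Prod>i\<in>{Suc j..<n}. C (u[j := v ! j] ! i) (v ! i)) =
          (\<Prod>i\<in>{Suc j..<n}. C (u ! i) (v ! i))"
        by (intro prod.cong) auto
      have iff: "(\<forall>p<Suc j. u[j := v ! j] ! p = v ! p) \<longleftrightarrow> (\<forall>p<j. u ! p = v ! p)"
        using step.hyps step.prems by (auto simp: less_Suc_eq nth_list_update)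
      have "?P (u[j := v ! j]) v =
          (if \<forall>p<j. u ! p = v ! p then \<Prod>i\<in>{Suc j..<n}. C (u ! i) (v ! i) else 0)"
        using step.IH[of "u[j := v ! j]"] step.prems by (simp only: iff eq length_list_update)
      moreover have "leg1 n j C u (u[j := v ! j]) = C (u ! j) (v ! j)"
        using step.hyps step.prems by (auto simp: leg1_def)
      ultimately show ?thesis
        using step.hyps by (auto simp: prod.atLeast_Suc_lessThan)
    qed
    finally show ?case .
  qed
  from this[of 0 u v] assms show ?thesis by (simp add: atLeast0LessThan)
qed

section \<open>Commuting families of matrix units and weighted partial traces\<close>

locale unit_tower = central_scalars cst for cst :: "complex \<Rightarrow> 't :: ring_1" +
  fixes e :: "nat \<Rightarrow> 'n :: finite \<Rightarrow> 'n \<Rightarrow> 't"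
  assumes e_mult: "e k x y * e k z w = (if y = z then e k x w else 0)"
    and e_comm: "k \<noteq> l \<Longrightarrow> e k x y * e l z w = e l z w * e k x y"
    and e_sum: "(\<Sum>x\<in>UNIV. e k x x) = 1"
begin

text \<open>Commuting with all matrix units of factor \<open>k\<close> means acting trivially on
  that factor. This replaces any record of the legs that an operator touches.\<close>

definition away :: "nat \<Rightarrow> 't \<Rightarrow> bool" where
  "away k X \<longleftrightarrow> (\<forall>x y. e k x y * X = X * e k x y)"

lemma away_0 [simp]: "away k 0" and away_1 [simp]: "away k 1"
  and away_cst [simp]: "away k (cst c)"
  by (auto simp: away_def cst_central)

lemma away_add: "away k X \<Longrightarrow> away k Y \<Longrightarrow> away k (X + Y)"
  and away_diff: "away k X \<Longrightarrow> away k Y \<Longrightarrow> away k (X - Y)"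
  by (auto simp: away_def algebra_simps)

lemma away_left_commute: "away k A \<Longrightarrow> e k x y * (A * Z) = A * (e k x y * Z)"
  by (simp add: away_def flip: mult.assoc)

lemma away_mult: "away k X \<Longrightarrow> away k Y \<Longrightarrow> away k (X * Y)"
  unfolding away_def[of k "X * Y"] by (simp add: away_left_commute) (simp add: away_def mult.assoc)

lemma away_sum: "(\<And>a. a \<in> A \<Longrightarrow> away k (f a)) \<Longrightarrow> away k (sum f A)"
  by (auto simp: away_def sum_distrib_left sum_distrib_right)

lemma away_e: "k \<noteq> l \<Longrightarrow> away k (e l x y)"
  by (auto simp: away_def e_comm)

text \<open>These elements act trivially on every factor; they serve as the entries of
  matrices.\<close>

definition com :: "'t \<Rightarrow> bool" where
  "com X \<longleftrightarrow> (\<forall>k. away k X)"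

lemma com_0 [simp]: "com 0" and com_1 [simp]: "com 1" and com_cst [simp]: "com (cst c)"
  by (auto simp: com_def)

lemma com_mult: "com X \<Longrightarrow> com Y \<Longrightarrow> com (X * Y)"
  and com_add: "com X \<Longrightarrow> com Y \<Longrightarrow> com (X + Y)"
  and com_sum: "(\<And>a. a \<in> A \<Longrightarrow> com (f a)) \<Longrightarrow> com (sum f A)"
  by (auto simp: com_def away_mult away_add away_sum)

lemma com_e: "com X \<Longrightarrow> X * e k x y = e k x y * X"
  by (simp add: com_def away_def)

text \<open>The sum over \<open>a\<close> of \<open>e k a y * X * e k x a\<close> is the entry of
  \<open>X\<close> in row \<open>y\<close> and column \<open>x\<close> of factor \<open>k\<close>,
  so this is Tr_k(C_k X) formed inside the ring.\<close>

definition ptr :: "('n \<Rightarrow> 'n \<Rightarrow> complex) \<Rightarrow> nat \<Rightarrow> 't \<Rightarrow> 't" where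
  "ptr C k X = (\<Sum>a\<in>UNIV. \<Sum>x\<in>UNIV. \<Sum>y\<in>UNIV. cst (C x y) * (e k a y * X * e k x a))"

lemma ptr_add: "ptr C k (X + Y) = ptr C k X + ptr C k Y"
  by (simp add: ptr_def algebra_simps sum.distrib)

lemma ptr_0 [simp]: "ptr C k 0 = 0"
  by (simp add: ptr_def)

lemma ptr_sum: "ptr C k (sum f A) = (\<Sum>a\<in>A. ptr C k (f a))"
  by (induction A rule: infinite_finite_induct) (auto simp: ptr_add)

lemma ptr_left: "away k A \<Longrightarrow> ptr C k (A * X) = A * ptr C k X"
proof -
  assume A: "away k A"
  have "cst c * (e k a y * (A * X) * e k x b) = A * (cst c * (e k a y * X * e k x b))" for c a y x b
    by (simp only: cst_left_commute[of A] mult.assoc away_left_commute[OF A])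
  then show ?thesis by (simp add: ptr_def sum_distrib_left)
qed

lemma ptr_right: "away k A \<Longrightarrow> ptr C k (X * A) = ptr C k X * A"
proof -
  assume A: "away k A"
  have "cst c * (e k a y * (X * A) * e k x b) = (cst c * (e k a y * X * e k x b)) * A" for c a y x b
    using A by (simp add: away_def mult.assoc)
  then show ?thesis by (simp add: ptr_def sum_distrib_right)
qed

lemma ptr_cst: "ptr C k (cst c * X) = cst c * ptr C k X"
  by (simp add: ptr_left)

lemma ptr_one: "ptr C k 1 = (\<Sum>x\<in>UNIV. cst (C x x))"
proof -
  have "ptr C k 1 = (\<Sum>a\<in>UNIV. \<Sum>x\<in>UNIV. cst (C x x) * e k a a)"
    by (simp add: ptr_def e_mult if_distrib cong: if_cong)
  also have "\<dots> = (\<Sum>x\<in>UNIV. cst (C x x)) * (\<Sum>a\<in>UNIV. e k a a)"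
    by (simp add: sum_product) (rule sum.swap)
  finally show ?thesis by (simp add: e_sum)
qed

lemma ptr_unit:
  assumes "away k Y" shows "ptr C k (e k x y * Y) = cst (C y x) * Y"
proof -
  have "cst (C p r) * (e k a r * e k x y * e k p a) =
      (if r = x then if y = p then cst (C y x) * e k a a else 0 else 0)" for a p r
    by (simp add: e_mult)
  then have "ptr C k (e k x y) = (\<Sum>a\<in>UNIV. cst (C y x) * e k a a)"
    by (simp add: ptr_def)
  also have "\<dots> = cst (C y x)"
    by (simp add: sum_distrib_left[symmetric] e_sum)
  finally show ?thesis by (simp add: ptr_right assms)
qed

text \<open>A matrix unit multiplied from either side collapses the sum over \<open>a\<close> to the
  same expression \<open>?S\<close>.\<close>

lemma away_ptr: "away k (ptr C k X)"
proof -
  let ?S = "\<lambda>z w. \<Sum>x\<in>UNIV. \<Sum>y\<in>UNIV. cst (C x y) * (e k z y * X * e k x w)"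
  have "e k z w * ptr C k X = ?S z w" for z w
  proof -
    have "e k z w * (cst (C x y) * (e k a y * X * e k x a)) =
        (if w = a then cst (C x y) * (e k z y * X * e k x w) else 0)" for x y a
    proof -
      have "e k z w * (cst (C x y) * (e k a y * X * e k x a)) =
          cst (C x y) * ((e k z w * e k a y) * X * e k x a)"
        by (simp only: cst_left_commute[of "e k z w"] mult.assoc)
      then show ?thesis by (simp add: e_mult)
    qed
    then have "e k z w * (\<Sum>x\<in>UNIV. \<Sum>y\<in>UNIV. cst (C x y) * (e k a y * X * e k x a)) =
        (if w = a then ?S z w else 0)" for a
      by (simp add: sum_distrib_left)
    then show ?thesis by (simp add: ptr_def sum_distrib_left[of _ _ UNIV])
  qed
  moreover have "ptr C k X * e k z w = ?S z w" for z w
  proof -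
    have "(cst (C x y) * (e k a y * X * e k x a)) * e k z w =
        (if a = z then cst (C x y) * (e k z y * X * e k x w) else 0)" for x y a
      by (simp add: e_mult mult.assoc)
    then have "(\<Sum>x\<in>UNIV. \<Sum>y\<in>UNIV. cst (C x y) * (e k a y * X * e k x a)) * e k z w =
        (if a = z then ?S z w else 0)" for a
      by (simp add: sum_distrib_right)
    then show ?thesis by (simp add: ptr_def sum_distrib_right[of _ UNIV])
  qed
  ultimately show ?thesis by (simp add: away_def)
qed

lemma away_ptr_other: "k \<noteq> l \<Longrightarrow> away k X \<Longrightarrow> away k (ptr C l X)"
  unfolding ptr_def by (intro away_sum away_mult away_e away_cst)

primrec Tr :: "('n \<Rightarrow> 'n \<Rightarrow> complex) \<Rightarrow> nat \<Rightarrow> nat \<Rightarrow> 't \<Rightarrow> 't" where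
  "Tr C p 0 X = X"
| "Tr C p (Suc n) X = ptr C p (Tr C (Suc p) n X)"

lemma Tr_add: "Tr C p n (X + Y) = Tr C p n X + Tr C p n Y"
  by (induction n arbitrary: p) (auto simp: ptr_add)

lemma Tr_0 [simp]: "Tr C p n 0 = 0"
  by (induction n arbitrary: p) auto

lemma Tr_sum: "Tr C p n (sum f A) = (\<Sum>a\<in>A. Tr C p n (f a))"
  by (induction A rule: infinite_finite_induct) (auto simp: Tr_add)

lemma Tr_left: "(\<And>k. p \<le> k \<Longrightarrow> k < p + n \<Longrightarrow> away k A) \<Longrightarrow> Tr C p n (A * X) = A * Tr C p n X"
  by (induction n arbitrary: p) (auto simp: ptr_left)

lemma Tr_right: "(\<And>k. p \<le> k \<Longrightarrow> k < p + n \<Longrightarrow> away k A) \<Longrightarrow> Tr C p n (X * A) = Tr C p n X * A"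
  by (induction n arbitrary: p) (auto simp: ptr_right)

lemma Tr_append: "Tr C p (m + n) X = Tr C p m (Tr C (p + m) n X)"
  by (induction m arbitrary: p) auto

lemma away_Tr_inside: "p \<le> k \<Longrightarrow> k < p + n \<Longrightarrow> away k (Tr C p n X)"
proof (induction n arbitrary: p)
  case (Suc n)
  then show ?case by (cases "k = p") (auto simp: away_ptr away_ptr_other)
qed auto

lemma away_Tr_outside: "k < p \<or> p + n \<le> k \<Longrightarrow> away k X \<Longrightarrow> away k (Tr C p n X)"
  by (induction n arbitrary: p) (auto intro!: away_ptr_other)

subsection \<open>Operators on two adjacent factors\<close>

definition e2 :: "nat \<Rightarrow> 'n \<times> 'n \<Rightarrow> 'n \<times> 'n \<Rightarrow> 't" where
  "e2 k a b = e k (fst a) (fst b) * e (Suc k) (snd a) (snd b)"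

definition Op :: "nat \<Rightarrow> ('n \<times> 'n \<Rightarrow> 'n \<times> 'n \<Rightarrow> 't) \<Rightarrow> 't" where
  "Op k X = (\<Sum>a\<in>UNIV. \<Sum>b\<in>UNIV. e2 k a b * X a b)"

definition op2 :: "nat \<Rightarrow> 'n op2 \<Rightarrow> 't" where
  "op2 k T = Op k (\<lambda>a b. cst (T $ a $ b))"

lemma e2_mult: "e2 k a b * e2 k c d = (if b = c then e2 k a d else 0)"
proof -
  have "e2 k a b * e2 k c d = (e k (fst a) (fst b) * e k (fst c) (fst d)) *
      (e (Suc k) (snd a) (snd b) * e (Suc k) (snd c) (snd d))"
    by (simp add: e2_def mult.assoc away_left_commute[OF away_e, of "Suc k" k])
  then show ?thesis by (auto simp: e_mult e2_def prod_eq_iff)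
qed

lemma com_e2: "com X \<Longrightarrow> X * e2 k a b = e2 k a b * X"
  unfolding e2_def by (rule commute_mult[symmetric]) (auto simp: com_e)

lemma e2_sum: "(\<Sum>a\<in>UNIV. e2 k a a) = 1"
proof -
  have "(\<Sum>a\<in>UNIV. e2 k a a) = (\<Sum>x\<in>UNIV. e k x x) * (\<Sum>x\<in>UNIV. e (Suc k) x x)"
    by (simp add: sum_product sum.cartesian_product case_prod_unfold e2_def)
  then show ?thesis by (simp add: e_sum)
qed

lemma Op_mult:
  assumes "\<And>a b. com (X a b)"
  shows "Op k X * Op k Y = Op k (\<lambda>a d. \<Sum>b\<in>UNIV. X a b * Y b d)"
  unfolding Op_def by (rule matrix_units_mult) (auto simp: e2_mult com_e2 assms)

lemma op2_mult: "op2 k (S ** T) = op2 k S * op2 k T"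
  unfolding op2_def by (subst Op_mult) (auto simp: matrix_matrix_mult_def cst_sum cst_mult)

lemma op2_one: "op2 k (mat 1) = 1"
proof -
  have "op2 k (mat 1) = (\<Sum>a\<in>UNIV. e2 k a a)"
    by (simp add: op2_def Op_def mat_def if_distrib[of cst] if_distrib[of "(*) _"] cong: if_cong)
  then show ?thesis by (simp add: e2_sum)
qed

lemma op2_add: "op2 k (S + T) = op2 k S + op2 k T"
  by (simp add: op2_def Op_def cst_add ring_distribs sum.distrib)

lemma away_e2: "l \<noteq> k \<Longrightarrow> l \<noteq> Suc k \<Longrightarrow> away l (e2 k a b)"
  unfolding e2_def by (intro away_mult away_e)

lemma away_op2: "l \<noteq> k \<Longrightarrow> l \<noteq> Suc k \<Longrightarrow> away l (op2 k T)"
  unfolding op2_def Op_def by (intro away_sum away_mult away_e2 away_cst)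

lemma com_op2: 
  assumes "away k X" "away (Suc k) X" shows "op2 k T * X = X * op2 k T"
proof -
  have "e2 k a b * cst c * X = X * (e2 k a b * cst c)" for a b c
    unfolding e2_def using assms by (intro commute_mult cst_central) (auto simp: away_def)
  then show ?thesis
    by (simp add: op2_def Op_def sum_distrib_left sum_distrib_right)
qed

lemma op2_far: "Suc k < l \<Longrightarrow> op2 k S * op2 l T = op2 l T * op2 k S"
  by (intro com_op2 away_op2) auto

text \<open>Reads off a matrix entry with respect to two adjacent factors, for arbitrary
  \<open>Z\<close>. As \<open>Z\<close> stands between matrix units, entries stay in every one-sided
  ideal that contains \<open>Z\<close> and is stable under matrix units on the other side; this is
  how relations are passed between operators and entries.\<close>

definition ent :: "nat \<Rightarrow> 't \<Rightarrow> 'n \<times> 'n \<Rightarrow> 'n \<times> 'n \<Rightarrow> 't" where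
  "ent k Z a b = (\<Sum>c\<in>UNIV. e2 k c a * Z * e2 k b c)"

lemma ent_Op:
  assumes "\<And>a b. com (X a b)"
  shows "ent k (Op k X) a b = X a b"
proof -
  have "e2 k c a * (e2 k p r * X p r) * e2 k b c =
      (if r = b then if p = a then e2 k c c * X a b else 0 else 0)" for c p r
  proof -
    have "e2 k c a * (e2 k p r * X p r) * e2 k b c = (e2 k c a * e2 k p r) * (X p r * e2 k b c)"
      by (simp only: mult.assoc)
    also have "\<dots> = (e2 k c a * e2 k p r * e2 k b c) * X p r"
      by (simp only: com_e2[OF assms] mult.assoc)
    finally show ?thesis by (auto simp: e2_mult)
  qed
  then have "ent k (Op k X) a b = (\<Sum>c\<in>UNIV. e2 k c c * X a b)"
    by (simp add: ent_def Op_def sum_distrib_left sum_distrib_right)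
  also have "\<dots> = X a b"
    by (simp add: sum_distrib_right[symmetric] e2_sum)
  finally show ?thesis .
qed

subsection \<open>Operators on several adjacent factors\<close>

fun eL :: "nat \<Rightarrow> 'n list \<Rightarrow> 'n list \<Rightarrow> 't" where
  "eL p [] [] = 1"
| "eL p (x # u) (y # v) = e p x y * eL (Suc p) u v"
| "eL p _ _ = 0"

lemma away_eL: "k < p \<Longrightarrow> away k (eL p u v)"
  by (induction p u v rule: eL.induct) (auto intro!: away_mult away_e)

lemma com_eL: "com X \<Longrightarrow> X * eL p u v = eL p u v * X"
proof (induction p u v rule: eL.induct)
  case (2 p x u y v)
  then show ?case unfolding eL.simps by (intro commute_mult[symmetric]) (auto simp: com_e)
qed auto

lemma eL_mult:
  assumes "length u = length v" "length w = length v" "length z = length v"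
  shows "eL p u v * eL p w z = (if v = w then eL p u z else 0)"
  using assms
proof (induction u v arbitrary: p w z rule: list_induct2)
  case (Cons x u y v)
  then obtain x' w' y' z' where wz: "w = x' # w'" "z = y' # z'"
    by (metis length_Suc_conv list.size(4) add.right_neutral add_Suc_right)
  have "eL p (x # u) (y # v) * eL p w z =
      e p x y * (eL (Suc p) u v * e p x' y') * eL (Suc p) w' z'"
    by (simp add: wz mult.assoc)
  also have "eL (Suc p) u v * e p x' y' = e p x' y' * eL (Suc p) u v"
    using away_eL[of p "Suc p" u v] by (simp add: away_def)
  finally have "eL p (x # u) (y # v) * eL p w z =
      (e p x y * e p x' y') * (eL (Suc p) u v * eL (Suc p) w' z')"
    by (simp only: mult.assoc)
  then show ?case using Cons by (auto simp: wz e_mult)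
qed auto

lemma eL_sum: "(\<Sum>u | length u = k. eL p u u) = 1"
proof (induction k arbitrary: p)
  case (Suc k)
  then show ?case by (simp add: sum_lists_Suc sum_distrib_left[symmetric] e_sum)
qed (simp add: sum_lists_0 del: length_0_conv)

text \<open>Places a matrix indexed by lists on the factors from \<open>p\<close> to
  \<open>p + k - 1\<close>. Its multiplicativity turns the matrix products of the definitions into
  products in the ring.\<close>

definition J :: "nat \<Rightarrow> nat \<Rightarrow> ('n, 't) tmat \<Rightarrow> 't" where
  "J p k X = (\<Sum>u | length u = k. \<Sum>v | length v = k. eL p u v * X u v)"

lemma J_cong:
  "(\<And>u v. length u = k \<Longrightarrow> length v = k \<Longrightarrow> X u v = Y u v) \<Longrightarrow> J p k X = J p k Y"
  unfolding J_def by (intro sum.cong refl) auto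

lemma J_mult:
  assumes "\<And>u v. com (X u v)"
  shows "J p k (tmul k X Y) = J p k X * J p k Y"
  unfolding J_def tmul_def
  by (rule matrix_units_mult[symmetric]) (auto simp: eL_mult com_eL assms)

lemma J_0: "J p 0 X = X [] []"
  by (simp add: J_def sum_lists_0 del: length_0_conv)

lemma J_Suc: "J p (Suc k) X = (\<Sum>x\<in>UNIV. \<Sum>y\<in>UNIV. e p x y * J (Suc p) k (\<lambda>u v. X (x # u) (y # v)))"
proof -
  have "J p (Suc k) X = (\<Sum>x\<in>UNIV. \<Sum>u | length u = k. \<Sum>y\<in>UNIV. \<Sum>v | length v = k.
      eL p (x # u) (y # v) * X (x # u) (y # v))"
    by (simp add: J_def sum_lists_Suc)
  also have "\<dots> = (\<Sum>x\<in>UNIV. \<Sum>y\<in>UNIV. \<Sum>u | length u = k. \<Sum>v | length v = k.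
      eL p (x # u) (y # v) * X (x # u) (y # v))"
    by (intro sum.cong refl sum.swap)
  finally show ?thesis by (simp add: J_def sum_distrib_left mult.assoc)
qed

lemma J_diag: "J p k (\<lambda>u v. if u = v then c else 0) = c"
proof -
  have "J p k (\<lambda>u v. if u = v then c else 0) = (\<Sum>u | length u = k. eL p u u * c)"
    by (simp add: J_def if_distrib cong: if_cong)
  then show ?thesis by (simp add: sum_distrib_right[symmetric] eL_sum)
qed

lemma J_one: "J p k (tid k) = 1"
  using J_diag[of p k 1] by (simp add: tid_def J_def cong: if_cong)

lemma J_tprod:
  assumes "\<And>X u v. X \<in> set Xs \<Longrightarrow> com (X u v)"
  shows "J p k (tprod k Xs) = prod_list (map (J p k) Xs)"
  using assms by (induction Xs) (auto simp: tprod_def J_one J_mult)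

lemma J_leg1: "J p (Suc k) (leg1 (Suc k) 0 X) = (\<Sum>x\<in>UNIV. \<Sum>y\<in>UNIV. e p x y * X x y)"
proof -
  have "J (Suc p) k (\<lambda>u v. leg1 (Suc k) 0 X (x # u) (y # v)) = X x y" for x y
  proof -
    have "J (Suc p) k (\<lambda>u v. leg1 (Suc k) 0 X (x # u) (y # v)) =
        J (Suc p) k (\<lambda>u v. if u = v then X x y else 0)"
    proof (rule J_cong)
      fix u v :: "'n list" assume "length u = k" "length v = k"
      then show "leg1 (Suc k) 0 X (x # u) (y # v) = (if u = v then X x y else 0)"
        by (auto simp: leg1_def list_eq_iff_nth_eq All_less_Suc2)
    qed
    then show ?thesis by (simp add: J_diag)
  qed
  then show ?thesis by (simp add: J_Suc)
qed

lemma J_leg2: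
  "Suc i < k \<Longrightarrow> J p k (\<lambda>u v. cst (leg2 k i T u v)) = op2 (p + i) T"
proof (induction i arbitrary: p k)
  case 0
  then obtain k' where k: "k = Suc (Suc k')" using that[of "k - 2"] by simp
  have "J (Suc (Suc p)) k' (\<lambda>u v. cst (leg2 k 0 T (x # x' # u) (y # y' # v))) =
      cst (T $ (x, x') $ (y, y'))" for x x' y y'
  proof -
    have "J (Suc (Suc p)) k' (\<lambda>u v. cst (leg2 k 0 T (x # x' # u) (y # y' # v))) =
        J (Suc (Suc p)) k' (\<lambda>u v. if u = v then cst (T $ (x, x') $ (y, y')) else 0)"
    proof (rule J_cong)
      fix u v :: "'n list" assume "length u = k'" "length v = k'"
      then show "cst (leg2 k 0 T (x # x' # u) (y # y' # v)) =
          (if u = v then cst (T $ (x, x') $ (y, y')) else 0)"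
        by (auto simp: leg2_def k list_eq_iff_nth_eq All_less_Suc2)
    qed
    then show ?thesis by (simp add: J_diag)
  qed
  then have "J p k (\<lambda>u v. cst (leg2 k 0 T u v)) = (\<Sum>x\<in>UNIV. \<Sum>y\<in>UNIV. e p x y *
      (\<Sum>x'\<in>UNIV. \<Sum>y'\<in>UNIV. e (Suc p) x' y' * cst (T $ (x, x') $ (y, y'))))"
    by (simp add: k J_Suc)
  also have "\<dots> = (\<Sum>x\<in>UNIV. \<Sum>x'\<in>UNIV. \<Sum>y\<in>UNIV. \<Sum>y'\<in>UNIV.
      e2 p (x, x') (y, y') * cst (T $ (x, x') $ (y, y')))"
    by (simp add: sum_distrib_left e2_def mult.assoc) (intro sum.cong refl sum.swap)
  also have "\<dots> = op2 p T"
    by (simp add: op2_def Op_def sum_UNIV_prod)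
  finally show ?case by simp
next
  case (Suc i)
  then obtain k' where k: "k = Suc k'" using that[of "k - 1"] by simp
  have "J (Suc p) k' (\<lambda>u v. cst (leg2 k (Suc i) T (x # u) (y # v))) =
      (if x = y then op2 (Suc p + i) T else 0)" for x y
  proof -
    have "J (Suc p) k' (\<lambda>u v. cst (leg2 k (Suc i) T (x # u) (y # v))) =
        J (Suc p) k' (\<lambda>u v. if x = y then cst (leg2 k' i T u v) else 0)"
    proof (rule J_cong)
      fix u v :: "'n list" assume uv: "length u = k'" "length v = k'"
      have "(\<forall>q<Suc k'. q \<noteq> Suc i \<and> q \<noteq> Suc (Suc i) \<longrightarrow> (x # u) ! q = (y # v) ! q) \<longleftrightarrow>
          x = y \<and> (\<forall>q<k'. q \<noteq> i \<and> q \<noteq> Suc i \<longrightarrow> u ! q = v ! q)"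
        by (simp add: All_less_Suc2)
      then show "cst (leg2 k (Suc i) T (x # u) (y # v)) =
          (if x = y then cst (leg2 k' i T u v) else 0)"
        using uv by (auto simp: leg2_def k)
    qed
    then show ?thesis using Suc.IH[of k' "Suc p"] Suc.prems k by (auto simp: J_def)
  qed
  note inner = this[unfolded k]
  have "J p k (\<lambda>u v. cst (leg2 k (Suc i) T u v)) =
      (\<Sum>x\<in>UNIV. e p x x * op2 (Suc p + i) T)"
    unfolding k J_Suc inner by (simp add: if_distrib cong: if_cong)
  then show ?case by (simp add: sum_distrib_right[symmetric] e_sum)
qed

text \<open>The entries act trivially on all factors, so each traced factor replaces its matrix unit
  by the transposed entry of \<open>C\<close>.\<close>

lemma Tr_J:
  assumes "\<And>u v. com (X u v)"
  shows "Tr C p k (J p k X) =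
    (\<Sum>u | length u = k. \<Sum>v | length v = k. cst (\<Prod>i<k. C (v ! i) (u ! i)) * X u v)"
  using assms
proof (induction k arbitrary: p X)
  case 0
  show ?case by (simp add: J_0 sum_lists_0 del: length_0_conv)
next
  case (Suc k)
  let ?S = "\<lambda>x y. \<Sum>u | length u = k. \<Sum>v | length v = k.
      cst (\<Prod>i<k. C (v ! i) (u ! i)) * X (x # u) (y # v)"
  have IH: "Tr C (Suc p) k (J (Suc p) k (\<lambda>u v. X (x # u) (y # v))) = ?S x y" for x y
    by (rule Suc.IH) (rule Suc.prems)
  have com: "com (?S x y)" for x y
    by (intro com_sum com_mult com_cst Suc.prems)
  have "Tr C p (Suc k) (J p (Suc k) X) = ptr C p (\<Sum>x\<in>UNIV. \<Sum>y\<in>UNIV. e p x y * ?S x y)"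
    by (simp add: J_Suc Tr_sum Tr_left away_e IH ptr_sum)
  also have "\<dots> = (\<Sum>x\<in>UNIV. \<Sum>y\<in>UNIV. cst (C y x) * ?S x y)"
    using com by (simp add: ptr_sum ptr_unit com_def)
  also have "\<dots> = (\<Sum>x\<in>UNIV. \<Sum>y\<in>UNIV. \<Sum>u | length u = k. \<Sum>v | length v = k.
      cst (\<Prod>i<Suc k. C ((y # v) ! i) ((x # u) ! i)) * X (x # u) (y # v))"
    by (simp only: sum_distrib_left prod.lessThan_Suc_shift cst_mult mult.assoc nth_Cons_0 nth_Cons_Suc)
  also have "\<dots> = (\<Sum>x\<in>UNIV. \<Sum>u | length u = k. \<Sum>y\<in>UNIV. \<Sum>v | length v = k.
      cst (\<Prod>i<Suc k. C ((y # v) ! i) ((x # u) ! i)) * X (x # u) (y # v))"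
    by (intro sum.cong refl sum.swap)
  finally show ?case by (simp only: sum_lists_Suc)
qed

end

section \<open>Copies of a matrix over the Hecke algebra\<close>

lemma const_in_free_on: "const c \<in> free_on A"
  by (auto simp: free_on_def const_def)

lemma gen_in_free_on: "i \<in> A \<Longrightarrow> gen i \<in> free_on A"
  by (auto simp: free_on_def gen_def)

lemma free_on_mono: "A \<subseteq> B \<Longrightarrow> free_on A \<subseteq> free_on B"
  by (auto simp: free_on_def)

text \<open>The quadratic relation is kept in the linear form \<open>quad\<close>. It makes each
  inverse a polynomial in its generator, so inverses lie in the image of the Hecke algebra as
  well.\<close>

locale hecke_gens = central_scalars cst for cst :: "complex \<Rightarrow> 't :: ring_1" +
  fixes t t' :: "nat \<Rightarrow> 't" and lam :: complex
  assumes t_t' [simp]: "t i * t' i = 1" and t'_t [simp]: "t' i * t i = 1"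
    and braid: "t i * t (Suc i) * t i = t (Suc i) * t i * t (Suc i)"
    and far: "Suc i < j \<Longrightarrow> t i * t j = t j * t i"
    and quad: "t i = t' i + cst lam"
begin

lemma t'_conv: "t' i = t i - cst lam"
  using quad[of i] by simp

lemma t_t'_left [simp]: "t i * (t' i * x) = x" and t'_t_left [simp]: "t' i * (t i * x) = x"
  by (simp_all flip: mult.assoc)

lemma t'_commute: "t i * x = x * t i \<Longrightarrow> t' i * x = x * t' i"
  by (simp add: t'_conv algebra_simps cst_central)

subsection \<open>The image of the Hecke algebra\<close>

text \<open>Image of the Hecke algebra of the strands \<open>a\<close> to \<open>b - 1\<close>,
  where \<open>t i\<close> acts on the strands \<open>i\<close> and \<open>Suc i\<close>.\<close>

definition H :: "nat \<Rightarrow> nat \<Rightarrow> 't set" where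
  "H a b = ev t ` free_on {i. a \<le> i \<and> Suc i < b}"

lemma H_add: "x \<in> H a b \<Longrightarrow> y \<in> H a b \<Longrightarrow> x + y \<in> H a b"
  unfolding H_def by (auto simp: ev_add[symmetric] free_on_add)

lemma H_mult: "x \<in> H a b \<Longrightarrow> y \<in> H a b \<Longrightarrow> x * y \<in> H a b"
  unfolding H_def by (auto simp: ev_mult[symmetric] free_on_mult)

lemma H_cst: "cst c \<in> H a b"
  unfolding H_def by (rule image_eqI[of _ _ "const c"]) (auto simp: const_in_free_on)

lemma H_one: "1 \<in> H a b"
  using H_cst[of 1] by simp

lemma H_gen: "a \<le> i \<Longrightarrow> Suc i < b \<Longrightarrow> t i \<in> H a b"
  unfolding H_def by (rule image_eqI[of _ _ "gen i"]) (auto simp: gen_in_free_on)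

lemma H_gen': "a \<le> i \<Longrightarrow> Suc i < b \<Longrightarrow> t' i \<in> H a b"
proof -
  assume i: "a \<le> i" "Suc i < b"
  have "t' i = t i + cst (- lam)" by (simp add: t'_conv cst_minus)
  then show ?thesis using i by (metis H_add H_cst H_gen)
qed

lemma H_mono: "x \<in> H a b \<Longrightarrow> a' \<le> a \<Longrightarrow> b \<le> b' \<Longrightarrow> x \<in> H a' b'"
  unfolding H_def using free_on_mono[of "{i. a \<le> i \<and> Suc i < b}" "{i. a' \<le> i \<and> Suc i < b'}"]
  by (force simp: subset_iff)

lemma H_induct [consumes 1, case_names one scale gen add]:
  assumes "x \<in> H a b"
    and "P 1" "\<And>c x. P x \<Longrightarrow> P (cst c * x)"
    and "\<And>i x. a \<le> i \<Longrightarrow> Suc i < b \<Longrightarrow> P x \<Longrightarrow> P (t i * x)"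
    and "\<And>x y. P x \<Longrightarrow> P y \<Longrightarrow> P (x + y)"
  shows "P x"
proof -
  have "P (ev t y)" if "y \<in> free_on {i. a \<le> i \<and> Suc i < b}" for y
    using that
  proof (induction y rule: free_on_induct)
    case zero
    show ?case using assms(3)[OF assms(2), of 0] by simp
  next
    case (monom w c)
    have "P (prod_list (map t w))"
      using monom by (induction w) (auto intro: assms)
    then show ?case by (auto simp: ev_single intro: assms)
  qed (auto simp: ev_add intro: assms)
  then show ?thesis using assms(1) by (auto simp: H_def)
qed

lemma H_commute:
  assumes "x \<in> H a b" "\<And>i. a \<le> i \<Longrightarrow> Suc i < b \<Longrightarrow> t i * y = y * t i"
  shows "x * y = y * x"
  using assms(1)
proof (induction x rule: H_induct)
  case (scale c x)
  then show ?case by (intro commute_mult cst_central)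
next
  case (gen i x)
  then show ?case by (intro commute_mult assms(2))
qed (auto simp: algebra_simps)

lemma H_H_commute:
  assumes "x \<in> H a b" "y \<in> H c d" "b \<le> c"
  shows "x * y = y * x"
proof (rule H_commute[OF assms(1)])
  fix i assume i: "a \<le> i" "Suc i < b"
  show "t i * y = y * t i"
  proof (rule H_commute[OF assms(2), symmetric])
    fix j assume "c \<le> j" "Suc j < d"
    with i assms(3) show "t j * t i = t i * t j" by (intro far[symmetric]) auto
  qed
qed

subsection \<open>Copies\<close>

primrec bbar :: "'t \<Rightarrow> nat \<Rightarrow> 't" where
  "bbar X 0 = X"
| "bbar X (Suc r) = t r * bbar X r * t' r"

primrec prodb :: "'t \<Rightarrow> nat \<Rightarrow> nat \<Rightarrow> 't" where
  "prodb X a 0 = 1"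
| "prodb X a (Suc n) = bbar X a * prodb X (Suc a) n"

lemma prodb_snoc: "prodb X a (Suc n) = prodb X a n * bbar X (a + n)"
proof (induction n arbitrary: a)
  case (Suc n)
  have "prodb X a (Suc (Suc n)) = bbar X a * (prodb X (Suc a) n * bbar X (Suc a + n))"
    by (simp only: Suc[symmetric] prodb.simps(2)[of X a])
  then show ?case by (simp add: mult.assoc del: bbar.simps)
qed simp

text \<open>What the braid relations need to know about a matrix that sits on the first tensor
  factor.\<close>

definition first_leg :: "'t \<Rightarrow> bool" where
  "first_leg X \<longleftrightarrow> (\<forall>i\<ge>1. t i * X = X * t i)"

lemma braid_inv:
  shows "t (Suc i) * t' i * t' (Suc i) = t' i * t' (Suc i) * t i"
    and "t i * t' (Suc i) * t' i = t' (Suc i) * t' i * t (Suc i)"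
    and "t' i * t' (Suc i) * t' i = t' (Suc i) * t' i * t' (Suc i)"
proof -
  have "t' i * t' (Suc i) * (t i * t (Suc i) * t i) * t' i * t' (Suc i) =
      t' i * t' (Suc i) * (t (Suc i) * t i * t (Suc i)) * t' i * t' (Suc i)"
    by (simp only: braid)
  then show "t (Suc i) * t' i * t' (Suc i) = t' i * t' (Suc i) * t i"
    by (simp add: mult.assoc)
  have "t' (Suc i) * t' i * (t i * t (Suc i) * t i) * t' (Suc i) * t' i =
      t' (Suc i) * t' i * (t (Suc i) * t i * t (Suc i)) * t' (Suc i) * t' i"
    by (simp only: braid)
  then show *: "t i * t' (Suc i) * t' i = t' (Suc i) * t' i * t (Suc i)"
    by (simp add: mult.assoc)
  have "t' i * (t i * t' (Suc i) * t' i) * t' (Suc i) = t' i * (t' (Suc i) * t' i * t (Suc i)) * t' (Suc i)"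
    by (simp only: *)
  then show "t' i * t' (Suc i) * t' i = t' (Suc i) * t' i * t' (Suc i)"
    by (simp add: mult.assoc)
qed

lemma bbar_commute_high:
  assumes "first_leg X"
  shows "r < i \<Longrightarrow> t i * bbar X r = bbar X r * t i"
proof (induction r)
  case 0
  then show ?case using assms by (simp add: first_leg_def)
next
  case (Suc r)
  then have "t r * t i = t i * t r" by (intro far) simp
  then show ?case
    using Suc unfolding bbar.simps by (intro commute_mult[symmetric] commute_mult t'_commute) auto
qed

text \<open>The essential case is \<open>r = i + 2\<close>. There the braid relation turns
  \<open>t i\<close> into \<open>t (Suc i)\<close>, which passes the inner copy of index
  \<open>i\<close>, and the braid relation for the inverses turns it back into \<open>t i\<close> on
  the right.\<close>

lemma bbar_commute_low:
  assumes "first_leg X"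
  shows "Suc i < r \<Longrightarrow> t i * bbar X r = bbar X r * t i"
proof (induction r)
  case (Suc r)
  show ?case
  proof (cases "r = Suc i")
    case True
    let ?B = "bbar X i"
    have c: "t (Suc i) * (?B * x) = ?B * (t (Suc i) * x)" for x
      using bbar_commute_high[OF assms, of i "Suc i"] by (simp flip: mult.assoc)
    have b: "t i * (t (Suc i) * (t i * x)) = t (Suc i) * (t i * (t (Suc i) * x))" for x
      using braid[of i] by (simp flip: mult.assoc)
    have b': "t (Suc i) * (t' i * t' (Suc i)) = t' i * (t' (Suc i) * t i)"
      using braid_inv(1)[of i] by (simp add: mult.assoc)
    show ?thesis by (simp only: True bbar.simps mult.assoc b c b')
  next
    case False
    with Suc have i: "Suc i < r" by simp
    then have "t r * t i = t i * t r" by (intro far[symmetric])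
    then show ?thesis
      using Suc i unfolding bbar.simps by (intro commute_mult[symmetric] commute_mult t'_commute) auto
  qed
qed simp

lemma prodb_commute_low:
  assumes "first_leg X" "Suc i < a"
  shows "t i * prodb X a n = prodb X a n * t i"
  using assms(2)
proof (induction n arbitrary: a)
  case (Suc n)
  then show ?case
    unfolding prodb.simps by (intro commute_mult[symmetric]) (auto simp: bbar_commute_low assms)
qed simp

lemma H_prodb_commute:
  "first_leg X \<Longrightarrow> h \<in> H a b \<Longrightarrow> b \<le> j \<Longrightarrow> h * prodb X j n = prodb X j n * h"
  by (erule H_commute) (simp add: prodb_commute_low)

lemma H_bbar_commute_high:
  "first_leg X \<Longrightarrow> h \<in> H a b \<Longrightarrow> j < a \<Longrightarrow> h * bbar X j = bbar X j * h"
  by (erule H_commute) (simp add: bbar_commute_high)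

text \<open>The braid t_a t_{a+1} ... t_{a+n-1}, which carries one strand across \<open>n\<close>
  others; \<open>sp'\<close> is its inverse. Conjugation by it raises indices by one
  (\<open>prodb_shift\<close>, \<open>ev_shift\<close>).\<close>

primrec sp :: "nat \<Rightarrow> nat \<Rightarrow> 't" where
  "sp a 0 = 1"
| "sp a (Suc n) = t a * sp (Suc a) n"

primrec sp' :: "nat \<Rightarrow> nat \<Rightarrow> 't" where
  "sp' a 0 = 1"
| "sp' a (Suc n) = sp' (Suc a) n * t' a"

lemma sp_in_H: "a' \<le> a \<Longrightarrow> a + n < b \<Longrightarrow> sp a n \<in> H a' b"
  and sp'_in_H: "a' \<le> a \<Longrightarrow> a + n < b \<Longrightarrow> sp' a n \<in> H a' b"
  by (induction n arbitrary: a) (auto intro!: H_one H_mult H_gen H_gen')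

lemma sp_sp': "sp a n * sp' a n = 1" "sp' a n * sp a n = 1"
proof -
  show "sp a n * sp' a n = 1"
  proof (induction n arbitrary: a)
    case (Suc n)
    have "sp a (Suc n) * sp' a (Suc n) = t a * (sp (Suc a) n * sp' (Suc a) n) * t' a"
      by (simp add: mult.assoc)
    with Suc show ?case by simp
  qed simp
  show "sp' a n * sp a n = 1"
    by (induction n arbitrary: a) (simp_all add: mult.assoc)
qed

text \<open>The first copy is \<open>t a * bbar X a * t' a\<close>. Its \<open>t' a\<close> passes
  all later copies of the shifted product, and the braid obtained for those copies by induction
  passes \<open>bbar X a\<close>.\<close>

lemma prodb_shift:
  assumes "first_leg X"
  shows "prodb X (Suc a) n = sp a n * prodb X a n * sp' a n"
proof (induction n arbitrary: a)
  case (Suc n)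
  have c: "t' a * prodb X (Suc (Suc a)) n = prodb X (Suc (Suc a)) n * t' a"
    by (intro t'_commute prodb_commute_low assms) simp
  have c': "sp (Suc a) n * bbar X a = bbar X a * sp (Suc a) n"
    by (rule H_bbar_commute_high[OF assms sp_in_H[of "Suc a" _ _ "Suc (Suc a + n)"]]) auto
  have "prodb X (Suc a) (Suc n) = t a * bbar X a * (t' a * prodb X (Suc (Suc a)) n)"
    by (simp add: mult.assoc)
  also have "\<dots> = t a * (bbar X a * sp (Suc a) n) * prodb X (Suc a) n * sp' (Suc a) n * t' a"
    unfolding c unfolding Suc[of "Suc a"] by (simp only: mult.assoc)
  also have "\<dots> = sp a (Suc n) * prodb X a (Suc n) * sp' a (Suc n)"
    by (simp only: c'[symmetric] mult.assoc sp.simps sp'.simps prodb.simps)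
  finally show ?case .
qed simp

text \<open>Used for the copies of D: the outer factors involve only the strands 0 to
  \<open>m\<close>, so they pass Hecke elements and copies that begin at strand
  \<open>Suc m\<close>.\<close>

lemma bbar_conj:
  "\<exists>w\<in>H 0 (Suc m). \<exists>w'\<in>H 0 (Suc m). \<forall>X. bbar X m = w * X * w'"
proof (induction m)
  case 0
  show ?case by (intro bexI[of _ 1] H_one) auto
next
  case (Suc m)
  then obtain w w' where w: "w \<in> H 0 (Suc m)" "w' \<in> H 0 (Suc m)" "\<And>X. bbar X m = w * X * w'"
    by auto
  then have "t m * w \<in> H 0 (Suc (Suc m))" "w' * t' m \<in> H 0 (Suc (Suc m))"
    by (auto intro!: H_mult H_gen H_gen' intro: H_mono)
  moreover have "bbar X (Suc m) = (t m * w) * X * (w' * t' m)" for X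
    by (simp add: w mult.assoc)
  ultimately show ?case by blast
qed

end

subsection \<open>Moving derivatives through products\<close>

locale hecke_double = hecke_gens cst t t' lam
  for cst :: "complex \<Rightarrow> 't :: ring_1" and t t' lam +
  fixes M D :: 't
  assumes first_M: "first_leg M" and first_D: "first_leg D"
    and perm: "D * t 0 * M * t 0 = t 0 * M * t' 0 * D + t 0"
begin

text \<open>Multiplying \<open>perm\<close> on the right by \<open>t' 0\<close> twice completes
  \<open>t 0 * M * t' 0\<close> on its left side; it leaves the square of \<open>t' 0\<close> behind
  D and a single \<open>t' 0\<close> in the term without D. The next copies arise by conjugation
  with generators that commute with D, and so do these elements.\<close>

primrec xx :: "nat \<Rightarrow> 't" where
  "xx 0 = t' 0 * t' 0"
| "xx (Suc a) = t (Suc a) * xx a * t' (Suc a)"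

primrec yy :: "nat \<Rightarrow> 't" where
  "yy 0 = t' 0"
| "yy (Suc a) = t (Suc a) * yy a * t' (Suc a)"

lemma xx_in_H: "xx a \<in> H 0 (Suc (Suc a))" and yy_in_H: "yy a \<in> H 0 (Suc (Suc a))"
  by (induction a) (auto intro!: H_mult H_gen H_gen' intro: H_mono)

lemma D_bbar: "D * bbar M (Suc a) = bbar M (Suc a) * D * xx a + yy a"
proof (induction a)
  case 0
  have "D * t 0 * M * t 0 * t' 0 * t' 0 = (t 0 * M * t' 0 * D + t 0) * t' 0 * t' 0"
    by (simp only: perm)
  then show ?case by (simp add: mult.assoc distrib_right)
next
  case (Suc a)
  let ?t = "t (Suc a)" and ?t' = "t' (Suc a)"
  have c: "D * ?t = ?t * D" using first_D by (simp add: first_leg_def)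
  have c': "?t' * D = D * ?t'" using c by (intro t'_commute) simp
  have "D * bbar M (Suc (Suc a)) = (D * ?t) * bbar M (Suc a) * ?t'"
    by (simp only: bbar.simps(2)[of M "Suc a"] mult.assoc)
  also have "\<dots> = ?t * (D * bbar M (Suc a)) * ?t'"
    by (simp only: c mult.assoc)
  also have "\<dots> = ?t * bbar M (Suc a) * (?t' * ?t) * D * xx a * ?t' + ?t * yy a * ?t'"
    unfolding Suc by (simp add: ring_distribs mult.assoc)
  also have "\<dots> = ?t * bbar M (Suc a) * ?t' * D * (?t * xx a * ?t') + yy (Suc a)"
    by (simp only: c[symmetric] mult.assoc yy.simps)
  finally show ?case by (simp only: bbar.simps xx.simps mult.assoc)
qed

subsection \<open>The reflection equations pass through the permutation relation\<close>

lemma two_inverses: "t' i * t' i + cst lam * t' i = 1"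
  by (metis distrib_right quad t_t' cst_central distrib_left t'_t)

lemma D_commute: "D * t 1 = t 1 * D" "D * t' 1 = t' 1 * D"
  using first_D t'_commute[of 1 D] by (auto simp: first_leg_def)

lemma bbar_2_commute: "t 0 * bbar M 2 = bbar M 2 * t 0" "t' 0 * bbar M 2 = bbar M 2 * t' 0"
  using bbar_commute_low[OF first_M, of 0 2] t'_commute[of 0 "bbar M 2"] by auto

lemma xx_1: "xx 1 = t' 0 * t' 1 * t' 1 * t 0"
proof -
  have "xx 1 = (t 1 * t' 0 * t' 1) * (t 1 * t' 0 * t' 1)" by (simp add: mult.assoc)
  also have "t 1 * t' 0 * t' 1 = t' 0 * t' 1 * t 0"
    using braid_inv(1)[of 0] by simp
  finally show ?thesis by (simp add: mult.assoc)
qed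

lemma yy_1: "yy 1 = t' 0 * t' 1 * t 0"
  using braid_inv(1)[of 0] by simp

lemma D_bbar_1: "D * bbar M 1 = bbar M 1 * D * (t' 0 * t' 0) + t' 0"
  using D_bbar[of 0] by simp

lemma D_bbar_2: "D * bbar M 2 = bbar M 2 * D * xx 1 + yy 1"
  using D_bbar[of 1] by (simp add: numeral_2_eq_2)

definition reflD :: 't where
  "reflD = t' 0 * D * t' 0 * D - D * t' 0 * D * t' 0"

text \<open>The reflection relation of D passes a copy of M at the cost of a Hecke element on the
  right. The copy of index 2 commutes with \<open>t 0\<close>, so only D itself has to be moved, and
  the terms with a single D cancel.\<close>

lemma reflD_bbar: "reflD * bbar M 2 = bbar M 2 * reflD * (t' 1 * t' 1 * xx 1)"
proof -
  let ?m = "bbar M 2" and ?r = "t 0" and ?p = "t' 0" and ?s = "t' 1"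
  \<comment> \<open>All four terms that are linear in D contain the factor
    \<open>D * z\<close>.\<close>
  define z where "z = ?p * ?p * ?s"
  have braid': "?p * ?s * ?p = ?s * ?p * ?s" using braid_inv(3)[of 0] by simp
  have sa: "?s * xx 1 = z"
    and spss: "?s * ?p * ?s * ?s = z * ?p"
    and quart: "?s * ?s * ?p * ?s * ?s = ?p * ?s * ?s * xx 1"
  proof -
    have 1: "?s * (?p * (?s * x)) = ?p * (?s * (?p * x))" for x
      using braid' by (simp flip: mult.assoc)
    have 2: "?s * (?p * ?s) = ?p * (?s * ?p)"
      using braid' by (simp flip: mult.assoc)
    show "?s * xx 1 = z" "?s * ?p * ?s * ?s = z * ?p"
      unfolding xx_1 z_def by (simp_all only: mult.assoc 1 2 t'_t t'_t_left mult_1_right)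
    have "?s * ?s * ?p * ?s * ?s * ?p = ?s * (?s * ?p * ?s) * ?s * ?p" by (simp only: mult.assoc)
    also have "\<dots> = ?s * (?p * ?s * ?p) * ?s * ?p" by (simp only: braid')
    also have "\<dots> = (?s * ?p * ?s) * (?p * ?s * ?p)" by (simp only: mult.assoc)
    also have "\<dots> = (?p * ?s * ?p) * (?s * ?p * ?s)" by (simp only: braid')
    also have "\<dots> = ?p * ?s * (?p * ?s * ?p) * ?s" by (simp only: mult.assoc)
    also have "\<dots> = ?p * ?s * (?s * ?p * ?s) * ?s" by (simp only: braid')
    finally have "?s * ?s * ?p * ?s * ?s * ?p * ?r = ?p * ?s * ?s * ?p * ?s * ?s * ?r"
      by (simp only: mult.assoc)
    then show "?s * ?s * ?p * ?s * ?s = ?p * ?s * ?s * xx 1"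
      unfolding xx_1 by (simp add: mult.assoc)
  qed
  have ap: "xx 1 * ?p = ?p * ?s * ?s" unfolding xx_1 by (simp add: mult.assoc)
  have bp: "yy 1 * ?p = ?p * ?s" unfolding yy_1 by (simp add: mult.assoc)
  have pb: "?p * yy 1 = z * ?r" unfolding yy_1 by (simp add: mult.assoc z_def)
  have DmZ: "D * (?m * Z) = ?m * D * xx 1 * Z + yy 1 * Z" for Z
    by (simp only: D_bbar_2 distrib_right flip: mult.assoc)
  have sD: "?s * (D * Z) = D * (?s * Z)" for Z
    by (simp only: D_commute flip: mult.assoc)
  have pm: "?p * (?m * Z) = ?m * (?p * Z)" for Z
    by (simp add: bbar_2_commute flip: mult.assoc)
  have "?p * D * ?p * D * ?m = ?p * D * ?p * (?m * D * xx 1 + yy 1)"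
    by (simp only: D_bbar_2 mult.assoc)
  also have "\<dots> = ?p * (D * (?m * (?p * D * xx 1))) + ?p * D * ?p * yy 1"
    by (simp only: distrib_left mult.assoc pm)
  also have "\<dots> = ?m * ?p * D * (xx 1 * ?p) * D * xx 1 + ?p * (yy 1 * ?p) * D * xx 1 + ?p * D * (?p * yy 1)"
    by (simp only: DmZ distrib_left mult.assoc pm)
  also have "\<dots> = ?m * (?p * D * ?p * D) * (?s * ?s * xx 1) + ?p * ?p * D * z + ?p * D * z * ?r"
    unfolding ap bp pb by (simp only: mult.assoc sD sa)
  finally have 1: "?p * D * ?p * D * ?m =
    ?m * (?p * D * ?p * D) * (?s * ?s * xx 1) + ?p * ?p * D * z + ?p * D * z * ?r" .
  have "D * ?p * D * ?p * ?m = D * ?p * (D * (?m * ?p))"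
    by (simp only: mult.assoc bbar_2_commute)
  also have "\<dots> = D * (?m * (?p * D * (xx 1 * ?p))) + D * ?p * (yy 1 * ?p)"
    by (simp only: DmZ distrib_left mult.assoc pm)
  also have "\<dots> = ?m * D * (xx 1 * ?p) * D * (xx 1 * ?p) + (yy 1 * ?p) * D * (xx 1 * ?p) + D * ?p * (yy 1 * ?p)"
    by (simp only: DmZ mult.assoc)
  also have "\<dots> = ?m * (D * ?p * D) * (?s * ?s * ?p * ?s * ?s) + ?p * D * (?s * ?p * ?s * ?s) + D * z"
    unfolding ap bp by (simp only: mult.assoc sD z_def)
  also have "\<dots> = ?m * (D * ?p * D * ?p) * (?s * ?s * xx 1) + ?p * D * z * ?p + D * z"
    unfolding quart spss by (simp only: mult.assoc)
  finally have 2: "D * ?p * D * ?p * ?m =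
    ?m * (D * ?p * D * ?p) * (?s * ?s * xx 1) + ?p * D * z * ?p + D * z" .
  \<comment> \<open>The Hecke relation enters here twice: \<open>t 0\<close> at the right end is
    \<open>t' 0\<close> plus a scalar, and the resulting prefix is 1 by
    \<open>two_inverses\<close>.\<close>
  have "?p * ?p * D * z + ?p * D * z * ?r = (?p * ?p + cst lam * ?p) * D * z + ?p * D * z * ?p"
    by (simp add: quad[of 0] ring_distribs mult.assoc cst_central)
  also have "\<dots> = ?p * D * z * ?p + D * z"
    by (simp add: two_inverses)
  finally have 3: "?p * ?p * D * z + ?p * D * z * ?r = ?p * D * z * ?p + D * z" .
  have "reflD * ?m = ?m * (?p * D * ?p * D) * (?s * ?s * xx 1) + (?p * ?p * D * z + ?p * D * z * ?r)
      - (?m * (D * ?p * D * ?p) * (?s * ?s * xx 1) + ?p * D * z * ?p + D * z)"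
    by (simp only: reflD_def left_diff_distrib 1 2 add.assoc)
  also have "\<dots> = ?m * reflD * (?s * ?s * xx 1)"
    unfolding 3 by (simp add: reflD_def algebra_simps)
  finally show ?thesis .
qed

text \<open>Moving the outer generators of the copy to the other side leaves M itself, whose entries
  are the letters of a word.\<close>

lemma reflD_push:
  "reflD * t 1 * t 0 * M = bbar M 2 * reflD * (t' 1 * t' 1 * xx 1 * t 1 * t 0)"
proof -
  have "reflD * bbar M 2 * (t 1 * t 0) = reflD * t 1 * t 0 * M"
    by (simp add: numeral_2_eq_2 mult.assoc)
  then show ?thesis by (simp only: reflD_bbar mult.assoc)
qed

definition reflM :: 't where
  "reflM = t 0 * M * t 0 * M - M * t 0 * M * t 0"

text \<open>Up to invertible factors, the reflection relation of M says that \<open>t 1\<close>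
  commutes with the product of the copies 1 and 2. In this form \<open>D_bbar\<close> applies to
  it.\<close>

lemma reflM_shift:
  "t 1 * bbar M 1 * bbar M 2 - bbar M 1 * bbar M 2 * t 1 =
    t 0 * t 1 * reflM * (t' 0 * t' 1 * t' 0)"
proof -
  have MM: "bbar M 1 * bbar M 2 = t 0 * t 1 * (M * t 0 * M * t' 0) * (t' 1 * t' 0)"
    using prodb_shift[OF first_M, of 0 2] by (simp add: numeral_2_eq_2 mult.assoc)
  have "t 1 * (t 0 * t 1 * x) = t 0 * t 1 * (t 0 * x)" for x
    using braid[of 0] by (simp flip: mult.assoc)
  then have 1: "t 1 * bbar M 1 * bbar M 2 = t 0 * t 1 * (t 0 * M * t 0 * M) * (t' 0 * t' 1 * t' 0)"
    using MM by (simp add: mult.assoc)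
  have "t' 1 * (t' 0 * t 1) = t 0 * (t' 1 * t' 0)"
    using braid_inv(2)[of 0] by (simp add: mult.assoc)
  then have 2: "bbar M 1 * bbar M 2 * t 1 = t 0 * t 1 * (M * t 0 * M * t 0) * (t' 0 * t' 1 * t' 0)"
    unfolding MM by (simp add: mult.assoc)
  show ?thesis unfolding 1 2 by (simp only: reflM_def right_diff_distrib left_diff_distrib)
qed

lemma D_reflM_shift:
  fixes C :: 't
  defines "C \<equiv> t 1 * bbar M 1 * bbar M 2 - bbar M 1 * bbar M 2 * t 1"
  shows "D * C = C * D * (xx 1 * (t' 0 * t' 0))"
proof -
  let ?m = "bbar M 1" and ?n = "bbar M 2" and ?c = "t' 0 * t' 0" and ?r = "t 1" and ?s = "t' 1"
  define W where "W = ?m * ?s * t' 0"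
  have n: "?n = ?r * ?m * ?s" by (simp add: numeral_2_eq_2)
  have cn: "?c * ?n = ?n * ?c"
    by (intro commute_mult bbar_2_commute)
  have bc: "yy 1 * ?c = ?s * t' 0 * ?s"
    using braid_inv(3)[of 0] unfolding yy_1 by (simp add: mult.assoc)
  have ac: "xx 1 * ?c = t' 0 * ?s * ?s * t' 0"
    unfolding xx_1 by (simp add: mult.assoc)
  have ac_r: "xx 1 * ?c * ?r = ?r * (xx 1 * ?c)"
  proof -
    have 1: "?r * (t' 0 * (?s * x)) = t' 0 * (?s * (t 0 * x))" for x
      using braid_inv(1)[of 0] by (simp flip: mult.assoc)
    have 2: "t 0 * (?s * t' 0) = ?s * (t' 0 * ?r)"
      using braid_inv(2)[of 0] by (simp add: mult.assoc)
    show ?thesis unfolding ac by (simp only: mult.assoc 1 2)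
  qed
  have "D * (?m * ?n) = ?m * D * (?c * ?n) + t' 0 * ?n"
    by (simp only: D_bbar_1 distrib_right flip: mult.assoc)
  also have "\<dots> = ?m * (D * ?n) * ?c + ?n * t' 0"
    unfolding cn by (simp only: bbar_2_commute mult.assoc)
  also have "\<dots> = ?m * ?n * D * (xx 1 * ?c) + ?m * (yy 1 * ?c) + ?n * t' 0"
    by (simp only: D_bbar_2 ring_distribs mult.assoc)
  finally have mn: "D * (?m * ?n) = ?m * ?n * D * (xx 1 * ?c) + (W * ?s + ?r * W)"
    by (simp only: bc W_def n mult.assoc add.assoc)
  have rD: "D * (?r * Z) = ?r * (D * Z)" for Z
    by (simp only: D_commute flip: mult.assoc)
  have "D * C = ?r * (D * (?m * ?n)) - (D * (?m * ?n)) * ?r"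
    using D_commute(1) by (simp add: C_def right_diff_distrib flip: mult.assoc)
  also have "\<dots> = ?r * ?m * ?n * D * (xx 1 * ?c) - ?m * ?n * D * (xx 1 * ?c * ?r) +
      (?r * (W * ?s + ?r * W) - (W * ?s + ?r * W) * ?r)"
    unfolding mn by (simp add: algebra_simps)
  also have "?m * ?n * D * (xx 1 * ?c * ?r) = ?m * ?n * ?r * D * (xx 1 * ?c)"
    unfolding ac_r by (simp only: mult.assoc rD)
  \<comment> \<open>For any \<open>W\<close>, the sum \<open>W * t' 1 + t 1 * W\<close> commutes
    with \<open>t 1\<close> by the quadratic relation; both products equal
    \<open>t 1 * W * t 1 + W\<close>. Hence no inhomogeneous term survives.\<close>
  also have "?r * (W * ?s + ?r * W) - (W * ?s + ?r * W) * ?r = 0"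
  proof -
    have "?r * ?r = 1 + cst lam * ?r"
      using quad[of 1] by (metis cst_central distrib_left t_t')
    then have "?r * ?r * W = W + cst lam * ?r * W" by (simp add: distrib_right)
    moreover have "?r * (W * ?s) = ?r * W * ?r - cst lam * ?r * W"
      by (simp add: t'_conv algebra_simps cst_central)
    moreover have "W * ?s * ?r = W" by (simp add: mult.assoc)
    ultimately show ?thesis by (simp add: algebra_simps)
  qed
  finally show ?thesis by (simp add: C_def algebra_simps)
qed

lemma D_reflM_push:
  "D * t 0 * t 1 * reflM =
    t 0 * t 1 * reflM * (t' 0 * t' 1 * t' 0) * D * (xx 1 * (t' 0 * t' 0) * (t 0 * t 1 * t 0))"
proof -
  have "D * t 0 * t 1 * reflM = D * (t 0 * t 1 * reflM * (t' 0 * t' 1 * t' 0)) * (t 0 * t 1 * t 0)"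
    by (simp add: mult.assoc)
  also have "\<dots> = t 0 * t 1 * reflM * (t' 0 * t' 1 * t' 0) * D * (xx 1 * (t' 0 * t' 0)) * (t 0 * t 1 * t 0)"
    using D_reflM_shift by (simp only: reflM_shift)
  finally show ?thesis by (simp only: mult.assoc)
qed

end

section \<open>Normal ordering of derivatives and copies of M modulo the vacuum\<close>

text \<open>\<open>L\<close> stands for the operators that kill the vacuum.\<close>

locale hecke_double_vacuum = hecke_double cst t t' lam M D
  for cst :: "complex \<Rightarrow> 't :: ring_1" and t t' lam M D +
  fixes L :: "'t set"
  assumes L_add: "x \<in> L \<Longrightarrow> y \<in> L \<Longrightarrow> x + y \<in> L"
    and L_left: "x \<in> L \<Longrightarrow> y * x \<in> L"
    and L_cst: "x \<in> L \<Longrightarrow> x * cst c \<in> L"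
    and L_t: "x \<in> L \<Longrightarrow> x * t i \<in> L"
    and D_in_L: "D \<in> L"
begin

lemma L_H: "h \<in> H a b \<Longrightarrow> x \<in> L \<Longrightarrow> x * h \<in> L"
proof (induction arbitrary: x rule: H_induct)
  case (scale c h)
  then show ?case by (simp add: L_cst flip: mult.assoc)
next
  case (gen i h)
  then show ?case by (simp add: L_t flip: mult.assoc)
qed (auto simp: distrib_left L_add)

text \<open>The left factor is restricted to the strands from \<open>a\<close> on, so that it
  commutes with every copy of index below \<open>a\<close>, be it a copy of M or of D. The right
  factor is unrestricted.\<close>

inductive_set G :: "nat \<Rightarrow> nat \<Rightarrow> nat \<Rightarrow> 't set" for a n K where
  base: "g \<in> H a K \<Longrightarrow> h \<in> H 0 K \<Longrightarrow> g * prodb M a n * h \<in> G a n K"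
| vac: "x \<in> L \<Longrightarrow> x \<in> G a n K"
| add: "x \<in> G a n K \<Longrightarrow> y \<in> G a n K \<Longrightarrow> x + y \<in> G a n K"

lemma G_right: "x \<in> G a n K \<Longrightarrow> h \<in> H 0 K \<Longrightarrow> x * h \<in> G a n K"
proof (induction rule: G.induct)
  case (base g h')
  then have "g * prodb M a n * (h' * h) \<in> G a n K" by (intro G.base H_mult)
  then show ?case by (simp add: mult.assoc)
qed (auto simp: distrib_right intro: G.intros L_H)

lemma G_left: "x \<in> G a n K \<Longrightarrow> h \<in> H a K \<Longrightarrow> h * x \<in> G a n K"
proof (induction rule: G.induct)
  case (base g h')
  then have "(h * g) * prodb M a n * h' \<in> G a n K" by (intro G.base H_mult)
  then show ?case by (simp add: mult.assoc)
qed (auto simp: distrib_left intro: G.intros L_left)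

lemma prodb_Suc_in_G: "Suc (a + n) \<le> K \<Longrightarrow> prodb M (Suc a) n \<in> G a n K"
  unfolding prodb_shift[OF first_M]
  by (intro G.base sp_in_H sp'_in_H) auto

text \<open>The shifted product is a conjugate of the unshifted one, and the left half of the
  conjugating braid lies in \<open>H a K\<close>. This makes room for the next copy of D.\<close>

lemma G_Suc: "x \<in> G (Suc a) n K \<Longrightarrow> Suc (a + n) \<le> K \<Longrightarrow> x \<in> G a n K"
proof (induction rule: G.induct)
  case (base g h)
  then have "g * (prodb M (Suc a) n * h) \<in> G a n K"
    by (intro G_left[OF G_right[OF prodb_Suc_in_G]]) (auto intro: H_mono)
  then show ?case by (simp add: mult.assoc)
qed (auto intro: G.intros)

lemma bbar_G: "x \<in> G (Suc a) n K \<Longrightarrow> bbar M a * x \<in> G a (Suc n) K"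
proof (induction rule: G.induct)
  case (base g h)
  then have "bbar M a * g = g * bbar M a"
    by (intro H_bbar_commute_high[symmetric] first_M) auto
  then have eq: "bbar M a * (g * prodb M (Suc a) n * h) = g * prodb M a (Suc n) * h"
    by (simp flip: mult.assoc)
  show ?case unfolding eq using base by (intro G.base) (auto intro: H_mono)
qed (auto simp: distrib_left intro: G.intros L_left)

text \<open>Either D passes the first copy, and by induction loses a later one, or it is absorbed by
  the first copy and leaves a shifted product. The elements \<open>xx a\<close> and
  \<open>yy a\<close> reach only strand \<open>Suc a\<close> and hence pass the remaining copies. A
  D that passes everything kills the vacuum.\<close>

lemma D_prodb: "Suc (Suc (a + n)) \<le> K \<Longrightarrow> D * prodb M (Suc a) (Suc n) \<in> G (Suc a) n K"
proof (induction n arbitrary: a)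
  case 0
  have "D * prodb M (Suc a) (Suc 0) = bbar M (Suc a) * (D * xx a) + 1 * prodb M (Suc a) 0 * yy a"
    by (simp del: bbar.simps add: D_bbar mult.assoc)
  moreover have "bbar M (Suc a) * (D * xx a) \<in> L"
    by (intro L_left L_H[OF xx_in_H] D_in_L)
  ultimately show ?case
    using 0 yy_in_H[of a] by (metis G.intros H_mono H_one add.right_neutral order_refl)
next
  case (Suc n)
  let ?p = "prodb M (Suc (Suc a)) (Suc n)"
  have "D * prodb M (Suc a) (Suc (Suc n)) =
      bbar M (Suc a) * D * (xx a * ?p) + yy a * ?p"
    by (simp only: prodb.simps(2)[of M "Suc a"] mult.assoc[symmetric] D_bbar distrib_right)
  also have "xx a * ?p = ?p * xx a"
    by (rule H_prodb_commute[OF first_M xx_in_H]) simp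
  also have "yy a * ?p = ?p * yy a"
    by (rule H_prodb_commute[OF first_M yy_in_H]) simp
  also have "bbar M (Suc a) * D * (?p * xx a) + ?p * yy a =
      bbar M (Suc a) * (D * ?p) * xx a + ?p * yy a"
    by (simp only: mult.assoc)
  also have "\<dots> \<in> G (Suc a) (Suc n) K"
    using Suc.prems by (intro G.add[OF G_right[OF bbar_G[OF Suc.IH]] G_right[OF prodb_Suc_in_G]])
      (auto intro: H_mono[OF xx_in_H] H_mono[OF yy_in_H] simp del: prodb.simps)
  finally show ?case .
qed

text \<open>A copy of D is \<open>w * D * w'\<close> with \<open>w\<close> and \<open>w'\<close> on
  the strands up to \<open>m\<close>. It passes the left Hecke factor, \<open>w'\<close> passes the
  copies of M, and \<open>D_prodb\<close> does the rest. Without copies of M only an operator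
  killing the vacuum is left.\<close>

lemma bbarD_G:
  assumes "x \<in> G (Suc m) n K" "Suc (m + n) \<le> K"
  shows "case n of 0 \<Rightarrow> bbar D m * x \<in> L | Suc n' \<Rightarrow> bbar D m * x \<in> G m n' K"
  using assms
proof (induction rule: G.induct)
  case (base g h)
  obtain w w' where w: "w \<in> H 0 (Suc m)" "w' \<in> H 0 (Suc m)" "bbar D m = w * D * w'"
    using bbar_conj[of m] by blast
  have "bbar D m * (g * prodb M (Suc m) n * h) = (bbar D m * g) * prodb M (Suc m) n * h"
    by (simp only: mult.assoc)
  also have "bbar D m * g = g * bbar D m"
    using base by (intro H_bbar_commute_high[symmetric] first_D) auto
  also have "g * bbar D m * prodb M (Suc m) n * h = g * w * D * (w' * prodb M (Suc m) n) * h"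
    by (simp only: w(3) mult.assoc)
  also have "w' * prodb M (Suc m) n = prodb M (Suc m) n * w'"
    by (rule H_prodb_commute[OF first_M w(2)]) simp
  finally have eq: "bbar D m * (g * prodb M (Suc m) n * h) =
      g * (w * (D * prodb M (Suc m) n)) * w' * h"
    by (simp only: mult.assoc)
  show ?case
  proof (cases n)
    case 0
    have "g * (w * D) * w' * h \<in> L"
      by (intro L_H[OF base(2) L_H[OF w(2) L_left[OF L_left[OF D_in_L]]]])
    with eq 0 show ?thesis by simp
  next
    case (Suc n')
    have w_x: "w * x \<in> G (Suc m) n' K" if "x \<in> G (Suc m) n' K" for x
      using that
    proof (induction rule: G.induct)
      case (base g h)
      have "w * g = g * w" by (rule H_H_commute[OF w(1) base(1)]) simp
      moreover have "w * prodb M (Suc m) n' = prodb M (Suc m) n' * w"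
        by (rule H_prodb_commute[OF first_M w(1)]) simp
      ultimately have "w * (g * prodb M (Suc m) n' * h) = g * prodb M (Suc m) n' * (w * h)"
        by (metis mult.assoc)
      moreover have "w \<in> H 0 K" using w(1) assms(2) by (auto intro: H_mono)
      ultimately show ?case using base by (auto intro!: G.base H_mult)
    qed (auto simp: distrib_left intro: G.intros L_left)
    have "D * prodb M (Suc m) (Suc n') \<in> G (Suc m) n' K"
      using base(3) Suc by (intro D_prodb) simp
    then have "g * (w * (D * prodb M (Suc m) (Suc n'))) * w' * h \<in> G (Suc m) n' K"
      using base w assms(2) by (intro G_right[OF G_right[OF G_left[OF w_x]]]) (auto intro: H_mono)
    with eq base(3) Suc show ?thesis by (auto intro: G_Suc)
  qed
next
  case (add x y)
  then show ?case by (cases n) (auto simp: distrib_left intro: G.add L_add)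
qed (auto split: nat.splits intro: L_left G.vac)

text \<open>The copies of D act from the last to the first. Each removes one copy of M and lowers
  the starting index by one.\<close>

lemma prodbD_G:
  assumes "x \<in> G m n K" "m + n \<le> K"
  shows "if m \<le> n then prodb D 0 m * x \<in> G 0 (n - m) K else prodb D 0 m * x \<in> L"
  using assms
proof (induction m arbitrary: n x)
  case (Suc m)
  have eq: "prodb D 0 (Suc m) * x = prodb D 0 m * (bbar D m * x)"
    by (simp only: prodb_snoc mult.assoc add_0)
  show ?case
  proof (cases n)
    case 0
    with Suc.prems bbarD_G[of x m n K] show ?thesis
      by (simp add: eq L_left del: prodb.simps)
  next
    case (Suc n')
    with Suc.prems bbarD_G[of x m n K] have "bbar D m * x \<in> G m n' K" by simp
    from Suc.IH[OF this] Suc.prems Suc show ?thesis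
      by (simp add: eq del: prodb.simps)
  qed
qed simp

end

section \<open>The R-trace on a tower of matrix units\<close>

context hecke_gens
begin

text \<open>Sums of products with at most one occurrence of the top generator
  \<open>t c\<close>.\<close>

inductive_set split :: "nat \<Rightarrow> 't set" for c where
  lower: "u \<in> H 0 (Suc c) \<Longrightarrow> u \<in> split c"
| top: "u \<in> H 0 (Suc c) \<Longrightarrow> v \<in> H 0 (Suc c) \<Longrightarrow> u * t c * v \<in> split c"
| add: "x \<in> split c \<Longrightarrow> y \<in> split c \<Longrightarrow> x + y \<in> split c"

lemma split_left: "x \<in> split c \<Longrightarrow> h \<in> H 0 (Suc c) \<Longrightarrow> h * x \<in> split c"
proof (induction rule: split.induct)
  case (top u v)
  then have "(h * u) * t c * v \<in> split c" by (intro split.top H_mult)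
  then show ?case by (simp add: mult.assoc)
qed (auto simp: distrib_left intro: split.intros H_mult)

lemma t_H_commute: "u \<in> H 0 c \<Longrightarrow> t c * u = u * t c"
  by (rule H_commute[symmetric]) (auto intro: far)

lemma t_t: "t i * t i = 1 + cst lam * t i"
  using quad[of i] by (metis cst_central distrib_left t_t')

text \<open>The classical spanning result for Hecke algebras. In \<open>t c * u * t c\<close> the
  element \<open>u\<close> is split by induction: if the generator below the top does not occur,
  \<open>u\<close> passes \<open>t c\<close> and the quadratic relation applies; if it occurs once,
  the braid relation leaves a single \<open>t c\<close>.\<close>

lemma H_split: "x \<in> H 0 (Suc (Suc c)) \<Longrightarrow> x \<in> split c"
proof (induction c arbitrary: x)
  have step: "t c * x \<in> split c"
    if sand: "\<And>u v. u \<in> H 0 (Suc c) \<Longrightarrow> v \<in> H 0 (Suc c) \<Longrightarrow> t c * u * t c * v \<in> split c"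
      and "x \<in> split c" for x c
    using that(2)
  proof (induction rule: split.induct)
    case (lower u)
    then show ?case using split.top[OF H_one lower] by simp
  next
    case (top u v)
    then show ?case using sand by (simp add: mult.assoc)
  qed (auto simp: distrib_left intro: split.add)
  have all: "x \<in> split c"
    if sand: "\<And>u v. u \<in> H 0 (Suc c) \<Longrightarrow> v \<in> H 0 (Suc c) \<Longrightarrow> t c * u * t c * v \<in> split c"
      and "x \<in> H 0 (Suc (Suc c))" for x c
    using that(2)
  proof (induction rule: H_induct)
    case (gen i x)
    show ?case
    proof (cases "i = c")
      case True
      with gen step[OF sand] show ?thesis by auto
    next
      case False
      with gen show ?thesis by (intro split_left H_gen) auto
    qed
  qed (auto intro: split.intros H_one split_left H_cst)
  have sand0: "t c * u * t c * v \<in> split c"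
    if "u \<in> H 0 c" "v \<in> H 0 (Suc c)" for u v c
  proof -
    have u: "u \<in> H 0 (Suc c)" using that(1) by (rule H_mono) auto
    have "t c * u * t c * v = u * (t c * t c) * v"
      by (simp only: t_H_commute[OF that(1)] mult.assoc)
    also have "\<dots> = u * v + (cst lam * u) * t c * v"
      unfolding t_t by (simp add: ring_distribs mult.assoc cst_left_commute)
    finally have eq: "t c * u * t c * v = u * v + (cst lam * u) * t c * v" .
    show ?thesis
      unfolding eq by (intro split.add[OF split.lower split.top] H_mult H_cst u that(2))
  qed
  {
    case 0
    have "H 0 (Suc 0) \<subseteq> H 0 0" by (simp add: H_def)
    then show ?case by (intro all[OF sand0 0]) auto
  next
    case (Suc c)
    show ?case
    proof (rule all[OF _ Suc.prems])
      fix u v assume uv: "u \<in> H 0 (Suc (Suc c))" "v \<in> H 0 (Suc (Suc c))"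
      from Suc.IH[OF uv(1)] show "t (Suc c) * u * t (Suc c) * v \<in> split (Suc c)"
      proof (induction rule: split.induct)
        case (lower u)
        then show ?case using uv(2) by (rule sand0)
      next
        case (top a b)
        have "t (Suc c) * (a * t c * b) * t (Suc c) * v = (t (Suc c) * a) * t c * (b * t (Suc c)) * v"
          by (simp only: mult.assoc)
        also have "\<dots> = a * (t (Suc c) * t c * t (Suc c)) * b * v"
          by (simp only: t_H_commute[OF top(1)] t_H_commute[OF top(2), symmetric] mult.assoc)
        also have "\<dots> = (a * t c) * t (Suc c) * (t c * b * v)"
          by (simp only: braid[symmetric]) (simp only: mult.assoc)
        also have "\<dots> \<in> split (Suc c)"
          using top uv by (intro split.top H_mult H_gen) (auto intro: H_mono)
        finally show ?case .
      qed (auto simp: ring_distribs intro: split.add)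
    qed
  }
qed

lemma H_prodb_commute_high:
  "first_leg X \<Longrightarrow> h \<in> H a b \<Longrightarrow> j + n \<le> a \<Longrightarrow> h * prodb X j n = prodb X j n * h"
proof (induction n arbitrary: j)
  case (Suc n)
  then show ?case
    unfolding prodb.simps
    by (intro commute_mult[symmetric] H_bbar_commute_high[symmetric] Suc.IH[symmetric]) auto
qed simp

lemma sp_snoc: "sp a (Suc n) = sp a n * t (a + n)" and sp'_snoc: "sp' a (Suc n) = t' (a + n) * sp' a n"
proof -
  show "sp a (Suc n) = sp a n * t (a + n)"
  proof (induction n arbitrary: a)
    case (Suc n)
    have "sp a (Suc (Suc n)) = t a * (sp (Suc a) n * t (Suc a + n))"
      by (simp only: sp.simps(2)[of a] Suc)
    then show ?case by (simp add: mult.assoc)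
  qed simp
  show "sp' a (Suc n) = t' (a + n) * sp' a n"
  proof (induction n arbitrary: a)
    case (Suc n)
    have "sp' a (Suc (Suc n)) = (t' (Suc a + n) * sp' (Suc a) n) * t' a"
      by (simp only: sp'.simps(2)[of a] Suc)
    then show ?case by (simp add: mult.assoc)
  qed simp
qed

text \<open>A generator slides through the braid \<open>sp a n\<close> and loses one index; the
  braid relation is needed at the single place where the indices meet.\<close>

lemma t_sp: "a \<le> j \<Longrightarrow> Suc j < a + n \<Longrightarrow> t (Suc j) * sp a n = sp a n * t j"
proof (induction n arbitrary: a)
  case (Suc n)
  show ?case
  proof (cases "a = j")
    case True
    with Suc.prems obtain n' where n: "n = Suc n'" by (cases n) auto
    have c: "t j * sp (Suc (Suc j)) n' = sp (Suc (Suc j)) n' * t j"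
      by (rule H_commute[symmetric, OF sp_in_H[of "Suc (Suc j)" _ _ "Suc (Suc (Suc j)) + n'"]])
        (auto intro: far[symmetric])
    have "t (Suc j) * sp j (Suc (Suc n')) = (t (Suc j) * t j * t (Suc j)) * sp (Suc (Suc j)) n'"
      by (simp add: mult.assoc)
    also have "\<dots> = t j * t (Suc j) * (t j * sp (Suc (Suc j)) n')"
      by (simp only: braid[symmetric]) (simp only: mult.assoc)
    also have "\<dots> = sp j (Suc (Suc n')) * t j"
      unfolding c by (simp add: mult.assoc)
    finally show ?thesis by (simp only: True n)
  next
    case False
    with Suc.prems have "Suc a \<le> j" "Suc j < Suc a + n" by auto
    then have "t (Suc j) * sp (Suc a) n = sp (Suc a) n * t j" by (rule Suc.IH)
    moreover have "t (Suc j) * t a = t a * t (Suc j)"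
      using \<open>Suc a \<le> j\<close> by (intro far[symmetric]) auto
    ultimately show ?thesis by (metis mult.assoc sp.simps(2))
  qed
qed simp

lemma ev_shift:
  assumes "x \<in> free_on (hecke_letters n)"
  shows "ev (\<lambda>i. t (i + Suc m)) x = sp m n * ev (\<lambda>i. t (i + m)) x * sp' m n"
  using assms
proof (induction x rule: free_on_induct)
  case (monom w c)
  have "prod_list (map (\<lambda>i. t (i + Suc m)) w) * sp m n = sp m n * prod_list (map (\<lambda>i. t (i + m)) w)"
    using monom
  proof (induction w)
    case (Cons i w)
    then have "t (Suc (i + m)) * sp m n = sp m n * t (i + m)"
      by (intro t_sp) (auto simp: hecke_letters_def)
    with Cons show ?case by (simp add: mult.assoc) (simp flip: mult.assoc)
  qed simp
  then have "prod_list (map (\<lambda>i. t (i + Suc m)) w) =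
      sp m n * prod_list (map (\<lambda>i. t (i + m)) w) * sp' m n"
    by (metis mult.assoc mult.right_neutral sp_sp'(1))
  then show ?case by (simp only: ev_single mult.assoc cst_left_commute[of "sp m n"])
qed (auto simp: ev_add ring_distribs)

lemma ev_t_in_H: "x \<in> free_on (hecke_letters n) \<Longrightarrow> ev (\<lambda>i. t (i + m)) x \<in> H m (m + n)"
proof (induction x rule: free_on_induct)
  case zero
  then show ?case using H_cst[of 0] by simp
next
  case (monom w c)
  then have "prod_list (map (\<lambda>i. t (i + m)) w) \<in> H m (m + n)"
    by (induction w) (auto intro!: H_one H_mult H_gen simp: hecke_letters_def)
  then show ?case by (simp add: ev_single H_mult H_cst)
qed (auto simp: ev_add intro: H_add)

lemma H_0_conv: "H 0 n = ev t ` free_on (hecke_letters n)"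
  by (simp add: H_def hecke_letters_def)

end

lemma sum_if_const: "(\<Sum>a\<in>A. if P then f a else 0) = (if P then \<Sum>a\<in>A. f a else 0)"
  by simp

lemma sum_swap4:
  "(\<Sum>a\<in>A. \<Sum>b\<in>B. \<Sum>c\<in>C. \<Sum>d\<in>D. f a b c d) = (\<Sum>c\<in>C. \<Sum>d\<in>D. \<Sum>a\<in>A. \<Sum>b\<in>B. f a b c d)"
proof -
  have "(\<Sum>a\<in>A. \<Sum>b\<in>B. \<Sum>c\<in>C. \<Sum>d\<in>D. f a b c d) = (\<Sum>a\<in>A. \<Sum>c\<in>C. \<Sum>d\<in>D. \<Sum>b\<in>B. f a b c d)"
    by (intro sum.cong refl) (subst sum.swap, intro sum.cong refl sum.swap)
  also have "\<dots> = (\<Sum>c\<in>C. \<Sum>d\<in>D. \<Sum>a\<in>A. \<Sum>b\<in>B. f a b c d)"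
    by (subst sum.swap) (intro sum.cong refl sum.swap)
  finally show ?thesis .
qed

lemma tmul_tid:
  fixes X :: "('n :: finite, 'a :: semiring_1) tmat"
  shows "length v = k \<Longrightarrow> tmul k X (tid k) u v = X u v"
  by (simp add: tmul_def tid_def if_distrib cong: if_cong)

text \<open>Applied a second time with the two matrices exchanged, it gives the other half of skew
  invertibility.\<close>

lemma skew_entries:
  fixes R \<Psi> :: "'n :: finite op2"
  assumes "tr_mid (tprod 3 [leg2 3 0 R, leg2 3 1 \<Psi>]) = flip"
  shows "(\<Sum>x\<in>UNIV. \<Sum>y\<in>UNIV. R $ (i, x) $ (k, y) * \<Psi> $ (y, j) $ (x, l)) =
    (if i = l \<and> j = k then 1 else 0)"
proof -
  have "tprod 3 [leg2 3 0 R, leg2 3 1 \<Psi>] [i, x, j] [k, x, l] =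
      (\<Sum>y\<in>UNIV. R $ (i, x) $ (k, y) * \<Psi> $ (y, j) $ (x, l))" for x
  proof -
    have "tprod 3 [leg2 3 0 R, leg2 3 1 \<Psi>] [i, x, j] [k, x, l] =
        (\<Sum>w | length w = 3. leg2 3 0 R [i, x, j] w * leg2 3 1 \<Psi> w [k, x, l])"
      by (simp add: tprod_def tmul_def[of 3 "leg2 3 0 R"] tmul_tid)
    also have "\<dots> = (\<Sum>a\<in>UNIV. \<Sum>b\<in>UNIV. \<Sum>c\<in>UNIV.
        leg2 3 0 R [i, x, j] [a, b, c] * leg2 3 1 \<Psi> [a, b, c] [k, x, l])"
      by (simp add: numeral_3_eq_3 sum_lists_Suc sum_lists_0 del: length_0_conv)
    also have "\<dots> = (\<Sum>a\<in>UNIV. \<Sum>b\<in>UNIV. \<Sum>c\<in>UNIV.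
        (if a = k then if j = c then R $ (i, x) $ (a, b) * \<Psi> $ (b, c) $ (x, l) else 0 else 0))"
      by (intro sum.cong refl) (auto simp: leg2_def numeral_3_eq_3 All_less_Suc2)
    also have "\<dots> = (\<Sum>b\<in>UNIV. R $ (i, x) $ (k, b) * \<Psi> $ (b, j) $ (x, l))"
    proof -
      have "(\<Sum>b\<in>UNIV. \<Sum>c\<in>UNIV. (if a = k then if j = c then R $ (i, x) $ (a, b) * \<Psi> $ (b, c) $ (x, l) else 0 else 0))
        = (if a = k then \<Sum>b\<in>UNIV. R $ (i, x) $ (k, b) * \<Psi> $ (b, j) $ (x, l) else 0)" for a
        by simp
      then show ?thesis by simp
    qed
    finally show ?thesis .
  qed
  then have "(\<Sum>x\<in>UNIV. \<Sum>y\<in>UNIV. R $ (i, x) $ (k, y) * \<Psi> $ (y, j) $ (x, l)) =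
      tr_mid (tprod 3 [leg2 3 0 R, leg2 3 1 \<Psi>]) $ (i, j) $ (k, l)"
    by (simp add: tr_mid_def)
  also have "\<dots> = (if i = l \<and> j = k then 1 else 0)"
    unfolding assms by (simp add: flip_def)
  finally show ?thesis .
qed

context unit_tower
begin

text \<open>Covers numerical matrices, by \<open>cst\<close>, and matrices over the free algebra, by
  evaluations, so that \<open>J\<close> is treated once for both.\<close>

definition coef :: "('a :: semiring_1 \<Rightarrow> 't) \<Rightarrow> bool" where
  "coef \<phi> \<longleftrightarrow> (\<forall>x y. \<phi> (x + y) = \<phi> x + \<phi> y) \<and> (\<forall>x y. \<phi> (x * y) = \<phi> x * \<phi> y) \<and>
    \<phi> 0 = 0 \<and> \<phi> 1 = 1 \<and> (\<forall>x. com (\<phi> x))"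

lemma coef_sum: "coef \<phi> \<Longrightarrow> \<phi> (sum f A) = (\<Sum>a\<in>A. \<phi> (f a))"
  by (induction A rule: infinite_finite_induct) (auto simp: coef_def)

lemma coef_cst: "coef cst"
  by (auto simp: coef_def cst_add cst_mult)

lemma com_ev: "(\<And>i. com (g i)) \<Longrightarrow> com (ev g x)"
proof -
  assume g: "\<And>i. com (g i)"
  have "com (prod_list (map g w))" for w by (induction w) (auto simp: com_mult g)
  then show ?thesis unfolding ev_def by (intro com_sum com_mult) auto
qed

lemma coef_ev: "(\<And>i. com (g i)) \<Longrightarrow> coef (ev g)"
  by (auto simp: coef_def ev_add ev_mult com_ev)

lemma coef_com: "coef \<phi> \<Longrightarrow> com (\<phi> x)"
  by (simp add: coef_def)

lemma J_coef_tmul: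
  assumes "coef \<phi>"
  shows "J p k (\<lambda>u v. \<phi> (tmul k X Y u v)) = J p k (\<lambda>u v. \<phi> (X u v)) * J p k (\<lambda>u v. \<phi> (Y u v))"
proof -
  have "(\<lambda>u v. \<phi> (tmul k X Y u v)) = tmul k (\<lambda>u v. \<phi> (X u v)) (\<lambda>u v. \<phi> (Y u v))"
    using assms by (intro ext) (simp add: tmul_def coef_sum, simp add: coef_def)
  then show ?thesis by (simp add: J_mult coef_com[OF assms])
qed

lemma J_coef_tprod:
  assumes "coef \<phi>"
  shows "J p k (\<lambda>u v. \<phi> (tprod k Xs u v)) = prod_list (map (\<lambda>X. J p k (\<lambda>u v. \<phi> (X u v))) Xs)"
proof (induction Xs)
  case Nil
  have "J p k (\<lambda>u v. \<phi> (tid k u v)) = J p k (tid k)"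
    using assms by (intro J_cong) (auto simp: tid_def coef_def)
  then have "J p k (\<lambda>u v. \<phi> (tid k u v)) = 1" by (simp only: J_one)
  then show ?case by (simp add: tprod_def)
next
  case (Cons X Xs)
  then show ?case by (simp add: tprod_def J_coef_tmul[OF assms])
qed

lemma J_coef_leg1:
  assumes "coef \<phi>"
  shows "J p (Suc k) (\<lambda>u v. \<phi> (leg1 (Suc k) 0 X u v)) = (\<Sum>x\<in>UNIV. \<Sum>y\<in>UNIV. e p x y * \<phi> (X x y))"
proof -
  have "(\<lambda>u v. \<phi> (leg1 (Suc k) 0 X u v)) = leg1 (Suc k) 0 (\<lambda>x y. \<phi> (X x y))"
    using assms by (intro ext) (auto simp: leg1_def coef_def)
  then show ?thesis by (simp add: J_leg1)
qed

lemma op2_expand: "op2 k T = (\<Sum>a\<in>UNIV. \<Sum>b\<in>UNIV. \<Sum>c\<in>UNIV. \<Sum>d\<in>UNIV.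
    cst (T $ (a, b) $ (c, d)) * (e k a c * e (Suc k) b d))"
  by (simp add: op2_def Op_def sum_UNIV_prod e2_def cst_central)

lemma op2_mat: "op2 k (mat c) = cst c"
proof -
  have "op2 k (mat c) = (\<Sum>a\<in>UNIV. e2 k a a * cst c)"
    by (simp add: op2_def Op_def mat_def if_distrib[of cst] if_distrib[of "(*) _"] cong: if_cong)
  then show ?thesis by (simp add: e2_sum sum_distrib_right[symmetric])
qed

text \<open>An entry with respect to the second factor is an operator on the first factor.\<close>

lemma op2_slice_right:
  "(\<Sum>p\<in>UNIV. e (Suc k) p j * op2 k T * e (Suc k) l p) =
    (\<Sum>a\<in>UNIV. \<Sum>c\<in>UNIV. cst (T $ (a, j) $ (c, l)) * e k a c)"
proof -
  have "e (Suc k) p j * (cst \<rho> * (e k a c * e (Suc k) b d)) * e (Suc k) l p =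
      (if d = l then if b = j then cst \<rho> * e k a c * e (Suc k) p p else 0 else 0)" for p \<rho> a b c d
  proof -
    have "e (Suc k) p j * (cst \<rho> * (e k a c * e (Suc k) b d)) * e (Suc k) l p =
        cst \<rho> * (e k a c * (e (Suc k) p j * e (Suc k) b d * e (Suc k) l p))"
      by (simp add: cst_left_commute[of "e (Suc k) p j"] mult.assoc away_left_commute[OF away_e, of "Suc k" k])
    then show ?thesis by (simp add: e_mult mult.assoc)
  qed
  then have "e (Suc k) p j * op2 k T * e (Suc k) l p =
      (\<Sum>a\<in>UNIV. \<Sum>c\<in>UNIV. cst (T $ (a, j) $ (c, l)) * e k a c) * e (Suc k) p p" for p
    by (simp add: op2_expand sum_distrib_left sum_distrib_right sum_if_const)
  then show ?thesis by (simp add: sum_distrib_left[symmetric] e_sum)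
qed

lemma op2_slice_left:
  "(\<Sum>p\<in>UNIV. e k p i * op2 k T * e k j p) =
    (\<Sum>b\<in>UNIV. \<Sum>d\<in>UNIV. cst (T $ (i, b) $ (j, d)) * e (Suc k) b d)"
proof -
  have "e k p i * (cst \<rho> * (e k a c * e (Suc k) b d)) * e k j p =
      (if a = i then if c = j then e k p p * (cst \<rho> * e (Suc k) b d) else 0 else 0)" for p \<rho> a b c d
  proof -
    have "e k p i * (cst \<rho> * (e k a c * e (Suc k) b d)) * e k j p =
        cst \<rho> * (e k p i * e k a c) * (e (Suc k) b d * e k j p)"
      by (simp only: cst_left_commute[of "e k p i"] mult.assoc)
    also have "e (Suc k) b d * e k j p = e k j p * e (Suc k) b d"
      by (rule e_comm) simp
    also have "cst \<rho> * (e k p i * e k a c) * (e k j p * e (Suc k) b d) =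
        cst \<rho> * ((e k p i * e k a c * e k j p) * e (Suc k) b d)"
      by (simp only: mult.assoc)
    also have "e k p i * e k a c * e k j p = (if a = i then if c = j then e k p p else 0 else 0)"
      by (auto simp: e_mult)
    finally show ?thesis by (simp add: cst_left_commute)
  qed
  then have "e k p i * op2 k T * e k j p =
      e k p p * (\<Sum>b\<in>UNIV. \<Sum>d\<in>UNIV. cst (T $ (i, b) $ (j, d)) * e (Suc k) b d)" for p
    by (simp add: op2_expand sum_distrib_left sum_distrib_right sum_if_const)
  then show ?thesis by (simp add: sum_distrib_right[symmetric] e_sum)
qed

text \<open>Every ring element is a matrix over the elements that act trivially on factor
  \<open>k\<close>; \<open>away_unit_coeff\<close> supplies the latter property.\<close>

lemma unit_decomp:
  "X = (\<Sum>x\<in>UNIV. \<Sum>y\<in>UNIV. e k x y * (\<Sum>a\<in>UNIV. e k a x * X * e k y a))"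
proof -
  have "(\<Sum>x\<in>UNIV. \<Sum>y\<in>UNIV. e k x y * (\<Sum>a\<in>UNIV. e k a x * X * e k y a)) =
      (\<Sum>x\<in>UNIV. \<Sum>y\<in>UNIV. e k x x * X * e k y y)"
  proof (intro sum.cong refl)
    fix x y
    have "e k x y * (e k a x * X * e k y a) = (if y = a then e k x x * X * e k y y else 0)" for a
      by (simp add: e_mult flip: mult.assoc)
    then show "e k x y * (\<Sum>a\<in>UNIV. e k a x * X * e k y a) = e k x x * X * e k y y"
      by (simp add: sum_distrib_left)
  qed
  also have "\<dots> = (\<Sum>x\<in>UNIV. e k x x) * X * (\<Sum>y\<in>UNIV. e k y y)"
    by (simp add: sum_distrib_left sum_distrib_right) (rule sum.swap)
  finally show ?thesis by (simp add: e_sum)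
qed

lemma away_unit_coeff: "away k (\<Sum>a\<in>UNIV. e k a x * X * e k y a)"
proof -
  have "e k z w * (e k a x * X * e k y a) = (if w = a then e k z x * X * e k y w else 0)" for z w a
    by (simp add: e_mult flip: mult.assoc)
  moreover have "e k a x * X * e k y a * e k z w = (if a = z then e k z x * X * e k y w else 0)" for z w a
    by (simp add: e_mult mult.assoc)
  ultimately show ?thesis
    by (simp add: away_def sum_distrib_left sum_distrib_right)
qed

lemma away_unit_coeff_other: "k \<noteq> l \<Longrightarrow> away l X \<Longrightarrow> away l (\<Sum>a\<in>UNIV. e k a x * X * e k y a)"
  by (intro away_sum away_mult away_e) auto

end

section \<open>Trace identities from skew invertibility and the braid relation\<close>

locale hecke_data =
  fixes R S \<Psi> :: "'n :: finite op2" and lam :: complex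
  assumes R_S: "R ** S = mat 1" and S_R: "S ** R = mat 1" and R_eq: "R = S + mat lam"
    and braid_R: "braid_eq R" and skew_R: "is_skew_inverse R \<Psi>"

locale hecke_tower = unit_tower cst e + hecke_data R S \<Psi> lam
  for cst :: "complex \<Rightarrow> 't :: ring_1" and e :: "nat \<Rightarrow> 'n :: finite \<Rightarrow> 'n \<Rightarrow> 't" and R S \<Psi> :: "'n op2" and lam
begin

definition r :: "nat \<Rightarrow> 't" where "r k = op2 k R"
definition s :: "nat \<Rightarrow> 't" where "s k = op2 k S"

lemma r_s [simp]: "r k * s k = 1" and s_r [simp]: "s k * r k = 1"
  by (simp_all add: r_def s_def op2_mult[symmetric] R_S S_R op2_one)

lemma r_eq: "r k = s k + cst lam"
  unfolding r_def s_def by (subst R_eq) (simp add: op2_add op2_mat)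

lemma r_braid: "r k * r (Suc k) * r k = r (Suc k) * r k * r (Suc k)"
proof -
  have "J k 3 (\<lambda>u v. cst (tprod 3 [leg2 3 0 R, leg2 3 1 R, leg2 3 0 R] u v)) =
      J k 3 (\<lambda>u v. cst (tprod 3 [leg2 3 1 R, leg2 3 0 R, leg2 3 1 R] u v))"
    using braid_R unfolding braid_eq_def by simp
  then show ?thesis
    by (simp add: J_coef_tprod[OF coef_cst] J_leg2 r_def mult.assoc)
qed

lemma r_far: "Suc k < l \<Longrightarrow> r k * r l = r l * r k"
  unfolding r_def by (rule op2_far)

lemma away_r: "l \<noteq> k \<Longrightarrow> l \<noteq> Suc k \<Longrightarrow> away l (r k)"
  by (simp add: r_def away_op2)

lemma away_s: "l \<noteq> k \<Longrightarrow> l \<noteq> Suc k \<Longrightarrow> away l (s k)"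
  by (simp add: s_def away_op2)

lemma r_commute: "away k X \<Longrightarrow> away (Suc k) X \<Longrightarrow> r k * X = X * r k"
  by (simp add: r_def com_op2)

lemma s_commute: "away k X \<Longrightarrow> away (Suc k) X \<Longrightarrow> s k * X = X * s k"
  by (simp add: s_def com_op2)

lemma skew1: "(\<Sum>x\<in>UNIV. \<Sum>y\<in>UNIV. R $ (i, x) $ (k, y) * \<Psi> $ (y, j) $ (x, l)) =
    (if i = l \<and> j = k then 1 else 0)"
  using skew_R by (intro skew_entries) (simp add: is_skew_inverse_def)

lemma skew2: "(\<Sum>x\<in>UNIV. \<Sum>y\<in>UNIV. \<Psi> $ (i, x) $ (k, y) * R $ (y, j) $ (x, l)) =
    (if i = l \<and> j = k then 1 else 0)"
  using skew_R by (intro skew_entries) (simp add: is_skew_inverse_def)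

text \<open>Skew invertibility in operator form: the entries of \<open>r k\<close> with respect to
  one factor span all matrices on the other, with coefficients taken from the skew inverse.\<close>

lemma unit_right:
  "e k x y = (\<Sum>j\<in>UNIV. \<Sum>l\<in>UNIV. cst (\<Psi> $ (l, y) $ (j, x)) *
    (\<Sum>p\<in>UNIV. e (Suc k) p j * r k * e (Suc k) l p))"
proof -
  have "(\<Sum>j\<in>UNIV. \<Sum>l\<in>UNIV. cst (\<Psi> $ (l, y) $ (j, x)) *
      (\<Sum>p\<in>UNIV. e (Suc k) p j * r k * e (Suc k) l p)) =
    (\<Sum>j\<in>UNIV. \<Sum>l\<in>UNIV. \<Sum>a\<in>UNIV. \<Sum>c\<in>UNIV. cst (R $ (a, j) $ (c, l) * \<Psi> $ (l, y) $ (j, x)) * e k a c)"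
    unfolding r_def op2_slice_right
    by (simp add: sum_distrib_left cst_mult[symmetric] mult.assoc[symmetric] mult.commute)
  also have "\<dots> = (\<Sum>a\<in>UNIV. \<Sum>c\<in>UNIV. \<Sum>j\<in>UNIV. \<Sum>l\<in>UNIV.
      cst (R $ (a, j) $ (c, l) * \<Psi> $ (l, y) $ (j, x)) * e k a c)"
    by (rule sum_swap4)
  also have "\<dots> = (\<Sum>a\<in>UNIV. \<Sum>c\<in>UNIV. cst (if a = x \<and> y = c then 1 else 0) * e k a c)"
    by (simp only: skew1[symmetric] cst_sum sum_distrib_right)
  also have "\<dots> = (\<Sum>a\<in>UNIV. \<Sum>c\<in>UNIV. if c = y then if a = x then e k x y else 0 else 0)"
    by (intro sum.cong refl) auto
  finally show ?thesis by simp
qed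

lemma unit_left:
  "e (Suc k) x y = (\<Sum>j\<in>UNIV. \<Sum>i\<in>UNIV. cst (\<Psi> $ (y, j) $ (x, i)) *
    (\<Sum>p\<in>UNIV. e k p i * r k * e k j p))"
proof -
  have "(\<Sum>j\<in>UNIV. \<Sum>i\<in>UNIV. cst (\<Psi> $ (y, j) $ (x, i)) *
      (\<Sum>p\<in>UNIV. e k p i * r k * e k j p)) =
    (\<Sum>j\<in>UNIV. \<Sum>i\<in>UNIV. \<Sum>b\<in>UNIV. \<Sum>d\<in>UNIV. cst (\<Psi> $ (y, j) $ (x, i) * R $ (i, b) $ (j, d)) * e (Suc k) b d)"
    unfolding r_def op2_slice_left
    by (simp add: sum_distrib_left cst_mult mult.assoc)
  also have "\<dots> = (\<Sum>b\<in>UNIV. \<Sum>d\<in>UNIV. \<Sum>j\<in>UNIV. \<Sum>i\<in>UNIV.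
      cst (\<Psi> $ (y, j) $ (x, i) * R $ (i, b) $ (j, d)) * e (Suc k) b d)"
    by (rule sum_swap4)
  also have "\<dots> = (\<Sum>b\<in>UNIV. \<Sum>d\<in>UNIV. cst (if y = d \<and> b = x then 1 else 0) * e (Suc k) b d)"
    by (simp only: skew2[symmetric] cst_sum sum_distrib_right)
  also have "\<dots> = (\<Sum>b\<in>UNIV. \<Sum>d\<in>UNIV. if d = y then if b = x then e (Suc k) x y else 0 else 0)"
    by (intro sum.cong refl) auto
  finally show ?thesis by simp
qed

definition C :: "'n \<Rightarrow> 'n \<Rightarrow> complex" where
  "C x y = (\<Sum>z\<in>UNIV. \<Psi> $ (x, z) $ (y, z))"

abbreviation E :: "nat \<Rightarrow> 't \<Rightarrow> 't" where "E \<equiv> ptr C"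

text \<open>\<open>C\<close> is itself a trace of the skew inverse, so tracing the skew inverse
  relation \<open>skew1\<close> once more gives Tr_2(C_2 R) = 1.\<close>

lemma R_C: "(\<Sum>b\<in>UNIV. \<Sum>d\<in>UNIV. R $ (a, b) $ (c, d) * C d b) = (if a = c then 1 else 0)"
proof -
  have "(\<Sum>b\<in>UNIV. \<Sum>d\<in>UNIV. R $ (a, b) $ (c, d) * C d b) =
      (\<Sum>b\<in>UNIV. \<Sum>z\<in>UNIV. \<Sum>d\<in>UNIV. R $ (a, b) $ (c, d) * \<Psi> $ (d, z) $ (b, z))"
    unfolding C_def sum_distrib_left by (intro sum.cong refl sum.swap)
  also have "\<dots> = (\<Sum>z\<in>UNIV. \<Sum>b\<in>UNIV. \<Sum>d\<in>UNIV. R $ (a, b) $ (c, d) * \<Psi> $ (d, z) $ (b, z))"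
    by (rule sum.swap)
  also have "\<dots> = (\<Sum>z\<in>UNIV. if z = c then if a = c then 1 else 0 else 0)"
    unfolding skew1 by (intro sum.cong refl) auto
  finally show ?thesis by simp
qed

lemma E_r: "E (Suc k) (r k) = 1"
proof -
  have unit: "E (Suc k) (cst \<rho> * (e k a c * e (Suc k) b d)) = cst (\<rho> * C d b) * e k a c" for \<rho> a c b d
    using ptr_unit[of "Suc k" 1 C b d]
    by (simp add: ptr_cst ptr_left away_e cst_mult mult.assoc cst_central[of _ "e k a c"])
  have "E (Suc k) (r k) = (\<Sum>a\<in>UNIV. \<Sum>b\<in>UNIV. \<Sum>c\<in>UNIV. \<Sum>d\<in>UNIV.
      cst (R $ (a, b) $ (c, d) * C d b) * e k a c)"
    by (simp add: r_def op2_expand ptr_sum unit)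
  also have "\<dots> = (\<Sum>a\<in>UNIV. \<Sum>c\<in>UNIV. \<Sum>b\<in>UNIV. \<Sum>d\<in>UNIV.
      cst (R $ (a, b) $ (c, d) * C d b) * e k a c)"
    by (intro sum.cong refl sum.swap)
  also have "\<dots> = (\<Sum>a\<in>UNIV. \<Sum>c\<in>UNIV. cst (if a = c then 1 else 0) * e k a c)"
    by (simp only: R_C[symmetric] cst_sum sum_distrib_right)
  also have "\<dots> = (\<Sum>a\<in>UNIV. e k a a)"
    by (intro sum.cong refl) (simp add: if_distrib[of cst] if_distrib[of "\<lambda>x. x * _"] cong: if_cong)
  finally show ?thesis by (simp add: e_sum)
qed

lemma E_r_left: "away (Suc k) X \<Longrightarrow> E (Suc k) (r k * X) = X"
  by (simp add: ptr_right E_r)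

text \<open>The matrix units of a factor are linear combinations of matrix entries of
  \<^term>\<open>r k\<close> with respect to the factor on its left; on those entries the claim follows from
  the braid relation.\<close>

lemma E_conj:
  assumes "away (Suc (Suc k)) X"
  shows "E (Suc (Suc k)) (r (Suc k) * X * s (Suc k)) = E (Suc k) X"
proof -
  let ?F = "\<lambda>X. E (Suc (Suc k)) (r (Suc k) * X * s (Suc k))"
  have F_add: "?F (sum f A) = (\<Sum>a\<in>A. ?F (f a))" for f :: "'n \<Rightarrow> 't" and A
    by (simp add: sum_distrib_left sum_distrib_right ptr_sum)
  have F_cst: "?F (cst c * Y) = cst c * ?F Y" for c Y
    by (simp add: cst_left_commute[of "r (Suc k)"] mult.assoc ptr_cst)
  have F_e: "?F (e k p i * Y * e k j p') = e k p i * ?F Y * e k j p'" for p i Y j p'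
  proof -
    have "r (Suc k) * (e k p i * Y * e k j p') * s (Suc k) =
        (r (Suc k) * e k p i) * Y * (e k j p' * s (Suc k))"
      by (simp only: mult.assoc)
    also have "\<dots> = (e k p i * r (Suc k)) * Y * (s (Suc k) * e k j p')"
      by (simp add: r_commute away_e s_commute)
    also have "\<dots> = e k p i * (r (Suc k) * Y * s (Suc k)) * e k j p'"
      by (simp only: mult.assoc)
    finally show ?thesis by (simp add: ptr_left ptr_right away_e)
  qed
  \<comment> \<open>The braid relation makes \<open>r (Suc k)\<close> occur only once, between
    operators that act trivially on the traced factor; they cancel after \<open>E_r\<close>.\<close>
  have "r (Suc k) * r k * s (Suc k) = s k * (r k * r (Suc k) * r k) * s (Suc k)"
    by (simp add: mult.assoc[symmetric])
  also have "\<dots> = s k * r (Suc k) * r k"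
    unfolding r_braid by (simp add: mult.assoc)
  finally have "?F (r k) = E (Suc (Suc k)) (s k * r (Suc k) * r k)" by simp
  also have "\<dots> = 1"
    by (simp add: ptr_left ptr_right away_r away_s E_r mult.assoc)
  finally have F_r: "?F (r k) = E (Suc k) (r k)" by (simp add: E_r)
  have unit: "?F (e (Suc k) x y) = E (Suc k) (e (Suc k) x y)" for x y
    by (subst (1 2) unit_left) (simp add: F_add F_cst F_e F_r ptr_sum ptr_cst ptr_left ptr_right away_e)
  let ?x = "\<lambda>x y. \<Sum>a\<in>UNIV. e (Suc k) a x * X * e (Suc k) y a"
  have x: "away (Suc k) (?x x y)" "away (Suc (Suc k)) (?x x y)" for x y
    using assms by (auto intro: away_unit_coeff away_unit_coeff_other)
  have "?F (e (Suc k) x y * ?x x y) = ?F (e (Suc k) x y) * ?x x y" for x y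
  proof -
    have "r (Suc k) * (e (Suc k) x y * ?x x y) * s (Suc k) =
        r (Suc k) * e (Suc k) x y * (?x x y * s (Suc k))"
      by (simp only: mult.assoc)
    also have "\<dots> = r (Suc k) * e (Suc k) x y * (s (Suc k) * ?x x y)"
      by (simp only: s_commute[OF x])
    also have "\<dots> = (r (Suc k) * e (Suc k) x y * s (Suc k)) * ?x x y"
      by (simp only: mult.assoc)
    finally show ?thesis by (simp only: ptr_right[OF x(2)])
  qed
  then have "?F (e (Suc k) x y * ?x x y) = E (Suc k) (e (Suc k) x y * ?x x y)" for x y
    by (simp only: unit ptr_right[OF x(1)])
  then have "?F (\<Sum>x\<in>UNIV. \<Sum>y\<in>UNIV. e (Suc k) x y * ?x x y) =
      E (Suc k) (\<Sum>x\<in>UNIV. \<Sum>y\<in>UNIV. e (Suc k) x y * ?x x y)"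
    by (simp only: F_add ptr_sum)
  then show ?thesis by (simp only: unit_decomp[of X "Suc k", symmetric])
qed

lemma E_sandwich:
  assumes "away (Suc (Suc k)) X"
  shows "E (Suc (Suc k)) (r (Suc k) * X * r (Suc k)) = E (Suc k) X + cst lam * X"
proof -
  have "r (Suc k) * X * r (Suc k) = r (Suc k) * X * s (Suc k) + cst lam * (r (Suc k) * X)"
    by (subst (2) r_eq) (simp add: distrib_left cst_central)
  then show ?thesis using assms by (simp add: ptr_add ptr_cst E_conj E_r_left)
qed

text \<open>By \<open>unit_left\<close> every \<open>Y\<close> is a combination of \<open>A r B y\<close> with \<open>A, B\<close> acting on the first factor
  and \<open>y\<close> commuting with both factors; for these \<open>E_sandwich\<close> gives a symmetric expression.\<close>

lemma E_E_trace:
  "E (Suc k) (E (Suc (Suc k)) (r (Suc k) * Y)) = E (Suc k) (E (Suc (Suc k)) (Y * r (Suc k)))"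
proof -
  let ?k = "Suc k" and ?l = "Suc (Suc k)"
  let ?P = "\<lambda>Y. E ?k (E ?l (r ?k * Y)) = E ?k (E ?l (Y * r ?k))"
  have sum: "?P (sum f A)" if "\<And>a. a \<in> A \<Longrightarrow> ?P (f a)" for f :: "'n \<Rightarrow> 't" and A
    using that by (simp add: sum_distrib_left sum_distrib_right ptr_sum)
  have cst: "?P (cst c * Y)" if "?P Y" for c Y
    using that by (simp add: cst_left_commute[of "r ?k"] mult.assoc ptr_cst)
  have base: "?P (A * r ?k * B * y)"
    if A: "away ?l A" and B: "away ?l B" and y: "away ?k y" "away ?l y" for A B y
  proof -
    have "r ?k * (A * r ?k * B * y) = (r ?k * A * r ?k) * (B * y)"
      by (simp only: mult.assoc)
    then have "E ?l (r ?k * (A * r ?k * B * y)) = E ?l (r ?k * A * r ?k) * (B * y)"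
      by (simp only: ptr_right[OF away_mult[OF B y(2)]])
    also have "\<dots> = (E ?k A * B + cst lam * (A * B)) * y"
      unfolding E_sandwich[OF A] by (simp only: distrib_right mult.assoc)
    finally have "E ?k (E ?l (r ?k * (A * r ?k * B * y))) = (E ?k A * E ?k B + cst lam * E ?k (A * B)) * y"
      by (simp only: ptr_right[OF y(1)] ptr_add ptr_left[OF away_ptr] ptr_cst)
    moreover have eq: "E ?l (A * r ?k * B * y * r ?k) = A * E ?l (r ?k * B * r ?k) * y"
    proof -
      have "A * r ?k * B * y * r ?k = A * (r ?k * B * r ?k) * y"
        using r_commute[OF y] by (simp add: mult.assoc)
      then show ?thesis by (simp add: ptr_left ptr_right A y)
    qed
    have "A * E ?l (r ?k * B * r ?k) * y = (A * E ?k B + cst lam * (A * B)) * y"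
      by (simp only: E_sandwich[OF B] distrib_left cst_left_commute[of A])
    then have "E ?k (A * E ?l (r ?k * B * r ?k) * y) = (E ?k A * E ?k B + cst lam * E ?k (A * B)) * y"
      by (simp only: ptr_right[OF y(1)] ptr_add ptr_right[OF away_ptr] ptr_cst)
    ultimately show ?thesis by (simp only: eq)
  qed
  have spread: "?P (e ?l x z * V)"
    if "\<And>c p i j. ?P (cst c * ((e ?k p i * r ?k * e ?k j p) * V))" for x z V
  proof -
    from that have "?P (\<Sum>j\<in>UNIV. \<Sum>i\<in>UNIV. \<Sum>p\<in>UNIV. cst (\<Psi> $ (z, j) $ (x, i)) *
        ((e ?k p i * r ?k * e ?k j p) * V))"
      by (intro sum)
    also have "(\<Sum>j\<in>UNIV. \<Sum>i\<in>UNIV. \<Sum>p\<in>UNIV. cst (\<Psi> $ (z, j) $ (x, i)) *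
        ((e ?k p i * r ?k * e ?k j p) * V)) = e ?l x z * V"
      unfolding unit_left[of ?k x z] by (simp only: sum_distrib_left sum_distrib_right mult.assoc)
    finally show ?thesis .
  qed
  have unit: "?P (e ?l x z * W)"
    if W: "away ?l W" for x z W
  proof -
    let ?w = "\<lambda>a b. \<Sum>c\<in>UNIV. e ?k c a * W * e ?k b c"
    have w: "away ?k (?w a b)" "away ?l (?w a b)" for a b
      using W by (auto intro: away_unit_coeff away_unit_coeff_other)
    have "?P (e ?l x z * (e ?k a b * ?w a b))" for a b
    proof -
      \<comment> \<open>The unit \<open>e ?k a b\<close> is absorbed into the right factor
        \<open>B\<close> of \<open>base\<close>; what remains commutes with both traced
        factors.\<close>
      have "?P (e ?k p i * r ?k * (e ?k j p * e ?k a b) * ?w a b)" for p i j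
        by (intro base away_mult away_e w) auto
      then have "?P (cst c * ((e ?k p i * r ?k * e ?k j p) * (e ?k a b * ?w a b)))" for c p i j
        by (intro cst) (simp only: mult.assoc)
      then show ?thesis by (rule spread)
    qed
    then have "?P (\<Sum>a\<in>UNIV. \<Sum>b\<in>UNIV. e ?l x z * (e ?k a b * ?w a b))"
      by (intro sum)
    then show ?thesis
      by (simp only: sum_distrib_left[symmetric] unit_decomp[of W ?k, symmetric])
  qed
  let ?x = "\<lambda>x y. \<Sum>a\<in>UNIV. e ?l a x * Y * e ?l y a"
  have "?P (\<Sum>x\<in>UNIV. \<Sum>y\<in>UNIV. e ?l x y * ?x x y)"
    by (intro sum unit away_unit_coeff)
  then show ?thesis by (simp only: unit_decomp[of Y ?l, symmetric])
qed

subsection \<open>The R-trace and the Hecke algebra\<close>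

text \<open>Position 0 of the tower only serves as the left neighbour in \<open>E_conj\<close>; the tensor factors
  are placed at the positions from 1 on.\<close>

definition t :: "nat \<Rightarrow> 't" where "t i = r (Suc i)"
definition t' :: "nat \<Rightarrow> 't" where "t' i = s (Suc i)"

sublocale hecke_gens cst t t' lam
proof
  fix i j
  show "t i * t' i = 1" "t' i * t i = 1" by (simp_all add: t_def t'_def)
  show "t i * t (Suc i) * t i = t (Suc i) * t i * t (Suc i)" unfolding t_def by (rule r_braid)
  show "t i = t' i + cst lam" unfolding t_def t'_def by (rule r_eq)
  show "t i * t j = t j * t i" if "Suc i < j"
    unfolding t_def using that by (intro r_far) simp
qed

lemma away_t: "l \<noteq> Suc i \<Longrightarrow> l \<noteq> Suc (Suc i) \<Longrightarrow> away l (t i)"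
  by (simp add: t_def away_r)

lemma away_t': "l \<noteq> Suc i \<Longrightarrow> l \<noteq> Suc (Suc i) \<Longrightarrow> away l (t' i)"
  by (simp add: t'_def away_s)

lemma away_H:
  assumes "x \<in> H a b" "l \<le> a \<or> b < l" shows "away l x"
  using assms by (induction x rule: H_induct) (auto intro!: away_mult away_add away_t)

lemma away_sp: "l \<le> a \<or> Suc (a + n) < l \<Longrightarrow> away l (sp a n)"
  and away_sp': "l \<le> a \<or> Suc (a + n) < l \<Longrightarrow> away l (sp' a n)"
  by (rule away_H[OF sp_in_H[of a a n "Suc (a + n)"]]; simp)
     (rule away_H[OF sp'_in_H[of a a n "Suc (a + n)"]]; simp)

text \<open>At most one top generator occurs, and its trace is 1 by \<open>E_r\<close>; without it
  the trace contributes the scalar Tr C. The traced factor is that of strand \<open>b\<close>,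
  because strands are counted from 0 and positions from 1.\<close>

lemma E_in_H: "x \<in> H 0 (Suc b) \<Longrightarrow> E (Suc b) x \<in> H 0 b"
proof (cases b)
  case 0
  assume "x \<in> H 0 (Suc b)"
  then show ?thesis unfolding 0
  proof (induction x rule: H_induct)
    case one
    show ?case by (simp add: ptr_one cst_sum[symmetric] H_cst)
  qed (auto simp: ptr_cst ptr_add intro: H_mult H_cst H_add)
next
  case (Suc c)
  have E1: "E (Suc b) u \<in> H 0 b" if "u \<in> H 0 b" for u
  proof -
    have "E (Suc b) (u * 1) = u * (\<Sum>x\<in>UNIV. cst (C x x))"
      using ptr_left[OF away_H[OF that], of "Suc b" C 1] by (simp add: ptr_one)
    then show ?thesis using that by (simp add: cst_sum[symmetric] H_mult H_cst)
  qed
  assume "x \<in> H 0 (Suc b)"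
  then have "x \<in> split c" unfolding Suc by (rule H_split)
  then show ?thesis
  proof (induction rule: split.induct)
    case (lower u)
    then show ?case using E1 Suc by simp
  next
    case (top u v)
    then have "E (Suc b) (u * t c * v) = u * E (Suc b) (t c) * v"
      using Suc by (simp add: ptr_left ptr_right away_H[of _ 0 "Suc c"])
    also have "E (Suc b) (t c) = 1"
      using E_r[of b] Suc by (simp add: t_def)
    finally show ?case using top Suc by (simp add: H_mult)
  qed (auto simp: ptr_add H_add)
qed

lemma Tr_in_H: "x \<in> H 0 (p + n) \<Longrightarrow> Tr C (Suc p) n x \<in> H 0 p"
proof (induction n arbitrary: p)
  case (Suc n)
  then have "Tr C (Suc (Suc p)) n x \<in> H 0 (Suc p)" by (intro Suc.IH) simp
  then show ?case by (simp add: E_in_H)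
qed simp

lemma Tr_snoc: "Tr C p (Suc n) X = Tr C p n (E (p + n) X)"
  using Tr_append[of C p n 1 X] by simp

text \<open>Once the factors beyond \<open>t i\<close> are traced out, which \<open>t i\<close>
  passes, the claim is \<open>E_E_trace\<close> under the remaining traces.\<close>

lemma Tr_t_cyclic:
  assumes "Suc i < n" shows "Tr C 1 n (t i * X) = Tr C 1 n (X * t i)"
proof -
  obtain m where n: "n = i + Suc (Suc m)"
    using assms that[of "n - i - 2"] by simp
  have eq: "Tr C 1 n Y = Tr C 1 i (E (Suc i) (E (Suc (Suc i)) (Tr C (Suc (Suc (Suc i))) m Y)))" for Y
    unfolding n by (subst Tr_append) simp
  have "away k (t i)" if "Suc (Suc (Suc i)) \<le> k" for k
    using that by (intro away_t) auto
  then show ?thesis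
    unfolding eq by (simp add: Tr_left Tr_right) (simp add: t_def E_E_trace)
qed

lemma Tr_cyclic: "h \<in> H 0 n \<Longrightarrow> Tr C 1 n (h * X) = Tr C 1 n (X * h)"
proof (induction arbitrary: X rule: H_induct)
  case (scale c h)
  have "X * (cst c * h) = cst c * (X * h)" by (rule cst_left_commute)
  with scale show ?case by (simp add: mult.assoc Tr_left)
next
  case (gen i h)
  have "Tr C 1 n (t i * h * X) = Tr C 1 n (h * X * t i)"
    using Tr_t_cyclic[OF gen(2), of "h * X"] by (simp add: mult.assoc)
  also have "\<dots> = Tr C 1 n (X * t i * h)"
    using gen(3)[of "X * t i"] by (simp add: mult.assoc)
  finally show ?case by (simp add: mult.assoc)
qed (auto simp: ring_distribs Tr_add)

text \<open>The braid is removed from its outer end. Its last generator conjugates \<open>X\<close>,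
  and \<open>E_conj\<close> moves the outermost trace one position to the left.\<close>

lemma Tr_sp_conj:
  "away (Suc (m + n)) X \<Longrightarrow> Tr C (Suc (Suc m)) n (sp m n * X * sp' m n) = Tr C (Suc m) n X"
proof (induction n arbitrary: X)
  case (Suc n)
  let ?k = "Suc (Suc (m + n))"
  have "sp m (Suc n) * X * sp' m (Suc n) = sp m n * (t (m + n) * X * t' (m + n)) * sp' m n"
    by (simp only: sp_snoc sp'_snoc mult.assoc)
  then have "E ?k (sp m (Suc n) * X * sp' m (Suc n)) =
      sp m n * E ?k (t (m + n) * X * t' (m + n)) * sp' m n"
    by (simp only: ptr_left ptr_right away_sp away_sp')
      (simp add: ptr_left ptr_right away_sp away_sp')
  also have "E ?k (t (m + n) * X * t' (m + n)) = E (Suc (m + n)) X"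
    unfolding t_def t'_def using Suc.prems by (intro E_conj) simp
  finally have eq: "E ?k (sp m (Suc n) * X * sp' m (Suc n)) =
      sp m n * E (Suc (m + n)) X * sp' m n" .
  have "Tr C (Suc (Suc m)) (Suc n) (sp m (Suc n) * X * sp' m (Suc n)) =
      Tr C (Suc (Suc m)) n (sp m n * E (Suc (m + n)) X * sp' m n)"
    by (simp only: Tr_snoc add_Suc eq)
  also have "\<dots> = Tr C (Suc m) n (E (Suc (m + n)) X)"
    by (intro Suc.IH away_ptr)
  finally show ?case by (simp only: Tr_snoc add_Suc)
qed simp

lemma away_bbar:
  assumes "\<And>k. 2 \<le> k \<Longrightarrow> away k X"
  shows "Suc (Suc j) \<le> k \<Longrightarrow> away k (bbar X j)"
proof (induction j arbitrary: k)
  case (Suc j)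
  then show ?case
    unfolding bbar.simps by (intro away_mult away_t away_t') auto
qed (use assms in auto)

lemma away_prodb:
  assumes "\<And>k. 2 \<le> k \<Longrightarrow> away k X"
  shows "Suc (j + n) \<le> k \<Longrightarrow> away k (prodb X j n)"
proof (induction n arbitrary: j k)
  case (Suc n)
  then show ?case
    unfolding prodb.simps by (intro away_mult away_bbar assms Suc.IH) auto
qed simp

text \<open>One and the same braid raises the indices of the Hecke element and of the copies; its
  inner pair cancels, and the outer pair is undone by moving the traced factors.\<close>

lemma Tr_shift:
  assumes M: "\<And>k. 2 \<le> k \<Longrightarrow> away k X" and "first_leg X" and x: "x \<in> free_on (hecke_letters n)"
  shows "Tr C (Suc m) n (ev (\<lambda>i. t (i + m)) x * prodb X m n) = Tr C 1 n (ev t x * prodb X 0 n)"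
proof (induction m)
  case (Suc m)
  have "ev (\<lambda>i. t (i + Suc m)) x * prodb X (Suc m) n =
      sp m n * (ev (\<lambda>i. t (i + m)) x * (sp' m n * sp m n) * prodb X m n) * sp' m n"
    unfolding ev_shift[OF x] prodb_shift[OF assms(2)] by (simp only: mult.assoc)
  then have "ev (\<lambda>i. t (i + Suc m)) x * prodb X (Suc m) n =
      sp m n * (ev (\<lambda>i. t (i + m)) x * prodb X m n) * sp' m n"
    by (simp only: sp_sp' mult_1_right)
  moreover have "away (Suc (m + n)) (ev (\<lambda>i. t (i + m)) x * prodb X m n)"
    by (intro away_mult away_H[OF ev_t_in_H[OF x]] away_prodb M) auto
  ultimately show ?case using Suc by (simp only: Tr_sp_conj)
qed simp

end

section \<open>A Laplace operator applied to a character\<close>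

locale laplace_tower = hecke_tower cst e R S \<Psi> lam
  for cst :: "complex \<Rightarrow> 't :: ring_1" and e :: "nat \<Rightarrow> 'n :: finite \<Rightarrow> 'n \<Rightarrow> 't" and R S \<Psi> :: "'n op2" and lam +
  fixes M D :: 't and L :: "'t set"
  assumes away_M: "2 \<le> k \<Longrightarrow> away k M" and away_D: "2 \<le> k \<Longrightarrow> away k D"
    and perm_MD: "D * r 1 * M * r 1 = r 1 * M * s 1 * D + r 1"
    and L_add: "x \<in> L \<Longrightarrow> y \<in> L \<Longrightarrow> x + y \<in> L"
    and L_left: "x \<in> L \<Longrightarrow> y * x \<in> L"
    and L_e: "x \<in> L \<Longrightarrow> x * e k a b \<in> L"
    and D_in_L: "D \<in> L"
begin

lemma L_0: "0 \<in> L"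
  using L_left[OF D_in_L, of 0] by simp

lemma L_sum: "(\<And>a. a \<in> A \<Longrightarrow> f a \<in> L) \<Longrightarrow> sum f A \<in> L"
  by (induction A rule: infinite_finite_induct) (auto intro: L_0 L_add)

lemma L_cst: "x \<in> L \<Longrightarrow> x * cst c \<in> L"
  by (simp add: cst_central[symmetric] L_left)

lemma L_op2: "x \<in> L \<Longrightarrow> x * op2 k T \<in> L"
proof -
  assume "x \<in> L"
  then have "x * e k a c * e (Suc k) b d * cst \<rho> \<in> L" for a b c d \<rho>
    by (intro L_cst L_e)
  then show ?thesis
    unfolding op2_expand sum_distrib_left
    by (intro L_sum) (simp add: cst_central[of _ "_ * _"] mult.assoc)
qed

sublocale hecke_double_vacuum cst t t' lam M D L
proof unfold_locales
  show "first_leg M" "first_leg D"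
    by (auto simp: first_leg_def t_def intro!: r_commute away_M away_D)
  show "D * t 0 * M * t 0 = t 0 * M * t' 0 * D + t 0"
    using perm_MD by (simp add: t_def t'_def)
qed (auto simp: L_add L_left L_cst D_in_L t_def r_def L_op2)

lemma L_ptr: "x \<in> L \<Longrightarrow> E k x \<in> L"
  unfolding ptr_def by (intro L_sum L_left L_e)

lemma L_Tr: "x \<in> L \<Longrightarrow> Tr C p n x \<in> L"
  by (induction n arbitrary: p) (auto intro: L_ptr)

text \<open>Cyclicity brings the right Hecke factor to the front. The copies of M act trivially on
  the factors beyond \<open>p\<close>, so tracing those factors affects the Hecke element only and
  keeps it in a Hecke algebra.\<close>

lemma Tr_G:
  assumes "x \<in> G 0 p K" "h \<in> H 0 K" "p \<le> K"
  shows "\<exists>z\<in>H 0 p. Tr C 1 K (h * x) - Tr C 1 p (z * prodb M 0 p) \<in> L"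
  using assms(1)
proof (induction rule: G.induct)
  case (base g h')
  have K: "K = p + (K - p)" using assms(3) by simp
  let ?z = "Tr C (Suc p) (K - p) (h' * h * g)"
  have "Tr C 1 K (h * (g * prodb M 0 p * h')) = Tr C 1 K (h' * (h * g * prodb M 0 p))"
    using Tr_cyclic[OF base(2), of "h * g * prodb M 0 p"] by (simp only: mult.assoc)
  also have "\<dots> = Tr C 1 p (Tr C (1 + p) (K - p) (h' * (h * g * prodb M 0 p)))"
    by (subst K) (rule Tr_append)
  also have "Tr C (1 + p) (K - p) (h' * (h * g * prodb M 0 p)) =
      Tr C (1 + p) (K - p) (h' * h * g) * prodb M 0 p"
    by (subst Tr_right[symmetric]) (auto intro: away_prodb away_M simp: mult.assoc)
  finally have "Tr C 1 K (h * (g * prodb M 0 p * h')) = Tr C 1 p (?z * prodb M 0 p)" by simp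
  moreover have "?z \<in> H 0 p"
    using base assms(2,3) by (intro Tr_in_H H_mult) auto
  ultimately show ?case by (intro bexI[of _ ?z]) (simp_all add: L_0)
next
  case (vac x)
  have "Tr C 1 K (h * x) - Tr C 1 p (0 * prodb M 0 p) \<in> L"
    using vac by (simp add: L_Tr L_left)
  moreover have "0 \<in> H 0 p" using H_cst[of 0] by simp
  ultimately show ?case by blast
next
  case (add x y)
  then obtain z w where z: "z \<in> H 0 p" "Tr C 1 K (h * x) - Tr C 1 p (z * prodb M 0 p) \<in> L"
    and w: "w \<in> H 0 p" "Tr C 1 K (h * y) - Tr C 1 p (w * prodb M 0 p) \<in> L"
    by auto
  have "Tr C 1 K (h * (x + y)) - Tr C 1 p ((z + w) * prodb M 0 p) =
      (Tr C 1 K (h * x) - Tr C 1 p (z * prodb M 0 p)) + (Tr C 1 K (h * y) - Tr C 1 p (w * prodb M 0 p))"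
    by (simp add: ring_distribs Tr_add)
  with z w show ?case by (metis H_add L_add)
qed

theorem laplace_product:
  assumes Q: "Q \<in> H 0 m" and x: "x \<in> free_on (hecke_letters n)"
  shows "\<exists>p. \<exists>z\<in>H 0 p. Tr C 1 m (Q * prodb D 0 m) * Tr C 1 n (ev t x * prodb M 0 n) -
    Tr C 1 p (z * prodb M 0 p) \<in> L"
proof -
  let ?Z = "ev (\<lambda>i. t (i + m)) x" and ?K = "m + n"
  let ?Y = "Tr C (Suc m) n (?Z * prodb M m n)"
  have Z: "?Z \<in> H m ?K" by (rule ev_t_in_H[OF x])
  have Y: "?Y = Tr C 1 n (ev t x * prodb M 0 n)"
    by (intro Tr_shift away_M first_M x)
  \<comment> \<open>The character acts trivially on all factors in use, inside the range because
    they are traced and outside it because nothing acts there. So it may enter the trace of the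
    Laplace operator.\<close>
  have "away k ?Y" if "1 \<le> k" for k
  proof (cases "k \<le> n")
    case True
    with that show ?thesis unfolding Y by (intro away_Tr_inside) auto
  next
    case False
    have "away k (ev t x * prodb M 0 n)"
      using False by (intro away_mult away_prodb away_M away_H[of _ 0 n])
        (auto simp: H_0_conv x)
    with False show ?thesis unfolding Y by (intro away_Tr_outside) auto
  qed
  then have "Tr C 1 m (Q * prodb D 0 m) * ?Y = Tr C 1 m (Q * prodb D 0 m * ?Y)"
    by (intro Tr_right[symmetric]) auto
  \<comment> \<open>The derivatives occupy the factors 1 to \<open>m\<close> and the shifted
    character the factors after them, so the two traces merge into one.\<close>
  also have "\<dots> = Tr C 1 m (Tr C (1 + m) n (Q * prodb D 0 m * (?Z * prodb M m n)))"
    by (subst (2) Tr_left) (auto intro!: away_mult away_prodb away_D away_H[OF Q])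
  also have "\<dots> = Tr C 1 ?K (Q * prodb D 0 m * (?Z * prodb M m n))"
    by (rule Tr_append[symmetric])
  also have "Q * prodb D 0 m * (?Z * prodb M m n) = (Q * ?Z) * (prodb D 0 m * prodb M m n)"
  proof -
    have c: "?Z * prodb D 0 m = prodb D 0 m * ?Z"
      by (rule H_prodb_commute_high[OF first_D Z]) simp
    have "Q * prodb D 0 m * (?Z * prodb M m n) = Q * (prodb D 0 m * ?Z) * prodb M m n"
      by (simp only: mult.assoc)
    then show ?thesis by (simp only: c[symmetric] mult.assoc)
  qed
  finally have eq: "Tr C 1 m (Q * prodb D 0 m) * Tr C 1 n (ev t x * prodb M 0 n) =
      Tr C 1 ?K ((Q * ?Z) * (prodb D 0 m * prodb M m n))"
    by (simp only: Y)
  have h: "Q * ?Z \<in> H 0 ?K"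
    by (intro H_mult H_mono[OF Q] H_mono[OF Z]) auto
  have "1 * prodb M m n * 1 \<in> G m n ?K" by (intro G.base H_one)
  then have G: "if m \<le> n then prodb D 0 m * prodb M m n \<in> G 0 (n - m) ?K
      else prodb D 0 m * prodb M m n \<in> L"
    using prodbD_G[of "prodb M m n" m n ?K] by simp
  show ?thesis
  proof (cases "m \<le> n")
    case True
    with G have "prodb D 0 m * prodb M m n \<in> G 0 (n - m) ?K" by simp
    from Tr_G[OF this h] show ?thesis
      unfolding eq by (intro exI[of _ "n - m"]) simp
  next
    case False
    with G have "Tr C 1 ?K ((Q * ?Z) * (prodb D 0 m * prodb M m n)) \<in> L"
      by (simp add: L_Tr L_left)
    moreover have "0 \<in> H 0 0" using H_cst[of 0] by simp
    ultimately show ?thesis unfolding eq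
      by (intro exI[of _ 0] bexI[of _ 0]) auto
  qed
qed

end

section \<open>The permutation relation in terms of matrix entries\<close>

context unit_tower
begin

definition Mt :: "('n \<times> 'n \<Rightarrow> 't) \<Rightarrow> 't" where
  "Mt m = (\<Sum>x\<in>UNIV. \<Sum>y\<in>UNIV. e 1 x y * m (x, y))"

text \<open>A matrix on one factor, written with pair indices and the identity on the second factor,
  so that it can be multiplied by \<open>Op_mult\<close>.\<close>

definition diag :: "('n \<times> 'n \<Rightarrow> 't) \<Rightarrow> 'n \<times> 'n \<Rightarrow> 'n \<times> 'n \<Rightarrow> 't" where
  "diag m a b = (if snd a = snd b then m (fst a, fst b) else 0)"

lemma com_diag: "(\<And>p. com (m p)) \<Longrightarrow> com (diag m a b)"
  by (simp add: diag_def)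

lemma Mt_Op: "Mt m = Op 1 (diag m)"
proof -
  have "(\<Sum>z\<in>UNIV. e2 1 (x, z) (y, z) * m (x, y)) = e 1 x y * m (x, y)" for x y
  proof -
    have "(\<Sum>z\<in>UNIV. e2 1 (x, z) (y, z) * m (x, y)) = e 1 x y * (\<Sum>z\<in>UNIV. e 2 z z) * m (x, y)"
      by (simp add: e2_def sum_distrib_left sum_distrib_right numeral_2_eq_2)
    then show ?thesis by (simp add: e_sum)
  qed
  moreover have "Op 1 (diag m) = (\<Sum>x\<in>UNIV. \<Sum>y\<in>UNIV. \<Sum>z\<in>UNIV. e2 1 (x, z) (y, z) * m (x, y))"
    by (simp add: Op_def sum_UNIV_prod diag_def if_distrib[of "(*) _"] cong: if_cong)
      (intro sum.cong refl sum.swap)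
  ultimately show ?thesis by (simp add: Mt_def)
qed

lemma diag_left: "(\<Sum>c\<in>UNIV. diag m a c * X c) = (\<Sum>x\<in>UNIV. m (fst a, x) * X (x, snd a))"
  by (simp add: sum_UNIV_prod diag_def if_distrib[of "\<lambda>x. x * _"] cong: if_cong)

lemma diag_right: "(\<Sum>c\<in>UNIV. X c * diag m c d) = (\<Sum>x\<in>UNIV. X (x, snd d) * m (x, fst d))"
  by (simp add: sum_UNIV_prod diag_def if_distrib[of "(*) _"] cong: if_cong)

lemma away_Mt: "(\<And>p. com (m p)) \<Longrightarrow> 2 \<le> k \<Longrightarrow> away k (Mt m)"
  unfolding Mt_def by (intro away_sum away_mult away_e) (auto simp: com_def)

lemma Mt_entry:
  assumes "\<And>p. com (m p)"
  shows "(\<Sum>a\<in>UNIV. e 1 a x * Mt m * e 1 y a) = m (x, y)"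
proof -
  have "e 1 a x * (e 1 z w * m (z, w)) * e 1 y a =
      (if w = y then if z = x then e 1 a a * m (x, y) else 0 else 0)" for a z w
  proof -
    have "e 1 a x * (e 1 z w * m (z, w)) * e 1 y a = (e 1 a x * e 1 z w * e 1 y a) * m (z, w)"
      by (simp add: mult.assoc com_e[OF assms])
    then show ?thesis by (simp add: e_mult)
  qed
  then have "e 1 a x * Mt m * e 1 y a = e 1 a a * m (x, y)" for a
    by (simp add: Mt_def sum_distrib_left sum_distrib_right)
  then show ?thesis by (simp add: sum_distrib_right[symmetric] e_sum)
qed

lemma ent_diff: "ent k (X - Y) a b = ent k X a b - ent k Y a b"
  by (simp add: ent_def algebra_simps sum_subtractf)

end

context hecke_tower
begin

text \<open>Entries of R M R^-1 D R^-1 + 1, the right side of the permutation relation after its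
  last R has been cancelled.\<close>

definition Yent :: "('n \<times> 'n \<Rightarrow> 't) \<Rightarrow> ('n \<times> 'n \<Rightarrow> 't) \<Rightarrow> 'n \<times> 'n \<Rightarrow> 'n \<times> 'n \<Rightarrow> 't" where
  "Yent m d a b = (\<Sum>h\<in>UNIV. \<Sum>g\<in>UNIV. \<Sum>f\<in>UNIV. \<Sum>u\<in>UNIV. \<Sum>v\<in>UNIV. \<Sum>x\<in>UNIV.
      cst (R $ a $ (x, v) * S $ (u, v) $ (f, g) * S $ (h, g) $ b) * (m (x, u) * d (f, h))) +
    (if a = b then 1 else 0)"

lemma Y_Op:
  assumes m: "\<And>p. com (m p)" and d: "\<And>p. com (d p)"
  shows "r 1 * Mt m * s 1 * Mt d * s 1 + 1 = Op 1 (Yent m d)"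
proof -
  let ?R = "\<lambda>a b. cst (R $ a $ b)" and ?S = "\<lambda>a b. cst (S $ a $ b)"
  let ?RM = "\<lambda>a b. \<Sum>x\<in>UNIV. ?R a (x, snd b) * m (x, fst b)"
  let ?RMS = "\<lambda>a b. \<Sum>u\<in>UNIV. ?RM a u * ?S u b"
  let ?RMSD = "\<lambda>a b. \<Sum>f\<in>UNIV. ?RMS a (f, snd b) * d (f, fst b)"
  let ?RMSDS = "\<lambda>a b. \<Sum>h\<in>UNIV. ?RMSD a h * ?S h b"
  have com: "com (?RM a b)" "com (?RMS a b)" "com (?RMSD a b)" for a b
    by (intro com_sum com_mult com_cst m d)+
  have "r 1 * Mt m * s 1 * Mt d * s 1 = Op 1 ?RMSDS"
    unfolding r_def s_def op2_def Mt_Op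
    by (simp add: Op_mult com com_diag m d diag_right)
  also have "?RMSDS = (\<lambda>a b. \<Sum>h\<in>UNIV. \<Sum>g\<in>UNIV. \<Sum>f\<in>UNIV. \<Sum>u\<in>UNIV. \<Sum>v\<in>UNIV. \<Sum>x\<in>UNIV.
      cst (R $ a $ (x, v) * S $ (u, v) $ (f, g) * S $ (h, g) $ b) * (m (x, u) * d (f, h)))"
  proof (intro ext)
    fix a b
    have comb: "cst \<rho> * M * cst \<sigma> * D * cst \<tau> = cst (\<rho> * \<sigma> * \<tau>) * (M * D)" for \<rho> \<sigma> \<tau> M D
    proof -
      have "cst \<rho> * M * cst \<sigma> * D * cst \<tau> = cst \<rho> * (M * cst \<sigma>) * (D * cst \<tau>)"
        by (simp only: mult.assoc)
      also have "\<dots> = cst \<rho> * (cst \<sigma> * M) * (cst \<tau> * D)"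
        by (simp only: cst_central)
      also have "\<dots> = cst \<rho> * (cst \<sigma> * (M * (cst \<tau> * D)))"
        by (simp only: mult.assoc)
      finally show ?thesis by (simp only: cst_left_commute[of M] cst_mult mult.assoc)
    qed
    show "?RMSDS a b = (\<Sum>h\<in>UNIV. \<Sum>g\<in>UNIV. \<Sum>f\<in>UNIV. \<Sum>u\<in>UNIV. \<Sum>v\<in>UNIV. \<Sum>x\<in>UNIV.
        cst (R $ a $ (x, v) * S $ (u, v) $ (f, g) * S $ (h, g) $ b) * (m (x, u) * d (f, h)))"
      by (simp add: sum_UNIV_prod sum_distrib_right comb)
  qed
  also have "Op 1 (\<lambda>a b. \<Sum>h\<in>UNIV. \<Sum>g\<in>UNIV. \<Sum>f\<in>UNIV. \<Sum>u\<in>UNIV. \<Sum>v\<in>UNIV. \<Sum>x\<in>UNIV.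
      cst (R $ a $ (x, v) * S $ (u, v) $ (f, g) * S $ (h, g) $ b) * (m (x, u) * d (f, h))) + 1 =
    Op 1 (Yent m d)"
  proof -
    have "Op 1 (\<lambda>a b. if a = b then 1 else 0) = (1 :: 't)"
      by (simp add: Op_def if_distrib[of "(*) _"] e2_sum cong: if_cong)
    then show ?thesis
      by (simp add: Op_def Yent_def distrib_left sum.distrib)
  qed
  finally show ?thesis .
qed

lemma DrM_Op:
  assumes m: "\<And>p. com (m p)" and d: "\<And>p. com (d p)"
  shows "Mt d * r 1 * Mt m =
    Op 1 (\<lambda>a b. \<Sum>x\<in>UNIV. \<Sum>y\<in>UNIV. cst (R $ (x, snd a) $ (y, snd b)) * (d (fst a, x) * m (y, fst b)))"
proof -
  let ?DR = "\<lambda>a b. \<Sum>x\<in>UNIV. d (fst a, x) * cst (R $ (x, snd a) $ b)"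
  have com: "com (?DR a b)" for a b by (intro com_sum com_mult com_cst d)
  have "Mt d * r 1 * Mt m = Op 1 (\<lambda>a b. \<Sum>y\<in>UNIV. ?DR a (y, snd b) * m (y, fst b))"
    unfolding r_def op2_def Mt_Op
    by (simp add: Op_mult com com_diag m d diag_right diag_left)
  also have "(\<lambda>a b. \<Sum>y\<in>UNIV. ?DR a (y, snd b) * m (y, fst b)) =
      (\<lambda>a b. \<Sum>x\<in>UNIV. \<Sum>y\<in>UNIV. cst (R $ (x, snd a) $ (y, snd b)) * (d (fst a, x) * m (y, fst b)))"
  proof (intro ext)
    fix a b
    have "(\<Sum>y\<in>UNIV. ?DR a (y, snd b) * m (y, fst b)) =
        (\<Sum>y\<in>UNIV. \<Sum>x\<in>UNIV. cst (R $ (x, snd a) $ (y, snd b)) * (d (fst a, x) * m (y, fst b)))"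
      by (simp add: sum_distrib_right mult.assoc cst_left_commute)
    then show "(\<Sum>y\<in>UNIV. ?DR a (y, snd b) * m (y, fst b)) =
        (\<Sum>x\<in>UNIV. \<Sum>y\<in>UNIV. cst (R $ (x, snd a) $ (y, snd b)) * (d (fst a, x) * m (y, fst b)))"
      by (subst sum.swap)
  qed
  finally show ?thesis .
qed

text \<open>The relation D R M = R M R^-1 D R^-1 + 1 is linear in the products of an entry of D and
  an entry of M. The skew inverse of R solves it for a single such product.\<close>

definition straight :: "('n \<times> 'n \<Rightarrow> 't) \<Rightarrow> ('n \<times> 'n \<Rightarrow> 't) \<Rightarrow> 'n \<times> 'n \<Rightarrow> 'n \<times> 'n \<Rightarrow> 't" where
  "straight m d a b = (\<Sum>j\<in>UNIV. \<Sum>l\<in>UNIV.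
    cst (\<Psi> $ (l, fst b) $ (j, snd a)) * Yent m d (fst a, j) (snd b, l))"

lemma com_Yent: "(\<And>p. com (m p)) \<Longrightarrow> (\<And>p. com (d p)) \<Longrightarrow> com (Yent m d a b)"
  unfolding Yent_def by (intro com_add com_sum com_mult com_cst) auto

lemma perm_of_straight:
  assumes m: "\<And>p. com (m p)" and d: "\<And>p. com (d p)"
    and dm: "\<And>a b. d a * m b = straight m d a b"
  shows "Mt d * r 1 * Mt m * r 1 = r 1 * Mt m * s 1 * Mt d + r 1"
proof -
  have "(\<Sum>x\<in>UNIV. \<Sum>y\<in>UNIV. cst (R $ (x, snd a) $ (y, snd b)) * (d (fst a, x) * m (y, fst b))) =
      Yent m d a b" for a b
  proof -
    let ?f = "\<lambda>x y j l. cst (\<Psi> $ (l, y) $ (j, x) * R $ (x, snd a) $ (y, snd b)) *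
        Yent m d (fst a, j) (fst b, l)"
    have "(\<Sum>x\<in>UNIV. \<Sum>y\<in>UNIV. cst (R $ (x, snd a) $ (y, snd b)) * (d (fst a, x) * m (y, fst b))) =
        (\<Sum>x\<in>UNIV. \<Sum>y\<in>UNIV. \<Sum>j\<in>UNIV. \<Sum>l\<in>UNIV. ?f x y j l)"
      by (simp add: dm straight_def sum_distrib_left cst_mult[symmetric] mult.assoc[symmetric] mult.commute)
    also have "\<dots> = (\<Sum>j\<in>UNIV. \<Sum>l\<in>UNIV. \<Sum>x\<in>UNIV. \<Sum>y\<in>UNIV. ?f x y j l)"
      by (rule sum_swap4)
    also have "\<dots> = (\<Sum>j\<in>UNIV. \<Sum>l\<in>UNIV. \<Sum>y\<in>UNIV. \<Sum>x\<in>UNIV. ?f x y j l)"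
      by (intro sum.cong refl sum.swap)
    also have "\<dots> = (\<Sum>j\<in>UNIV. \<Sum>l\<in>UNIV. cst (if l = snd b \<and> snd a = j then 1 else 0) *
        Yent m d (fst a, j) (fst b, l))"
      by (simp only: skew2[symmetric] cst_sum sum_distrib_right)
    also have "\<dots> = (\<Sum>j\<in>UNIV. \<Sum>l\<in>UNIV. if l = snd b then if j = snd a then Yent m d a b else 0 else 0)"
      by (intro sum.cong refl) auto
    finally show ?thesis by simp
  qed
  then have "Mt d * r 1 * Mt m = r 1 * Mt m * s 1 * Mt d * s 1 + 1"
    by (simp only: DrM_Op[OF m d] Y_Op[OF m d])
  then have "Mt d * r 1 * Mt m * r 1 = (r 1 * Mt m * s 1 * Mt d * s 1 + 1) * r 1"
    by simp
  then show ?thesis by (simp add: distrib_right mult.assoc)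
qed

text \<open>The defect \<open>Z\<close> of the permutation relation is kept, so that the solved form
  can also be used modulo an ideal, where the relation holds only up to elements of the
  ideal.\<close>

lemma straight_of_perm:
  assumes m: "\<And>p. com (m p)" and d: "\<And>p. com (d p)"
  defines "Z \<equiv> Mt d * r 1 * Mt m * r 1 - (r 1 * Mt m * s 1 * Mt d + r 1)"
  shows "d a * m b - straight m d a b = (\<Sum>j\<in>UNIV. \<Sum>l\<in>UNIV.
    cst (\<Psi> $ (l, fst b) $ (j, snd a)) * ent 1 (Z * s 1) (fst a, j) (snd b, l))"
proof -
  let ?X = "\<lambda>a b. \<Sum>x\<in>UNIV. \<Sum>y\<in>UNIV. cst (R $ (x, snd a) $ (y, snd b)) * (d (fst a, x) * m (y, fst b))"
  let ?f = "\<lambda>j l x y. cst (R $ (x, j) $ (y, l) * \<Psi> $ (l, fst b) $ (j, snd a)) *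
      (d (fst a, x) * m (y, snd b))"
  have "Z * s 1 = Mt d * r 1 * Mt m - (r 1 * Mt m * s 1 * Mt d * s 1 + 1)"
    unfolding Z_def by (simp add: left_diff_distrib distrib_right mult.assoc)
  also have "\<dots> = Op 1 ?X - Op 1 (Yent m d)"
    by (simp only: DrM_Op[OF m d] Y_Op[OF m d])
  finally have "Z * s 1 = Op 1 ?X - Op 1 (Yent m d)" .
  moreover have "com (?X a b)" for a b
    by (intro com_sum com_mult com_cst m d)
  ultimately have "ent 1 (Z * s 1) p q = ?X p q - Yent m d p q" for p q
    by (simp only: ent_diff ent_Op com_Yent m d)
  then have "(\<Sum>j\<in>UNIV. \<Sum>l\<in>UNIV.
      cst (\<Psi> $ (l, fst b) $ (j, snd a)) * ent 1 (Z * s 1) (fst a, j) (snd b, l)) =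
    (\<Sum>j\<in>UNIV. \<Sum>l\<in>UNIV. \<Sum>x\<in>UNIV. \<Sum>y\<in>UNIV. ?f j l x y) - straight m d a b"
    by (simp add: straight_def right_diff_distrib sum_subtractf sum_distrib_left
      cst_mult[symmetric] mult.assoc[symmetric] mult.commute)
  also have "(\<Sum>j\<in>UNIV. \<Sum>l\<in>UNIV. \<Sum>x\<in>UNIV. \<Sum>y\<in>UNIV. ?f j l x y) =
      (\<Sum>x\<in>UNIV. \<Sum>y\<in>UNIV. \<Sum>j\<in>UNIV. \<Sum>l\<in>UNIV. ?f j l x y)"
    by (rule sum_swap4)
  also have "\<dots> = (\<Sum>x\<in>UNIV. \<Sum>y\<in>UNIV. cst (if x = snd a \<and> fst b = y then 1 else 0) *
      (d (fst a, x) * m (y, snd b)))"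
    by (simp only: skew1[symmetric] cst_sum sum_distrib_right)
  also have "\<dots> = (\<Sum>x\<in>UNIV. \<Sum>y\<in>UNIV. if y = fst b then if x = snd a then d a * m b else 0 else 0)"
    by (intro sum.cong refl) auto
  finally show ?thesis by simp
qed

text \<open>The braid generators in \<open>reflD_push\<close> and \<open>D_reflM_push\<close> can be traded for arbitrary matrices
  on the adjacent factor by \<open>unit_right\<close>, and thereby removed.\<close>

lemmas unit_1 = unit_right[of 1, unfolded Suc_1]
lemmas unit_2 = unit_right[of 2, simplified]

lemma strip_right:
  assumes add: "\<And>x y. x \<in> A \<Longrightarrow> y \<in> A \<Longrightarrow> x + y \<in> A"
    and left: "\<And>x y. x \<in> A \<Longrightarrow> y * x \<in> A" and right: "\<And>x k a b. x \<in> A \<Longrightarrow> x * e k a b \<in> A"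
    and m: "\<And>p. com (m p)" and X: "away 3 X" and XM: "X * r 2 * r 1 * Mt m \<in> A"
  shows "X * m p \<in> A"
proof -
  have zero: "0 \<in> A" using left[OF XM, of 0] by simp
  have sum: "sum f B \<in> A" if "\<And>a. a \<in> B \<Longrightarrow> f a \<in> A" for f :: "'n \<Rightarrow> 't" and B
    using that by (induction B rule: infinite_finite_induct) (auto intro: zero add)
  have M3: "away 3 (Mt m)" "away 2 (Mt m)" using m by (auto intro: away_Mt)
  \<comment> \<open>Units of factor 3 pass \<open>X\<close> on the left and
    \<open>r 1 * Mt m\<close> on the right, so \<open>r 2\<close> may be replaced by its entries
    with respect to factor 3, and these span all matrices on factor 2.\<close>
  have 1: "X * e 2 x y * r 1 * Mt m \<in> A" for x y
  proof -
    have "X * (e 3 q j * r 2 * e 3 l q) * r 1 * Mt m = e 3 q j * (X * r 2 * r 1 * Mt m) * e 3 l q" for q j l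
    proof -
      have "X * (e 3 q j * r 2 * e 3 l q) * r 1 * Mt m = X * e 3 q j * r 2 * (e 3 l q * (r 1 * Mt m))"
        by (simp only: mult.assoc)
      also have "e 3 l q * (r 1 * Mt m) = (r 1 * Mt m) * e 3 l q"
        using away_mult[OF away_r[of 3 1] M3(1)] by (simp add: away_def)
      also have "X * e 3 q j = e 3 q j * X" using X by (simp add: away_def)
      finally show ?thesis by (simp only: mult.assoc)
    qed
    moreover have "e 3 q j * (X * r 2 * r 1 * Mt m) * e 3 l q \<in> A" for q j l
      by (intro right left XM)
    ultimately have "X * (e 3 q j * r 2 * e 3 l q) * r 1 * Mt m \<in> A" for q j l
      by (simp only:)
    then have "cst c * (X * (e 3 q j * r 2 * e 3 l q) * r 1 * Mt m) \<in> A" for c q j l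
      by (rule left)
    then have "X * (cst c * (e 3 q j * r 2 * e 3 l q)) * r 1 * Mt m \<in> A" for c q j l
      by (simp only: cst_left_commute[of X] mult.assoc[of "cst c"])
    then show ?thesis
      unfolding unit_2 sum_distrib_left sum_distrib_right by (intro sum)
  qed
  have 2: "X * e 1 x y * Mt m \<in> A" for x y
  proof -
    have "X * (e 2 q j * r 1 * e 2 l q) * Mt m = X * e 2 q j * r 1 * Mt m * e 2 l q" for q j l
      using M3(2) by (simp add: away_def mult.assoc)
    moreover have "X * e 2 q j * r 1 * Mt m * e 2 l q \<in> A" for q j l
      by (intro right 1)
    ultimately have "X * (e 2 q j * r 1 * e 2 l q) * Mt m \<in> A" for q j l
      by (simp only:)
    then have "cst c * (X * (e 2 q j * r 1 * e 2 l q) * Mt m) \<in> A" for c q j l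
      by (rule left)
    then have "X * (cst c * (e 2 q j * r 1 * e 2 l q)) * Mt m \<in> A" for c q j l
      by (simp only: cst_left_commute[of X] mult.assoc[of "cst c"])
    then show ?thesis
      unfolding unit_1 sum_distrib_left sum_distrib_right by (intro sum)
  qed
  obtain x y where p: "p = (x, y)" by fastforce
  have "(\<Sum>a\<in>UNIV. X * e 1 a x * Mt m * e 1 y a) \<in> A"
    by (intro sum right 2)
  also have "(\<Sum>a\<in>UNIV. X * e 1 a x * Mt m * e 1 y a) = X * m p"
  proof -
    have "X * m p = X * (\<Sum>a\<in>UNIV. e 1 a x * Mt m * e 1 y a)"
      by (simp only: p Mt_entry[OF m])
    then show ?thesis by (simp only: sum_distrib_left mult.assoc)
  qed
  finally show ?thesis .
qed

lemma strip_left: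
  assumes add: "\<And>x y. x \<in> A \<Longrightarrow> y \<in> A \<Longrightarrow> x + y \<in> A"
    and right: "\<And>x y. x \<in> A \<Longrightarrow> x * y \<in> A" and left: "\<And>x k a b. x \<in> A \<Longrightarrow> e k a b * x \<in> A"
    and d: "\<And>p. com (d p)" and g: "\<And>a b. com (g a b)"
    and DG: "Mt d * r 1 * r 2 * Op 1 g \<in> A"
  shows "d p * g a b \<in> A"
proof -
  let ?D = "Mt d" and ?G = "Op 1 g"
  have zero: "0 \<in> A" using right[OF DG, of 0] by simp
  have sum: "sum f B \<in> A" if "\<And>a. a \<in> B \<Longrightarrow> f a \<in> A" for f :: "'n \<Rightarrow> 't" and B
    using that by (induction B rule: infinite_finite_induct) (auto intro: zero add)
  have cst: "cst c * x \<in> A" if "x \<in> A" for c x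
    using right[OF that, of "cst c"] by (simp only: cst_central)
  have D: "away 2 ?D" "away 3 ?D" using d by (auto intro: away_Mt)
  have G3: "away 3 ?G" unfolding Op_def using g
    by (intro away_sum away_mult away_e2) (auto simp: com_def)
  have 1: "?D * r 1 * e 2 x y * ?G \<in> A" for x y
  proof -
    have "?D * r 1 * (e 3 q j * r 2 * e 3 l q) * ?G = e 3 q j * (?D * r 1 * r 2 * ?G) * e 3 l q" for q j l
    proof -
      have "?D * r 1 * (e 3 q j * r 2 * e 3 l q) * ?G = (?D * r 1 * e 3 q j) * r 2 * (e 3 l q * ?G)"
        by (simp only: mult.assoc)
      also have "e 3 l q * ?G = ?G * e 3 l q" using G3 by (simp add: away_def)
      also have "?D * r 1 * e 3 q j = e 3 q j * (?D * r 1)"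
        using away_mult[OF D(2) away_r[of 3 1]] by (simp add: away_def)
      finally show ?thesis by (simp only: mult.assoc)
    qed
    moreover have "e 3 q j * (?D * r 1 * r 2 * ?G) * e 3 l q \<in> A" for q j l
      by (intro right left DG)
    ultimately have "?D * r 1 * (e 3 q j * r 2 * e 3 l q) * ?G \<in> A" for q j l
      by (simp only:)
    then have "cst c * (?D * r 1 * (e 3 q j * r 2 * e 3 l q) * ?G) \<in> A" for c q j l
      by (intro cst)
    then have "?D * r 1 * (cst c * (e 3 q j * r 2 * e 3 l q)) * ?G \<in> A" for c q j l
      by (simp only: cst_left_commute[of "?D * r 1"] mult.assoc[of "cst c"])
    then show ?thesis
      unfolding unit_2 sum_distrib_left sum_distrib_right by (intro sum)
  qed
  \<comment> \<open>Units of factor 2 do not pass \<open>?G\<close>, so \<open>?G\<close> is first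
    decomposed into its entries with respect to that factor.\<close>
  let ?g = "\<lambda>k l. \<Sum>b\<in>UNIV. e 2 b k * ?G * e 2 l b"
  have 2: "?D * r 1 * e 2 x y * ?g k l \<in> A" for x y k l
  proof -
    have "e 2 x y * (e 2 b k * ?G * e 2 l b) = (if y = b then e 2 x k * ?G * e 2 l y else 0)" for b
      by (simp add: e_mult flip: mult.assoc)
    then have "e 2 x y * ?g k l = e 2 x k * ?G * e 2 l y"
      by (simp add: sum_distrib_left)
    then have "?D * r 1 * e 2 x y * ?g k l = (?D * r 1 * e 2 x k * ?G) * e 2 l y"
      by (simp only: mult.assoc)
    then show ?thesis by (simp only: right 1)
  qed
  have 3: "?D * e 1 x y * ?g k l \<in> A" for x y k l
  proof -
    define V where "V = ?g k l"
    have "?D * (e 2 q j * r 1 * e 2 z q) * V = e 2 q j * (?D * r 1 * e 2 z q * V)" for q j z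
    proof -
      have "?D * (e 2 q j * r 1 * e 2 z q) * V = (?D * e 2 q j) * (r 1 * e 2 z q * V)"
        by (simp only: mult.assoc)
      also have "?D * e 2 q j = e 2 q j * ?D" using D(1) by (simp add: away_def)
      finally show ?thesis by (simp only: mult.assoc)
    qed
    moreover have "e 2 q j * (?D * r 1 * e 2 z q * V) \<in> A" for q j z
      unfolding V_def by (intro left 2)
    ultimately have "?D * (e 2 q j * r 1 * e 2 z q) * V \<in> A" for q j z by (simp only:)
    then have "cst c * (?D * (e 2 q j * r 1 * e 2 z q) * V) \<in> A" for c q j z
      by (intro cst)
    then have "?D * (cst c * (e 2 q j * r 1 * e 2 z q)) * V \<in> A" for c q j z
      by (simp only: cst_left_commute[of "?D"] mult.assoc[of "cst c"])
    then have "?D * e 1 x y * V \<in> A"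
      unfolding unit_1 sum_distrib_left sum_distrib_right by (intro sum)
    then show ?thesis by (simp only: V_def)
  qed
  have 4: "?D * g a b \<in> A"
  proof -
    have "(\<Sum>c\<in>UNIV. ?D * e 1 c (fst a) * ?g (snd a) (snd b) * e 1 (fst b) c) \<in> A"
      by (intro sum right 3)
    also have "(\<Sum>c\<in>UNIV. ?D * e 1 c (fst a) * ?g (snd a) (snd b) * e 1 (fst b) c) = ?D * ent 1 ?G a b"
    proof -
      have "e 2 x y * e 1 z w = e 1 z w * e 2 x y" for x y z w by (rule e_comm) simp
      then have "e 1 c (fst a) * (e 2 c' (snd a) * ?G * e 2 (snd b) c') * e 1 (fst b) c =
          e2 1 (c, c') a * ?G * e2 1 b (c, c')" for c c'
        by (simp add: e2_def mult.assoc numeral_2_eq_2)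
      then show ?thesis
        by (simp add: ent_def sum_UNIV_prod sum_distrib_left sum_distrib_right mult.assoc)
    qed
    finally show ?thesis by (simp only: ent_Op[OF g])
  qed
  obtain x y where p: "p = (x, y)" by fastforce
  have "(\<Sum>c\<in>UNIV. e 1 c x * (?D * g a b) * e 1 y c) \<in> A"
    by (intro sum right left 4)
  also have "(\<Sum>c\<in>UNIV. e 1 c x * (?D * g a b) * e 1 y c) = (\<Sum>c\<in>UNIV. e 1 c x * ?D * e 1 y c) * g a b"
    by (simp add: sum_distrib_right mult.assoc com_e[OF g])
  finally show ?thesis by (simp only: Mt_entry[OF d] p)
qed

end

section \<open>Linear operators on functions with values in a free algebra\<close>

definition lin :: "('g free \<Rightarrow> 'h free) \<Rightarrow> bool" where
  "lin F \<longleftrightarrow> (\<forall>x y. F (x + y) = F x + F y) \<and> (\<forall>c x. F (const c * x) = const c * F x)"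

lemma linD: "lin F \<Longrightarrow> F (x + y) = F x + F y" "lin F \<Longrightarrow> F (const c * x) = const c * F x"
  by (auto simp: lin_def)

lemma lin_0: "lin F \<Longrightarrow> F 0 = 0"
  using linD(2)[of F 0 0] by simp

lemma lin_diff: "lin F \<Longrightarrow> F (x - y) = F x - F y"
  using linD(1)[of F "x - y" y] by simp

lemma lin_zero: "lin (\<lambda>x. 0)" and lin_id: "lin (\<lambda>x. x)"
  by (auto simp: lin_def)

lemma lin_add: "lin F \<Longrightarrow> lin G \<Longrightarrow> lin (\<lambda>x. F x + G x)"
  by (auto simp: lin_def algebra_simps)

lemma lin_left: "lin F \<Longrightarrow> lin (\<lambda>x. a * F x)"
  by (auto simp: lin_def algebra_simps const.cst_left_commute)

lemma lin_mult: "lin ((*) a)"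
  by (auto simp: lin_def distrib_left const.cst_left_commute)

lemma lin_comp: "lin F \<Longrightarrow> lin G \<Longrightarrow> lin (\<lambda>x. F (G x))"
  by (auto simp: lin_def)

lemma lin_sum: "(\<And>a. a \<in> A \<Longrightarrow> lin (\<lambda>x. F x a)) \<Longrightarrow> lin (\<lambda>x. \<Sum>a\<in>A. F x a)"
  by (induction A rule: infinite_finite_induct) (auto intro: lin_add lin_zero)

lemma lin_eqI:
  assumes "lin F" "lin G" "\<And>w. F (Poly_Mapping.single w 1) = G (Poly_Mapping.single w 1)"
  shows "F x = G x"
proof (induction x rule: free_induct)
  case (monom w c)
  show ?case
    by (subst (1 2) single_conv_const) (simp add: linD(2)[OF assms(1)] linD(2)[OF assms(2)] assms(3))
qed (auto simp: linD(1)[OF assms(1)] linD(1)[OF assms(2)] lin_0[OF assms(1)] lin_0[OF assms(2)])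

definition lin_ext :: "('g list \<Rightarrow> 'h free) \<Rightarrow> 'g free \<Rightarrow> 'h free" where
  "lin_ext F x = (\<Sum>w\<in>Poly_Mapping.keys x. const (Poly_Mapping.lookup x w) * F w)"

lemma lin_ext_superset:
  assumes "finite A" "Poly_Mapping.keys x \<subseteq> A"
  shows "lin_ext F x = (\<Sum>w\<in>A. const (Poly_Mapping.lookup x w) * F w)"
  unfolding lin_ext_def using assms by (intro sum.mono_neutral_left) (auto simp: in_keys_iff)

lemma lin_lin_ext: "lin (lin_ext F)"
  unfolding lin_def
proof (intro conjI allI)
  fix x y :: "'a free"
  let ?A = "Poly_Mapping.keys x \<union> Poly_Mapping.keys y"
  have "Poly_Mapping.keys (x + y) \<subseteq> ?A" by (rule Poly_Mapping.keys_add)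
  then show "lin_ext F (x + y) = lin_ext F x + lin_ext F y"
    by (simp add: lin_ext_superset[of ?A] lookup_add const_add sum.distrib ring_distribs)
next
  fix c and x :: "'a free"
  have "Poly_Mapping.keys (const c * x) \<subseteq> Poly_Mapping.keys x"
    by (auto simp: in_keys_iff lookup_const_mult)
  then show "lin_ext F (const c * x) = const c * lin_ext F x"
    by (simp add: lin_ext_superset[of "Poly_Mapping.keys x"] lookup_const_mult const_mult
      sum_distrib_left mult.assoc)
qed

lemma lin_ext_single: "lin_ext F (Poly_Mapping.single w 1) = F w"
  by (simp add: lin_ext_def)

text \<open>Linearity is over the complex numbers only: the derivatives act on the values and are
  not linear over the free algebra.\<close>

typedef ('s, 'g) lop = "{f :: ('s \<Rightarrow> 'g free) \<Rightarrow> 's \<Rightarrow> 'g free.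
    (\<forall>x y. f (\<lambda>s. x s + y s) = (\<lambda>s. f x s + f y s)) \<and>
    (\<forall>c x. f (\<lambda>s. const c * x s) = (\<lambda>s. const c * f x s))}"
  morphisms app Abs_lop
  by (intro exI[of _ id]) auto

setup_lifting type_definition_lop

lemma app_add_arg: "app T (\<lambda>s. x s + y s) s = app T x s + app T y s"
  using app[of T] by simp

lemma app_const_arg: "app T (\<lambda>s. const c * x s) s = const c * app T x s"
  using app[of T] by simp

lemma app_0_arg [simp]: "app T (\<lambda>s. 0) s = 0"
  using app_const_arg[of T 0 "\<lambda>s. 0" s] by simp

lemma lop_eqI: "(\<And>f s. app S f s = app T f s) \<Longrightarrow> S = T"
  by (simp add: app_inject[symmetric] fun_eq_iff)

instantiation lop :: (type, type) ring_1
begin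

lift_definition zero_lop :: "('a, 'b) lop" is "\<lambda>f s. 0" by auto
lift_definition one_lop :: "('a, 'b) lop" is "\<lambda>f. f" by auto
lift_definition plus_lop :: "('a, 'b) lop \<Rightarrow> ('a, 'b) lop \<Rightarrow> ('a, 'b) lop" is
  "\<lambda>S T f s. S f s + T f s" by (auto simp: algebra_simps)
lift_definition minus_lop :: "('a, 'b) lop \<Rightarrow> ('a, 'b) lop \<Rightarrow> ('a, 'b) lop" is
  "\<lambda>S T f s. S f s - T f s" by (auto simp: algebra_simps)
lift_definition uminus_lop :: "('a, 'b) lop \<Rightarrow> ('a, 'b) lop" is
  "\<lambda>T f s. - T f s" by auto
lift_definition times_lop :: "('a, 'b) lop \<Rightarrow> ('a, 'b) lop \<Rightarrow> ('a, 'b) lop" is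
  "\<lambda>S T f. S (T f)" by auto

lemmas lop_rep_eq = zero_lop.rep_eq one_lop.rep_eq plus_lop.rep_eq minus_lop.rep_eq
  uminus_lop.rep_eq times_lop.rep_eq

instance
proof
  show "(0 :: ('a, 'b) lop) \<noteq> 1"
  proof
    assume "(0 :: ('a, 'b) lop) = 1"
    then have "app (0 :: ('a, 'b) lop) (\<lambda>s. 1) undefined = app 1 (\<lambda>s. 1) undefined" by simp
    then show False by (simp add: lop_rep_eq)
  qed
qed (rule lop_eqI, simp add: lop_rep_eq app_add_arg algebra_simps)+

end

lemma app_zero [simp]: "app 0 f s = 0" and app_one [simp]: "app 1 f = f"
  and app_add: "app (S + T) f s = app S f s + app T f s"
  and app_diff: "app (S - T) f s = app S f s - app T f s"
  and app_mult: "app (S * T) f = app S (app T f)"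
  by (simp_all add: lop_rep_eq)

lemma app_sum: "app (sum F A) f s = (\<Sum>a\<in>A. app (F a) f s)"
  by (induction A rule: infinite_finite_induct) (auto simp: app_add)

lift_definition cstop :: "complex \<Rightarrow> ('s, 'g) lop" is "\<lambda>c f s. const c * f s"
  by (auto simp: distrib_left intro: const.cst_left_commute)

lift_definition eop :: "nat \<Rightarrow> 'n \<Rightarrow> 'n \<Rightarrow> (nat \<Rightarrow> 'n, 'g) lop" is
  "\<lambda>k x y f s. if s k = x then f (s(k := y)) else 0"
  by auto

lemma app_cstop: "app (cstop c) f s = const c * f s"
  by (simp add: cstop.rep_eq)

lemma app_eop: "app (eop k x y) f s = (if s k = x then f (s(k := y)) else 0)"
  by (simp add: eop.rep_eq)

definition pointop :: "('g free \<Rightarrow> 'g free) \<Rightarrow> ('s, 'g) lop" where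
  "pointop F = Abs_lop (\<lambda>f s. F (f s))"

lemma app_pointop: "lin F \<Longrightarrow> app (pointop F) f s = F (f s)"
  unfolding pointop_def by (subst Abs_lop_inverse) (auto simp: linD)

interpretation lop: unit_tower cstop "eop :: nat \<Rightarrow> 'n :: finite \<Rightarrow> 'n \<Rightarrow> (nat \<Rightarrow> 'n, 'g) lop"
proof
  show "cstop (a + b) = cstop a + (cstop b :: (nat \<Rightarrow> 'n, 'g) lop)" for a b
    by (intro lop_eqI) (simp add: app_cstop app_add const_add distrib_right)
  show "cstop (a * b) = cstop a * (cstop b :: (nat \<Rightarrow> 'n, 'g) lop)" for a b
    by (intro lop_eqI) (simp add: app_cstop app_mult const_mult mult.assoc)
  show "cstop 1 = (1 :: (nat \<Rightarrow> 'n, 'g) lop)"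
    by (intro lop_eqI) (simp add: app_cstop)
  show "cstop a * x = x * cstop a" for a and x :: "(nat \<Rightarrow> 'n, 'g) lop"
  proof (rule lop_eqI)
    fix f :: "(nat \<Rightarrow> 'n) \<Rightarrow> 'g free" and s
    have "app (cstop a) f = (\<lambda>s. const a * f s)" by (simp add: fun_eq_iff app_cstop)
    then show "app (cstop a * x) f s = app (x * cstop a) f s"
      by (simp add: app_cstop app_mult app_const_arg)
  qed
  show "(eop k x y :: (nat \<Rightarrow> 'n, 'g) lop) * eop k z w = (if y = z then eop k x w else 0)" for k x y z w
    by (intro lop_eqI) (simp add: app_mult app_eop)
  show "(eop k x y :: (nat \<Rightarrow> 'n, 'g) lop) * eop l z w = eop l z w * eop k x y" if "k \<noteq> l" for k l x y z w
    using that by (intro lop_eqI) (simp add: app_mult app_eop fun_upd_twist)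
  show "(\<Sum>x\<in>UNIV. eop k x x) = (1 :: (nat \<Rightarrow> 'n, 'g) lop)" for k
    by (intro lop_eqI) (simp add: app_sum app_eop)
qed

lemma com_pointop: "lin F \<Longrightarrow> lop.com (pointop F)"
  unfolding lop.com_def lop.away_def
  by (intro allI lop_eqI) (auto simp: app_mult app_eop app_pointop lin_0)

definition pointwise :: "('s, 'g) lop \<Rightarrow> bool" where
  "pointwise T \<longleftrightarrow> (\<exists>F. lin F \<and> T = pointop F)"

lemma pointwise_pointop: "lin F \<Longrightarrow> pointwise (pointop F)"
  by (auto simp: pointwise_def)

text \<open>Recovers the map on values from a pointwise operator. For such an operator the value
  does not depend on the point, so \<open>undefined\<close> stands for an arbitrary one.\<close>

definition at_const :: "('s, 'g) lop \<Rightarrow> 'g free \<Rightarrow> 'g free" where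
  "at_const T x = app T (\<lambda>_. x) undefined"

lemma at_const: "pointwise T \<Longrightarrow> app T f s = at_const T (f s)"
  by (auto simp: pointwise_def at_const_def app_pointop)

lemma lin_at_const: "lin (at_const T)"
  by (auto simp: lin_def at_const_def app_add_arg app_const_arg)

lemma pointwise_add: "pointwise S \<Longrightarrow> pointwise T \<Longrightarrow> pointwise (S + T)"
  unfolding pointwise_def
proof (elim exE conjE)
  fix F G assume *: "lin F" "S = pointop F" "lin G" "T = pointop G"
  then have "S + T = pointop (\<lambda>x. F x + G x)"
    by (intro lop_eqI) (simp add: app_add app_pointop lin_add)
  with * show "\<exists>F. lin F \<and> S + T = pointop F" by (intro exI[of _ "\<lambda>x. F x + G x"]) (simp add: lin_add)
qed

lemma pointwise_mult: "pointwise S \<Longrightarrow> pointwise T \<Longrightarrow> pointwise (S * T)"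
  unfolding pointwise_def
proof (elim exE conjE)
  fix F G assume *: "lin F" "S = pointop F" "lin G" "T = pointop G"
  then have "S * T = pointop (\<lambda>x. F (G x))"
    by (intro lop_eqI) (simp add: app_mult app_pointop lin_comp)
  with * show "\<exists>F. lin F \<and> S * T = pointop F" by (intro exI[of _ "\<lambda>x. F (G x)"]) (simp add: lin_comp)
qed

lemma pointwise_cstop: "pointwise (cstop c)"
proof -
  have eq: "cstop c = pointop (\<lambda>x. const c * x)"
    by (intro lop_eqI) (simp add: app_cstop app_pointop lin_mult)
  show ?thesis unfolding eq by (intro pointwise_pointop lin_mult)
qed

lemma pointwise_ev:
  fixes g :: "'i \<Rightarrow> (nat \<Rightarrow> 'n :: finite, 'g) lop"
  assumes "\<And>i. pointwise (g i)"
  shows "pointwise (lop.ev g x)"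
proof (induction x rule: free_gen_induct)
  case zero
  show ?case unfolding lop.ev_0 lop.cst_0[symmetric] by (rule pointwise_cstop)
next
  case one
  show ?case unfolding lop.ev_1 lop.cst_1[symmetric] by (rule pointwise_cstop)
qed (auto simp: lop.ev_mult lop.ev_add intro: pointwise_mult pointwise_add pointwise_cstop assms)

lemma lop_ev_left_mult:
  "lop.ev (\<lambda>p. pointop (\<lambda>x. gen p * x)) y = (pointop (\<lambda>x. y * x) :: (nat \<Rightarrow> 'n :: finite, 'g) lop)"
proof (rule lop.ev_unique[symmetric])
  show "(pointop (\<lambda>z. (x + y) * z) :: (nat \<Rightarrow> 'n, 'g) lop) = pointop (\<lambda>z. x * z) + pointop (\<lambda>z. y * z)" for x y
    by (intro lop_eqI) (unfold app_add app_pointop[OF lin_mult], rule distrib_right)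
  show "(pointop (\<lambda>z. (x * y) * z) :: (nat \<Rightarrow> 'n, 'g) lop) = pointop (\<lambda>z. x * z) * pointop (\<lambda>z. y * z)" for x y
    by (intro lop_eqI) (unfold app_mult app_pointop[OF lin_mult], rule mult.assoc)
  show "(pointop (\<lambda>z. const c * z) :: (nat \<Rightarrow> 'n, 'g) lop) = cstop c" for c
    by (intro lop_eqI) (unfold app_cstop app_pointop[OF lin_mult], rule refl)
qed simp

section \<open>Ideals of relations\<close>

lemma rel_ideal:
  assumes "S \<subseteq> free_on A"
  shows rel_ideal_ideal: "ideal (rel_ideal A S) (free_ring A)"
    and rel_ideal_subset: "rel_ideal A S \<subseteq> free_on A"
    and rel_ideal_gen: "s \<in> S \<Longrightarrow> s \<in> rel_ideal A S"
    and rel_ideal_0: "0 \<in> rel_ideal A S"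
    and rel_ideal_add: "x \<in> rel_ideal A S \<Longrightarrow> y \<in> rel_ideal A S \<Longrightarrow> x + y \<in> rel_ideal A S"
    and rel_ideal_left: "x \<in> rel_ideal A S \<Longrightarrow> z \<in> free_on A \<Longrightarrow> z * x \<in> rel_ideal A S"
    and rel_ideal_right: "x \<in> rel_ideal A S \<Longrightarrow> z \<in> free_on A \<Longrightarrow> x * z \<in> rel_ideal A S"
proof -
  interpret F: ring "free_ring A" by (rule ring_free_ring)
  have S: "S \<subseteq> carrier (free_ring A)" using assms by (simp add: free_ring_def)
  show I: "ideal (rel_ideal A S) (free_ring A)"
    unfolding rel_ideal_def by (rule F.genideal_ideal[OF S])
  interpret I: ideal "rel_ideal A S" "free_ring A" by (rule I)
  show "rel_ideal A S \<subseteq> free_on A" using I.a_subset by (simp add: free_ring_def)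
  show "s \<in> S \<Longrightarrow> s \<in> rel_ideal A S"
    using F.genideal_self[OF S] by (auto simp: rel_ideal_def)
  show "0 \<in> rel_ideal A S" using I.zero_closed by (simp add: free_ring_def)
  show "x \<in> rel_ideal A S \<Longrightarrow> y \<in> rel_ideal A S \<Longrightarrow> x + y \<in> rel_ideal A S"
    using I.a_closed by (simp add: free_ring_def)
  show "x \<in> rel_ideal A S \<Longrightarrow> z \<in> free_on A \<Longrightarrow> z * x \<in> rel_ideal A S"
    using I.I_l_closed by (simp add: free_ring_def)
  show "x \<in> rel_ideal A S \<Longrightarrow> z \<in> free_on A \<Longrightarrow> x * z \<in> rel_ideal A S"
    using I.I_r_closed by (simp add: free_ring_def)
qed

lemma rel_ideal_const:
  assumes "S \<subseteq> free_on A" "x \<in> rel_ideal A S" shows "const c * x \<in> rel_ideal A S"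
  using assms by (intro rel_ideal_left const_in_free_on)

lemma rel_ideal_diff:
  assumes "S \<subseteq> free_on A" "x \<in> rel_ideal A S" "y \<in> rel_ideal A S" shows "x - y \<in> rel_ideal A S"
proof -
  have "x + const (- 1) * y \<in> rel_ideal A S"
    using assms by (intro rel_ideal_add rel_ideal_const)
  moreover have "const (- 1) = (- 1 :: 'a free)" by (metis const.cst_minus const_1)
  ultimately show ?thesis by simp
qed

lemma rel_ideal_sum:
  assumes "S \<subseteq> free_on A" "\<And>i. i \<in> B \<Longrightarrow> f i \<in> rel_ideal A S"
  shows "sum f B \<in> rel_ideal A S"
  using assms(2)
  by (induction B rule: infinite_finite_induct) (auto intro: rel_ideal_0[OF assms(1)] rel_ideal_add[OF assms(1)])

lemma rel_ideal_minimal: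
  assumes K: "K \<subseteq> free_on A" "S \<subseteq> K" "0 \<in> K"
    and add: "\<And>x y. x \<in> K \<Longrightarrow> y \<in> K \<Longrightarrow> x + y \<in> K"
    and left: "\<And>x z. x \<in> K \<Longrightarrow> z \<in> free_on A \<Longrightarrow> z * x \<in> K"
    and right: "\<And>x z. x \<in> K \<Longrightarrow> z \<in> free_on A \<Longrightarrow> x * z \<in> K"
  shows "rel_ideal A S \<subseteq> K"
proof -
  interpret F: ring "free_ring A" by (rule ring_free_ring)
  have uminus: "- x \<in> K" if "x \<in> K" for x
  proof -
    have "const (- 1) * x \<in> K" by (intro left that const_in_free_on)
    moreover have "const (- 1) = (- 1 :: 'a free)" by (metis const.cst_minus const_1)
    ultimately show ?thesis by simp
  qed
  have "ideal K (free_ring A)"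
  proof (rule idealI)
    show "subgroup K (add_monoid (free_ring A))"
    proof (rule F.add.subgroupI)
      show "K \<subseteq> carrier (free_ring A)" using K(1) by (simp add: free_ring_def)
      show "K \<noteq> {}" using K(3) by auto
      fix x assume x: "x \<in> K"
      then have "\<ominus>\<^bsub>free_ring A\<^esub> x = - x"
        using K(1) uminus by (intro F.minus_equality) (auto simp: free_ring_def)
      then show "\<ominus>\<^bsub>free_ring A\<^esub> x \<in> K" using uminus x by simp
    qed (simp add: free_ring_def add)
  qed (use F.ring_axioms left right in \<open>auto simp: free_ring_def\<close>)
  then show ?thesis
    unfolding rel_ideal_def using K(2) by (intro F.genideal_minimal)
qed

lemma cls_conv: "cls A S x = {z. z - x \<in> rel_ideal A S}"
proof -
  have "z \<in> cls A S x \<longleftrightarrow> (\<exists>h\<in>rel_ideal A S. z = h + x)" for z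
    by (auto simp: cls_def a_r_coset_def r_coset_def free_ring_def)
  moreover have "(\<exists>h\<in>rel_ideal A S. z = h + x) \<longleftrightarrow> z - x \<in> rel_ideal A S" for z
    by (metis add_diff_cancel diff_add_cancel)
  ultimately show ?thesis by blast
qed

lemma cls_eq_iff:
  assumes "S \<subseteq> free_on A"
  shows "cls A S x = cls A S y \<longleftrightarrow> x - y \<in> rel_ideal A S"
proof
  assume "cls A S x = cls A S y"
  moreover have "x \<in> cls A S x" by (simp add: cls_conv rel_ideal_0[OF assms])
  ultimately show "x - y \<in> rel_ideal A S" by (simp add: cls_conv)
next
  assume xy: "x - y \<in> rel_ideal A S"
  have "z - x \<in> rel_ideal A S \<longleftrightarrow> z - y \<in> rel_ideal A S" for z
    using rel_ideal_add[OF assms _ xy, of "z - x"] rel_ideal_diff[OF assms _ xy, of "z - y"] by auto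
  then show "cls A S x = cls A S y" by (simp add: cls_conv)
qed

lemma presented_ops:
  assumes "S \<subseteq> free_on A" "x \<in> free_on A" "y \<in> free_on A"
  shows presented_add: "cls A S x \<oplus>\<^bsub>presented A S\<^esub> cls A S y = cls A S (x + y)"
    and presented_mult: "cls A S x \<otimes>\<^bsub>presented A S\<^esub> cls A S y = cls A S (x * y)"
proof -
  interpret I: ideal "rel_ideal A S" "free_ring A" by (rule rel_ideal_ideal[OF assms(1)])
  have xy: "x \<in> carrier (free_ring A)" "y \<in> carrier (free_ring A)"
    using assms by (auto simp: free_ring_def)
  show "cls A S x \<oplus>\<^bsub>presented A S\<^esub> cls A S y = cls A S (x + y)"
    using I.a_rcos_sum[OF xy] by (simp add: presented_def FactRing_def cls_def) (simp add: free_ring_def)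
  show "cls A S x \<otimes>\<^bsub>presented A S\<^esub> cls A S y = cls A S (x * y)"
    using I.rcoset_mult_add[OF xy] by (simp add: presented_def FactRing_def cls_def) (simp add: free_ring_def)
qed

lemma presented_one: "\<one>\<^bsub>presented A S\<^esub> = cls A S 1"
  by (simp add: presented_def FactRing_def cls_def) (simp add: free_ring_def)

lemma presented_carrier: "carrier (presented A S) = cls A S ` free_on A"
  by (auto simp: presented_def FactRing_def cls_def A_RCOSETS_def' a_r_coset_def free_ring_def)

lemma free_on_UNIV [simp]: "free_on UNIV = UNIV"
  by (auto simp: free_on_def)

section \<open>The action of the quantum double\<close>

lemma (in unit_tower) J_2: "J p 2 X = Op p (\<lambda>a b. X [fst a, snd a] [fst b, snd b])"
proof -
  have "J p 2 X = (\<Sum>x\<in>UNIV. \<Sum>y\<in>UNIV. \<Sum>x'\<in>UNIV. \<Sum>y'\<in>UNIV.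
      e2 p (x, x') (y, y') * X [x, x'] [y, y'])"
    by (simp add: numeral_2_eq_2 J_Suc J_0 sum_distrib_left e2_def mult.assoc)
  also have "\<dots> = (\<Sum>x\<in>UNIV. \<Sum>x'\<in>UNIV. \<Sum>y\<in>UNIV. \<Sum>y'\<in>UNIV.
      e2 p (x, x') (y, y') * X [x, x'] [y, y'])"
    by (intro sum.cong refl sum.swap)
  finally show ?thesis by (simp add: Op_def sum_UNIV_prod)
qed

lemma (in unit_tower) ent_J_2:
  assumes "\<And>u v. com (X u v)" "length u = 2" "length v = 2"
  shows "X u v = ent p (J p 2 X) (u ! 0, u ! 1) (v ! 0, v ! 1)"
proof -
  have "u = [u ! 0, u ! 1]" "v = [v ! 0, v ! 1]"
    using assms(2,3) by (auto simp: list_eq_iff_nth_eq less_2_cases_iff)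
  then show ?thesis using assms(1) by (simp add: J_2 ent_Op)
qed

context hecke_tower
begin

lemma J_leg2_coef:
  "coef (ev g) \<Longrightarrow> Suc i < k \<Longrightarrow> J p k (\<lambda>u v. ev g (lift (leg2 k i T) u v)) = op2 (p + i) T"
  by (simp add: lift_def J_leg2)

lemma J_leg1_coef:
  assumes "coef (ev g)" "0 < k"
  shows "J 1 k (\<lambda>u v. ev g (leg1 k 0 X u v)) = Mt (\<lambda>p. ev g (X (fst p) (snd p)))"
  using assms J_coef_leg1[OF assms(1), of 1 "k - 1" X] by (simp add: Mt_def)

lemma J_refl:
  fixes f :: "'n \<times> 'n \<Rightarrow> 'g" and g :: "'g \<Rightarrow> 't"
  assumes "\<And>i. com (g i)"
  defines "X \<equiv> leg1 2 0 (gen_mat f)" and "m \<equiv> \<lambda>p. g (f p)"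
  shows "J 1 2 (\<lambda>u v. ev g (tprod 2 [lift (leg2 2 0 T), X, lift (leg2 2 0 T), X] u v -
      tprod 2 [X, lift (leg2 2 0 T), X, lift (leg2 2 0 T)] u v)) =
    op2 1 T * Mt m * op2 1 T * Mt m - Mt m * op2 1 T * Mt m * op2 1 T"
proof -
  have c: "coef (ev g)" by (intro coef_ev assms)
  have X: "J 1 2 (\<lambda>u v. ev g (X u v)) = Mt m"
    using J_leg1_coef[OF c, of 2 "gen_mat f"] by (simp add: X_def m_def gen_mat_def)
  have T: "J 1 2 (\<lambda>u v. ev g (lift (leg2 2 0 T) u v)) = op2 1 T"
    using J_leg2_coef[OF c, of 0 2 1 T] by simp
  have "J 1 2 (\<lambda>u v. ev g (tprod 2 A u v - tprod 2 B u v)) =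
      J 1 2 (\<lambda>u v. ev g (tprod 2 A u v)) - J 1 2 (\<lambda>u v. ev g (tprod 2 B u v))" for A B
    by (simp add: J_def ev_diff right_diff_distrib sum_subtractf)
  then show ?thesis
    by (simp only: J_coef_tprod[OF c] X T list.map prod_list.Nil prod_list.Cons mult_1_right mult.assoc)
qed

lemma refl_rels_entries:
  fixes f :: "'n \<times> 'n \<Rightarrow> 'g" and g :: "'g \<Rightarrow> 't"
  assumes "\<And>i. com (g i)" "x \<in> refl_rels T (gen_mat f)"
  defines "m \<equiv> \<lambda>p. g (f p)"
  shows "\<exists>a b. ev g x = ent 1 (op2 1 T * Mt m * op2 1 T * Mt m - Mt m * op2 1 T * Mt m * op2 1 T) a b"
proof -
  let ?X = "leg1 2 0 (gen_mat f)"
  obtain u v where uv: "length u = 2" "length v = 2"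
    "x = tprod 2 [lift (leg2 2 0 T), ?X, lift (leg2 2 0 T), ?X] u v -
      tprod 2 [?X, lift (leg2 2 0 T), ?X, lift (leg2 2 0 T)] u v"
    using assms(2) by (auto simp: refl_rels_def entry_rels_def Let_def)
  have "ev g x = ent 1 (J 1 2 (\<lambda>u v. ev g (tprod 2 [lift (leg2 2 0 T), ?X, lift (leg2 2 0 T), ?X] u v -
      tprod 2 [?X, lift (leg2 2 0 T), ?X, lift (leg2 2 0 T)] u v))) (u ! 0, u ! 1) (v ! 0, v ! 1)"
    unfolding uv(3) by (rule ent_J_2[OF com_ev uv(1,2)]) (rule assms(1))
  then show ?thesis unfolding J_refl[of g, OF assms(1)] m_def by blast
qed

lemma reflM_Op:
  fixes f :: "'n \<times> 'n \<Rightarrow> 'g" and g :: "'g \<Rightarrow> 't"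
  assumes "\<And>i. com (g i)"
  defines "m \<equiv> \<lambda>p. g (f p)"
  obtains h where "\<And>a b. h a b \<in> refl_rels T (gen_mat f)"
    and "op2 1 T * Mt m * op2 1 T * Mt m - Mt m * op2 1 T * Mt m * op2 1 T = Op 1 (\<lambda>a b. ev g (h a b))"
proof
  let ?X = "leg1 2 0 (gen_mat f)"
  let ?h = "\<lambda>u v. tprod 2 [lift (leg2 2 0 T), ?X, lift (leg2 2 0 T), ?X] u v -
      tprod 2 [?X, lift (leg2 2 0 T), ?X, lift (leg2 2 0 T)] u v"
  show "?h [fst a, snd a] [fst b, snd b] \<in> refl_rels T (gen_mat f)" for a b
    unfolding refl_rels_def entry_rels_def Let_def
    by (intro CollectI exI[of _ "[fst a, snd a]"] exI[of _ "[fst b, snd b]"]) simp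
  show "op2 1 T * Mt m * op2 1 T * Mt m - Mt m * op2 1 T * Mt m * op2 1 T =
      Op 1 (\<lambda>a b. ev g (?h [fst a, snd a] [fst b, snd b]))"
    unfolding m_def by (rule trans[OF J_refl[of g, OF assms(1), symmetric] J_2])
qed

lemma J_perm:
  fixes g :: "'n \<times> 'n + 'n \<times> 'n \<Rightarrow> 't"
  assumes "\<And>i. com (g i)"
  defines "M1 \<equiv> leg1 2 0 (gen_mat Inl)" and "D1 \<equiv> leg1 2 0 (gen_mat Inr)"
    and "m \<equiv> \<lambda>p. g (Inl p)" and "d \<equiv> \<lambda>p. g (Inr p)"
  shows "J 1 2 (\<lambda>u v. ev g (tprod 2 [D1, lift (leg2 2 0 R), M1, lift (leg2 2 0 R)] u v -
      (tprod 2 [lift (leg2 2 0 R), M1, lift (leg2 2 0 S), D1] u v + lift (leg2 2 0 R) u v))) =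
    Mt d * r 1 * Mt m * r 1 - (r 1 * Mt m * s 1 * Mt d + r 1)"
proof -
  have c: "coef (ev g)" by (intro coef_ev assms)
  have M1: "J 1 2 (\<lambda>u v. ev g (M1 u v)) = Mt m"
    using J_leg1_coef[OF c, of 2 "gen_mat Inl"] by (simp add: M1_def m_def gen_mat_def)
  have D1: "J 1 2 (\<lambda>u v. ev g (D1 u v)) = Mt d"
    using J_leg1_coef[OF c, of 2 "gen_mat Inr"] by (simp add: D1_def d_def gen_mat_def)
  have T: "J 1 2 (\<lambda>u v. ev g (lift (leg2 2 0 T) u v)) = op2 1 T" for T
    using J_leg2_coef[OF c, of 0 2 1 T] by simp
  have "J 1 2 (\<lambda>u v. ev g (A u v - (B u v + B' u v))) =
      J 1 2 (\<lambda>u v. ev g (A u v)) - (J 1 2 (\<lambda>u v. ev g (B u v)) + J 1 2 (\<lambda>u v. ev g (B' u v)))" for A B B'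
    by (simp add: J_def ev_diff ev_add algebra_simps sum_subtractf sum.distrib)
  then show ?thesis
    by (simp only: J_coef_tprod[OF c] M1 D1 T r_def s_def list.map prod_list.Nil prod_list.Cons
      mult_1_right mult.assoc)
qed

end

section \<open>Derivatives as operators on the free algebra\<close>

context hecke_data
begin

abbreviation M_ideal :: "('n \<times> 'n) free set" where "M_ideal \<equiv> rel_ideal UNIV (M_rels R)"

sublocale T: hecke_tower cstop "eop :: nat \<Rightarrow> 'n \<Rightarrow> 'n \<Rightarrow> (nat \<Rightarrow> 'n, 'g) lop" R S \<Psi> lam
  by unfold_locales

text \<open>The permutation relations, solved for \<open>\<partial> m\<close> with the skew inverse as in \<open>straight_of_perm\<close>,
  express \<open>\<partial>\<^sub>a m\<^sub>b z\<close> as \<open>solved F z a b\<close>, where \<open>F p d\<close> is \<open>m\<^sub>p \<partial>\<^sub>d z\<close>.\<close>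

definition solved :: "('n \<times> 'n \<Rightarrow> 'n \<times> 'n \<Rightarrow> 'g free) \<Rightarrow> 'g free \<Rightarrow> 'n \<times> 'n \<Rightarrow> 'n \<times> 'n \<Rightarrow> 'g free" where
  "solved F z a b = (\<Sum>j\<in>UNIV. \<Sum>l\<in>UNIV. const (\<Psi> $ (l, fst b) $ (j, snd a)) *
    ((\<Sum>h\<in>UNIV. \<Sum>g\<in>UNIV. \<Sum>f\<in>UNIV. \<Sum>u\<in>UNIV. \<Sum>v\<in>UNIV. \<Sum>x\<in>UNIV.
      const (R $ (fst a, j) $ (x, v) * S $ (u, v) $ (f, g) * S $ (h, g) $ (snd b, l)) *
      F (x, u) (f, h)) +
     (if (fst a, j) = (snd b, l) then z else 0)))"

text \<open>The solved permutation relation, read as a recursion: a derivative of a word is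
  expressed by derivatives of its tail, and derivatives of the vacuum vanish.\<close>

primrec dword :: "('n \<times> 'n) list \<Rightarrow> 'n \<times> 'n \<Rightarrow> ('n \<times> 'n) free" where
  "dword [] = (\<lambda>a. 0)"
| "dword (b # w) =
    (\<lambda>a. solved (\<lambda>p d. gen p * dword w d) (Poly_Mapping.single w 1) a b)"

definition d_op :: "'n \<times> 'n \<Rightarrow> ('n \<times> 'n) free \<Rightarrow> ('n \<times> 'n) free" where
  "d_op a = lin_ext (\<lambda>w. dword w a)"

lemma lin_d_op: "lin (d_op a)"
  unfolding d_op_def by (rule lin_lin_ext)

lemma d_op_gen: "d_op a (gen b * y) = solved (\<lambda>p d. gen p * d_op d y) y a b" (is "?F y = ?G y")
proof (rule lin_eqI[of ?F ?G])
  show "lin ?F" by (intro lin_comp[OF lin_d_op] lin_mult)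
  have "lin (\<lambda>y. if P then y else 0)" for P by (cases P) (auto simp: lin_def)
  then show "lin ?G" unfolding solved_def by (intro lin_sum lin_left lin_add lin_d_op)
  show "?F (Poly_Mapping.single w 1) = ?G (Poly_Mapping.single w 1)" for w
    by (simp only: single_Cons_conv[symmetric] d_op_def lin_ext_single dword.simps)
qed

definition mm :: "'n \<times> 'n \<Rightarrow> (nat \<Rightarrow> 'n, 'n \<times> 'n) lop" where
  "mm p = pointop (\<lambda>x. gen p * x)"

definition dd :: "'n \<times> 'n \<Rightarrow> (nat \<Rightarrow> 'n, 'n \<times> 'n) lop" where
  "dd p = pointop (d_op p)"

lemma app_mm: "app (mm p) f s = gen p * f s"
  by (simp add: mm_def app_pointop lin_mult)

lemma app_dd: "app (dd p) f s = d_op p (f s)"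
  by (simp add: dd_def app_pointop lin_d_op)

lemma com_mm: "lop.com (mm p)" and com_dd: "lop.com (dd p)"
  by (simp_all add: mm_def dd_def com_pointop lin_mult lin_d_op)

lemma dd_mm: "dd a * mm b = T.straight mm dd a b"
  by (rule lop_eqI)
    (simp add: T.straight_def T.Yent_def app_mult app_sum app_add app_cstop app_mm app_dd d_op_gen solved_def
      if_distrib[of "\<lambda>T. app T _ _"] cong: if_cong)

abbreviation MM :: "(nat \<Rightarrow> 'n, 'n \<times> 'n) lop" where "MM \<equiv> lop.Mt mm"
abbreviation DD :: "(nat \<Rightarrow> 'n, 'n \<times> 'n) lop" where "DD \<equiv> lop.Mt dd"

definition kills :: "('n \<times> 'n) free \<Rightarrow> (nat \<Rightarrow> 'n, 'n \<times> 'n) lop set" where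
  "kills x = {Z. \<forall>c s. app Z (\<lambda>s. const (c s) * x) s = 0}"

lemma kills_add: "Y \<in> kills x \<Longrightarrow> Z \<in> kills x \<Longrightarrow> Y + Z \<in> kills x"
  by (simp add: kills_def app_add)

lemma kills_left: "Z \<in> kills x \<Longrightarrow> Y * Z \<in> kills x"
proof -
  assume "Z \<in> kills x"
  then have "app Z (\<lambda>s. const (c s) * x) = (\<lambda>s. 0)" for c
    by (simp add: kills_def fun_eq_iff)
  then show ?thesis by (simp add: kills_def app_mult)
qed

lemma kills_e: "Z \<in> kills x \<Longrightarrow> Z * eop k a b \<in> kills x"
proof -
  assume Z: "Z \<in> kills x"
  have "app (eop k a b) (\<lambda>s. const (c s) * x) =
      (\<lambda>s. const (if s k = a then c (s(k := b)) else 0) * x)" for c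
    by (simp add: fun_eq_iff app_eop)
  with Z show ?thesis by (simp add: kills_def app_mult)
qed

lemma DD_kills: "DD \<in> kills 1"
proof -
  have "d_op p (const c) = 0" for p c
    by (simp add: d_op_def lin_ext_def const_def)
  then have "dd p \<in> kills 1" for p
    by (simp add: kills_def app_dd)
  then have "app (dd p) (\<lambda>s. const (c s)) = (\<lambda>s. 0)" for p c
    by (simp add: kills_def fun_eq_iff)
  then show ?thesis
    by (simp add: kills_def lop.Mt_def app_sum app_mult)
qed

sublocale L: laplace_tower cstop "eop :: nat \<Rightarrow> 'n \<Rightarrow> 'n \<Rightarrow> (nat \<Rightarrow> 'n, 'n \<times> 'n) lop"
    R S \<Psi> lam MM DD "kills 1"
proof unfold_locales
  show "DD * T.r 1 * MM * T.r 1 = T.r 1 * MM * T.s 1 * DD + T.r 1"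
    by (rule T.perm_of_straight[OF com_mm com_dd dd_mm])
qed (auto simp: lop.away_Mt com_mm com_dd kills_add kills_left kills_e DD_kills)

end

section \<open>Operators with values in an ideal\<close>

definition into :: "'g free set \<Rightarrow> (nat \<Rightarrow> 'n :: finite, 'g) lop set" where
  "into I = {Z. \<forall>f s. app Z f s \<in> I}"

context
  fixes I K :: "'g free set"
  assumes I: "I = rel_ideal UNIV K"
begin

lemma ideal_UNIV:
  shows ideal_0: "0 \<in> I" and ideal_add: "x \<in> I \<Longrightarrow> y \<in> I \<Longrightarrow> x + y \<in> I"
    and ideal_diff: "x \<in> I \<Longrightarrow> y \<in> I \<Longrightarrow> x - y \<in> I"
    and ideal_left: "x \<in> I \<Longrightarrow> z * x \<in> I" and ideal_right: "x \<in> I \<Longrightarrow> x * z \<in> I"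
    and ideal_sum: "(\<And>i. i \<in> B \<Longrightarrow> f i \<in> I) \<Longrightarrow> sum f B \<in> I"
  unfolding I
  by (auto intro: rel_ideal_0 rel_ideal_add rel_ideal_diff rel_ideal_left rel_ideal_right rel_ideal_sum)

lemma into_add: "Y \<in> into I \<Longrightarrow> Z \<in> into I \<Longrightarrow> Y + Z \<in> into I"
  by (simp add: into_def app_add ideal_add)

lemma into_right: "Z \<in> into I \<Longrightarrow> Z * Y \<in> into I"
  by (simp add: into_def app_mult)

lemma into_e: "Z \<in> into I \<Longrightarrow> eop k a b * Z \<in> into I"
  by (simp add: into_def app_mult app_eop ideal_0)

lemma into_0: "0 \<in> into I"
  by (simp add: into_def ideal_0)

lemma into_sum: "(\<And>a. a \<in> B \<Longrightarrow> F a \<in> into I) \<Longrightarrow> sum F B \<in> into I"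
  by (induction B rule: infinite_finite_induct) (auto intro: into_add into_0)

lemma into_cst: "Z \<in> into I \<Longrightarrow> cstop c * Z \<in> into I"
  by (simp add: into_def app_mult app_cstop ideal_left)

lemma into_e2: "Z \<in> into I \<Longrightarrow> lop.e2 k a b * Z \<in> into I"
  by (simp add: lop.e2_def mult.assoc into_e)

lemma into_op2: "Z \<in> into I \<Longrightarrow> lop.op2 k T * Z \<in> into I"
  unfolding lop.op2_expand sum_distrib_right mult.assoc
  by (intro into_sum into_cst into_e)

lemma into_ent: "Z \<in> into I \<Longrightarrow> lop.ent k Z a b \<in> into I"
  unfolding lop.ent_def by (intro into_sum into_right into_e2)

lemma into_Op: "(\<And>a b. X a b \<in> into I) \<Longrightarrow> lop.Op k X \<in> into I"
  unfolding lop.Op_def by (intro into_sum into_e2)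

lemma into_pointop: "lin F \<Longrightarrow> (\<And>x. F x \<in> I) \<Longrightarrow> pointop F \<in> into I"
  by (simp add: into_def app_pointop)

end

section \<open>The relations of the double on the free algebra\<close>

context hecke_data
begin

lemma matrix_inv_R: "matrix_inv R = S"
proof -
  have "\<exists>A'. R ** A' = mat 1 \<and> A' ** R = mat 1" using R_S S_R by blast
  then have inv: "R ** matrix_inv R = mat 1" "matrix_inv R ** R = mat 1"
    unfolding matrix_inv_def by (metis (mono_tags, lifting) someI_ex)+
  have "matrix_inv R = matrix_inv R ** (R ** S)" by (simp add: R_S)
  also have "\<dots> = S" by (simp add: matrix_mul_assoc inv)
  finally show ?thesis .
qed

lemma kills_value: "Z \<in> kills x \<Longrightarrow> app Z (\<lambda>_. x) s = 0"
proof -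
  assume "Z \<in> kills x"
  then have "app Z (\<lambda>s. const ((\<lambda>_. 1) s) * x) s = 0" unfolding kills_def by fast
  then show ?thesis by simp
qed

lemma kills_0: "0 \<in> kills x"
  by (simp add: kills_def)

lemma kills_diff: "Y \<in> kills x \<Longrightarrow> Z \<in> kills x \<Longrightarrow> Y - Z \<in> kills x"
  by (simp add: kills_def app_diff)

lemma kills_sum: "(\<And>a. a \<in> A \<Longrightarrow> F a \<in> kills x) \<Longrightarrow> sum F A \<in> kills x"
  by (induction A rule: infinite_finite_induct) (auto intro: kills_0 kills_add)

lemma kills_cst: "Z \<in> kills x \<Longrightarrow> Z * cstop c \<in> kills x"
  by (simp add: lop.cst_central[symmetric] kills_left)

lemma kills_op2: "Z \<in> kills x \<Longrightarrow> Z * lop.op2 k T \<in> kills x"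
proof -
  assume "Z \<in> kills x"
  then have "Z * cstop \<rho> * eop k a c * eop (Suc k) b d \<in> kills x" for a b c d \<rho>
    by (intro kills_cst kills_e)
  then show ?thesis
    unfolding lop.op2_expand sum_distrib_left mult.assoc by (intro kills_sum)
qed

lemma kills_e2: "Z \<in> kills x \<Longrightarrow> Z * lop.e2 k a b \<in> kills x"
  by (simp add: lop.e2_def kills_e flip: mult.assoc)

lemma kills_ent: "Z \<in> kills x \<Longrightarrow> lop.ent k Z a b \<in> kills x"
  unfolding lop.ent_def by (intro kills_sum kills_e2 kills_left)

lemma kills_H: "h \<in> T.H a b \<Longrightarrow> Z \<in> kills x \<Longrightarrow> Z * h \<in> kills x"
proof (induction arbitrary: Z rule: T.H_induct)
  case (scale c h)
  then show ?case by (simp add: kills_cst flip: mult.assoc)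
next
  case (gen i h)
  then have "Z * T.t i * h \<in> kills x"
    by (intro gen.IH) (simp add: T.t_def T.r_def kills_op2)
  then show ?case by (simp add: mult.assoc)
qed (auto simp: distrib_left kills_add)

lemma L_t'_0: "T.t' 0 = lop.op2 1 S" and L_t_0: "T.t 0 = lop.op2 1 R"
  by (simp_all add: T.t'_def T.s_def T.t_def T.r_def)

text \<open>Induction on the word: by \<open>reflD_push\<close>, the product
  \<open>L.reflD * T.t 1 * T.t 0 * MM\<close> ends in \<open>L.reflD\<close> times a Hecke element,
  which kills the shorter word. \<open>strip_right\<close> then replaces \<open>MM\<close> by the
  letter in front.\<close>

lemma reflD_kills: "L.reflD \<in> kills (Poly_Mapping.single w 1)"
proof (induction w)
  case Nil
  have "L.reflD \<in> kills 1"
    unfolding L.reflD_def L_t'_0 by (intro kills_diff kills_left kills_op2 DD_kills)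
  then show ?case by (metis const_1 const_def)
next
  case (Cons p w)
  let ?x = "Poly_Mapping.single w (1 :: complex)"
  have "T.bbar MM 2 * L.reflD * (T.t' 1 * T.t' 1 * L.xx 1 * T.t 1 * T.t 0) \<in> kills ?x"
    using L.xx_in_H[of 1]
    by (intro kills_H[of _ 0 3] kills_left Cons T.H_mult T.H_gen T.H_gen')
      (auto simp: numeral_3_eq_3)
  then have "L.reflD * T.t 1 * T.t 0 * MM \<in> kills ?x"
    by (simp only: L.reflD_push)
  then have push: "L.reflD * T.r 2 * T.r 1 * MM \<in> kills ?x"
    by (simp add: T.t_def numeral_2_eq_2)
  have away: "lop.away 3 L.reflD"
    unfolding L.reflD_def T.t'_def
    by (intro lop.away_diff lop.away_mult T.away_s L.away_D) auto
  have "L.reflD * mm p \<in> kills ?x"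
    by (rule T.strip_right[OF kills_add kills_left kills_e com_mm away push])
  then have Z: "app (L.reflD * mm p) (\<lambda>s. const (c s) * ?x) s = 0" for c s
    by (simp add: kills_def)
  have "app (mm p) (\<lambda>s. const (c s) * ?x) = (\<lambda>s. const (c s) * Poly_Mapping.single (p # w) 1)" for c
    by (simp add: fun_eq_iff app_mm single_Cons_conv const.cst_left_commute)
  with Z show ?case by (simp add: kills_def app_mult)
qed

definition rhoD :: "('n \<times> 'n) free \<Rightarrow> (nat \<Rightarrow> 'n, 'n \<times> 'n) lop" where "rhoD = lop.ev dd"
definition rhoM :: "('n \<times> 'n) free \<Rightarrow> (nat \<Rightarrow> 'n, 'n \<times> 'n) lop" where "rhoM = lop.ev mm"

lemma pointwise_mm: "pointwise (mm p)" and pointwise_dd: "pointwise (dd p)"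
  by (simp_all add: mm_def dd_def pointwise_pointop lin_mult lin_d_op)

lemma pointwise_rhoD: "pointwise (rhoD x)"
  unfolding rhoD_def by (intro pointwise_ev pointwise_dd)

lemma rhoM_conv: "rhoM y = pointop (\<lambda>x. y * x)"
  unfolding rhoM_def mm_def[abs_def] by (rule lop_ev_left_mult)

lemma app_rhoM: "app (rhoM y) f s = y * f s"
  by (simp add: rhoM_conv app_pointop lin_mult)

lemma kills_words_0:
  assumes "pointwise Z" "\<And>w. Z \<in> kills (Poly_Mapping.single w 1)"
  shows "Z = 0"
proof -
  have "at_const Z (Poly_Mapping.single w 1) = 0" for w
    by (simp add: at_const_def kills_value assms(2))
  then have "at_const Z y = 0" for y
    by (rule lin_eqI[OF lin_at_const lin_zero])
  then show ?thesis
    by (intro lop_eqI) (simp add: at_const assms(1))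
qed

lemma rhoD_rel:
  assumes "x \<in> D_rels R" shows "rhoD x = 0"
proof -
  have x: "x \<in> refl_rels S (gen_mat id)"
    using assms by (simp add: D_rels_def matrix_inv_R)
  have D: "(\<lambda>p. dd (id p)) = dd" by simp
  obtain a b where ab: "rhoD x = lop.ent 1 L.reflD a b"
    using T.refl_rels_entries[of dd, OF com_dd x]
    unfolding rhoD_def L.reflD_def L_t'_0 D by blast
  show ?thesis
    by (rule kills_words_0[OF pointwise_rhoD]) (simp only: ab kills_ent reflD_kills)
qed

lemma rhoD_ideal: "x \<in> rel_ideal UNIV (D_rels R) \<Longrightarrow> rhoD x = 0"
proof -
  have "rel_ideal UNIV (D_rels R) \<subseteq> {x. rhoD x = 0}"
    by (rule rel_ideal_minimal) (auto simp: rhoD_rel, auto simp: rhoD_def lop.ev_add lop.ev_mult)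
  then show "x \<in> rel_ideal UNIV (D_rels R) \<Longrightarrow> rhoD x = 0" by blast
qed

lemma reflM_entries:
  obtains h where "\<And>a b. h a b \<in> M_rels R" "L.reflM = lop.Op 1 (\<lambda>a b. rhoM (h a b))"
  using T.reflM_Op[of mm R id, OF com_mm]
  unfolding L.reflM_def L_t_0 M_rels_def rhoM_def id_apply by metis

lemma reflM_into: "L.reflM \<in> into M_ideal"
proof -
  obtain h where h: "\<And>a b. h a b \<in> M_rels R" and G: "L.reflM = lop.Op 1 (\<lambda>a b. rhoM (h a b))"
    using reflM_entries by metis
  have "rhoM (h a b) \<in> into M_ideal" for a b
    unfolding rhoM_conv
    by (intro into_pointop[OF refl] lin_mult ideal_right[OF refl] rel_ideal_gen h) simp
  then show ?thesis unfolding G by (intro into_Op[OF refl])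
qed

text \<open>By \<open>D_reflM_push\<close> a derivative before the relation turns into an operator
  that starts with Hecke generators times the relation, hence has values in the ideal.
  \<open>strip_left\<close> isolates a single derivative and a single entry.\<close>

lemma d_op_rel:
  assumes x: "x \<in> M_rels R" shows "d_op p (x * y) \<in> M_ideal"
proof -
  obtain h where "\<And>a b. h a b \<in> M_rels R" and G: "L.reflM = lop.Op 1 (\<lambda>a b. rhoM (h a b))"
    using reflM_entries by metis
  have com: "lop.com (rhoM (h a b))" for a b
    unfolding rhoM_def by (intro lop.com_ev com_mm)
  have "lop.op2 1 R * (lop.op2 2 R * L.reflM) \<in> into M_ideal"
    by (intro into_op2[OF refl] reflM_into)
  then have "T.t 0 * T.t 1 * L.reflM * (T.t' 0 * T.t' 1 * T.t' 0) * DD *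
      (L.xx 1 * (T.t' 0 * T.t' 0) * (T.t 0 * T.t 1 * T.t 0)) \<in> into M_ideal"
    by (intro into_right[OF refl into_right[OF refl into_right[OF refl]]])
      (simp add: T.t_def T.r_def numeral_2_eq_2 mult.assoc)
  then have push: "DD * T.r 1 * T.r 2 * lop.Op 1 (\<lambda>a b. rhoM (h a b)) \<in> into M_ideal"
    unfolding L.D_reflM_push[symmetric] G[symmetric] by (simp add: T.t_def numeral_2_eq_2)
  have dh: "dd p * rhoM (h a b) \<in> into M_ideal" for a b
    by (rule T.strip_left[OF into_add[OF refl] into_right[OF refl] into_e[OF refl] com_dd com push])
  obtain a b where "rhoM x = lop.ent 1 L.reflM a b"
    using T.refl_rels_entries[of mm x R id, OF com_mm] x
    unfolding rhoM_def L.reflM_def L_t_0 M_rels_def id_apply by blast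
  then have "rhoM x = rhoM (h a b)"
    unfolding G lop.ent_Op[OF com] .
  with dh have "dd p * rhoM x \<in> into M_ideal" by simp
  then have "app (dd p * rhoM x) (\<lambda>_. y) undefined \<in> M_ideal" by (simp add: into_def)
  then show ?thesis by (simp add: app_mult app_dd app_rhoM)
qed

lemma d_op_gen_in_ideal:
  assumes "y \<in> M_ideal" "\<And>p. d_op p y \<in> M_ideal"
  shows "d_op p (gen b * y) \<in> M_ideal"
  unfolding d_op_gen solved_def
  by (intro ideal_sum[OF refl] ideal_left[OF refl] ideal_add[OF refl] assms)
    (simp add: assms ideal_0[OF refl])

text \<open>The set \<open>?K\<close> admits an arbitrary right factor \<open>y\<close>, which makes
  it closed under right multiplication. Closure under left multiplication comes from the recursion
  for derivatives of \<open>gen b * y\<close>.\<close>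

lemma d_op_ideal: "x \<in> M_ideal \<Longrightarrow> d_op p x \<in> M_ideal"
proof -
  let ?K = "{x \<in> M_ideal. \<forall>y p. d_op p (x * y) \<in> M_ideal}"
  have "M_ideal \<subseteq> ?K"
  proof (rule rel_ideal_minimal)
    show "M_rels R \<subseteq> ?K" by (auto intro: rel_ideal_gen d_op_rel)
    show "0 \<in> ?K" by (simp add: ideal_0[OF refl] lin_0[OF lin_d_op])
    show "x + y \<in> ?K" if "x \<in> ?K" "y \<in> ?K" for x y
      using that by (simp add: ideal_add[OF refl] distrib_right linD(1)[OF lin_d_op])
    show "x * z \<in> ?K" if "x \<in> ?K" for x z
      using that by (simp add: ideal_right[OF refl] mult.assoc)
    show "z * x \<in> ?K" if x: "x \<in> ?K" for x z
    proof -
      have "\<forall>p. d_op p (z * x * y) \<in> M_ideal" for y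
      proof (induction z rule: free_gen_induct)
        case (scale c z)
        then show ?case by (simp add: mult.assoc linD(2)[OF lin_d_op] ideal_left[OF refl])
      next
        case (gen g z)
        have "z * x * y \<in> M_ideal" using x by (simp add: ideal_left[OF refl] ideal_right[OF refl])
        with gen show ?case
          using d_op_gen_in_ideal[of "z * x * y"] by (simp only: mult.assoc) blast
      qed (use x in \<open>auto simp: ideal_0[OF refl] lin_0[OF lin_d_op] distrib_right
          linD(1)[OF lin_d_op] ideal_add[OF refl]\<close>)
      with x show ?thesis by (simp add: ideal_left[OF refl])
    qed
  qed auto
  then show "x \<in> M_ideal \<Longrightarrow> d_op p x \<in> M_ideal"
    by (metis (no_types, lifting) mem_Collect_eq mult.right_neutral subsetD)
qed

abbreviation double_ideal :: "('n \<times> 'n + 'n \<times> 'n) free set" where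
  "double_ideal \<equiv> rel_ideal UNIV (double_rels R)"

text \<open>This acts on the free algebra and not on M(R). A relation of the double therefore need
  not act as zero, but its values lie in \<open>M_ideal\<close>, which the action preserves.\<close>

definition rho :: "('n \<times> 'n + 'n \<times> 'n) free \<Rightarrow> (nat \<Rightarrow> 'n, 'n \<times> 'n) lop" where
  "rho = lop.ev (case_sum mm dd)"

lemma rho_relabel: "rho (relabel Inl y) = rhoM y" "rho (relabel Inr x) = rhoD x"
  by (simp_all add: rho_def rhoM_def rhoD_def lop.ev_relabel)

lemma pointwise_rho: "pointwise (rho z)"
  unfolding rho_def by (intro pointwise_ev) (auto simp: pointwise_mm pointwise_dd split: sum.splits)

lemma rho_ideal_stable: "x \<in> M_ideal \<Longrightarrow> at_const (rho z) x \<in> M_ideal"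
proof (induction z arbitrary: x rule: free_gen_induct)
  case (gen g z)
  then show ?case
    by (cases g) (simp_all add: rho_def lop.ev_mult at_const_def app_mult app_mm app_dd
      ideal_left[OF refl] d_op_ideal)
qed (auto simp: rho_def lop.ev_mult lop.ev_add at_const_def app_mult app_add app_cstop
  ideal_left[OF refl] ideal_add[OF refl] ideal_0[OF refl])

lemma into_stable: "Z \<in> into M_ideal \<Longrightarrow> rho z * Z \<in> into M_ideal"
  by (simp add: into_def app_mult at_const[OF pointwise_rho] rho_ideal_stable)

lemma double_rels_cases:
  assumes "x \<in> double_rels R"
  obtains "x \<in> refl_rels R (gen_mat Inl)" | "x \<in> refl_rels S (gen_mat Inr)" | "x \<in> perm_rels R"
  using assms by (auto simp: double_rels_def matrix_inv_R)

lemma rho_rel: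
  assumes "x \<in> double_rels R" shows "rho x \<in> into M_ideal"
  using assms
proof (cases rule: double_rels_cases)
  case 1
  have com: "lop.com (case_sum mm dd i)" for i by (cases i) (auto simp: com_mm com_dd)
  have M: "(\<lambda>p. case_sum mm dd (Inl p)) = mm" by auto
  obtain a b where "rho x = lop.ent 1 L.reflM a b"
    using T.refl_rels_entries[of "case_sum mm dd", OF com 1]
    unfolding rho_def L.reflM_def L_t_0 M by blast
  then show ?thesis by (simp only: into_ent[OF refl] reflM_into)
next
  case 2
  have com: "lop.com (case_sum mm dd i)" for i by (cases i) (auto simp: com_mm com_dd)
  have D: "(\<lambda>p. case_sum mm dd (Inr p)) = dd" by auto
  obtain a b where ab: "rho x = lop.ent 1 L.reflD a b"
    using T.refl_rels_entries[of "case_sum mm dd", OF com 2]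
    unfolding rho_def L.reflD_def L_t'_0 D by blast
  have "rho x = 0"
    by (rule kills_words_0[OF pointwise_rho]) (simp only: ab kills_ent reflD_kills)
  then show ?thesis by (simp add: into_0[OF refl])
next
  case 3
  have com: "lop.com (case_sum mm dd i)" for i by (cases i) (auto simp: com_mm com_dd)
  have MD: "(\<lambda>p. case_sum mm dd (Inl p)) = mm" "(\<lambda>p. case_sum mm dd (Inr p)) = dd" by auto
  let ?M1 = "leg1 2 0 (gen_mat Inl)" and ?D1 = "leg1 2 0 (gen_mat Inr)" and ?R = "lift (leg2 2 0 R)"
  let ?X = "\<lambda>u v. tprod 2 [?D1, ?R, ?M1, ?R] u v - (tprod 2 [?R, ?M1, lift (leg2 2 0 S), ?D1] u v + ?R u v)"
  obtain u v where uv: "length u = 2" "length v = 2" "x = ?X u v"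
    using 3 by (auto simp: perm_rels_def entry_rels_def Let_def matrix_inv_R)
  have "rho x = lop.ent 1 (lop.J 1 2 (\<lambda>u v. rho (?X u v))) (u ! 0, u ! 1) (v ! 0, v ! 1)"
    unfolding uv(3) rho_def by (rule lop.ent_J_2[OF lop.com_ev uv(1,2)]) (rule com)
  also have "lop.J 1 2 (\<lambda>u v. rho (?X u v)) = DD * T.r 1 * MM * T.r 1 - (T.r 1 * MM * T.s 1 * DD + T.r 1)"
    unfolding rho_def using T.J_perm[of "case_sum mm dd", OF com] unfolding MD .
  also have "\<dots> = 0"
    using L.perm_MD by simp
  finally have "rho x = 0" by (simp add: lop.ent_def)
  then show ?thesis by (simp add: into_0[OF refl])
qed

lemma rho_ideal: "z \<in> double_ideal \<Longrightarrow> rho z \<in> into M_ideal"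
proof -
  have "double_ideal \<subseteq> {z. rho z \<in> into M_ideal}"
  proof (rule rel_ideal_minimal)
    show "0 \<in> {z. rho z \<in> into M_ideal}" by (simp add: rho_def into_0[OF refl])
    show "x + y \<in> {z. rho z \<in> into M_ideal}"
      if "x \<in> {z. rho z \<in> into M_ideal}" "y \<in> {z. rho z \<in> into M_ideal}" for x y
      using that by (simp add: rho_def lop.ev_add into_add[OF refl])
    show "x * y \<in> {z. rho z \<in> into M_ideal}" if "x \<in> {z. rho z \<in> into M_ideal}" for x y
      using that by (simp add: rho_def lop.ev_mult into_right[OF refl])
    show "y * x \<in> {z. rho z \<in> into M_ideal}" if "x \<in> {z. rho z \<in> into M_ideal}" for x y
      using that into_stable[of "rho x" y] by (simp add: rho_def lop.ev_mult)
  qed (auto simp: rho_rel)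
  then show "z \<in> double_ideal \<Longrightarrow> rho z \<in> into M_ideal" by blast
qed

lemma at_const_rhoD_1: "at_const (rhoD x) 1 = const (counit x)"
proof (induction x rule: free_induct)
  case zero
  show ?case by (simp add: rhoD_def at_const_def counit_def)
next
  case (add x y)
  then show ?case by (simp add: rhoD_def at_const_def counit_def lop.ev_add app_add lookup_add const_add)
next
  case (monom w c)
  have d1: "app (dd p) (\<lambda>_. const a) = (\<lambda>_. 0)" for p a
    by (simp add: fun_eq_iff app_dd d_op_def lin_ext_def const_def)
  have "app (prod_list (map dd w)) (\<lambda>_. 1) s = (if w = [] then 1 else 0)" for s
  proof (induction w rule: rev_induct)
    case (snoc p w)
    show ?case using d1[of p 1] by (simp add: app_mult)
  qed simp
  then show ?case
    by (simp add: rhoD_def at_const_def counit_def lop.ev_single app_mult app_cstop lookup_single when_def)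
qed

definition normal_form :: "(('n \<times> 'n) free \<times> ('n \<times> 'n) free) list \<Rightarrow> ('n \<times> 'n + 'n \<times> 'n) free" where
  "normal_form ps = (\<Sum>(b, a)\<leftarrow>ps. relabel Inl b * relabel Inr a)"

lemma reorders_iff: "reorders R x y ps \<longleftrightarrow> relabel Inr x * relabel Inl y - normal_form ps \<in> double_ideal"
  by (simp add: reorders_def double_cls_def cls_eq_iff normal_form_def)

lemma rho_normal_form:
  "app (rho (normal_form ps)) (\<lambda>_. 1) s = (\<Sum>(b, a)\<leftarrow>ps. const (counit a) * b)"
proof (induction ps)
  case (Cons p ps)
  obtain b a where p: "p = (b, a)" by fastforce
  have "app (rhoD a) (\<lambda>_. 1) = (\<lambda>_. const (counit a))"
    by (simp add: fun_eq_iff at_const[OF pointwise_rhoD] at_const_rhoD_1)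
  then have "app (rho (relabel Inl b * relabel Inr a)) (\<lambda>_. 1) s = const (counit a) * b"
    using rho_relabel by (simp add: rho_def lop.ev_mult app_mult) (simp add: app_rhoM const_central)
  moreover have "rho (normal_form (p # ps)) = rho (relabel Inl b * relabel Inr a) + rho (normal_form ps)"
    by (simp add: normal_form_def rho_def lop.ev_add p)
  ultimately show ?case using Cons by (simp add: app_add p)
qed (simp add: normal_form_def rho_def)

text \<open>Applied to the vacuum 1, a normally ordered sum of products b a gives the sum of the
  counits of a times b. So every reordering has the same value modulo the ideal.\<close>

lemma reorders_value:
  assumes "reorders R x y ps"
  shows "at_const (rhoD x) y - (\<Sum>(b, a)\<leftarrow>ps. const (counit a) * b) \<in> M_ideal"
proof -
  let ?z = "relabel Inr x * relabel Inl y"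
  have "rho (?z - normal_form ps) \<in> into M_ideal"
    using assms by (intro rho_ideal) (simp add: reorders_iff)
  then have "app (rho (?z - normal_form ps)) (\<lambda>_. 1) undefined \<in> M_ideal"
    by (simp add: into_def)
  moreover have "app (rho ?z) (\<lambda>_. 1) undefined = at_const (rhoD x) y"
  proof -
    have "rho ?z = rhoD x * rhoM y" using rho_relabel by (simp add: rho_def lop.ev_mult)
    then show ?thesis by (simp add: app_mult at_const[OF pointwise_rhoD] app_rhoM)
  qed
  ultimately show ?thesis
    using rho_normal_form[of ps undefined] by (simp add: rho_def lop.ev_diff app_diff)
qed

end

lemma relabel_add: "relabel f (x + y) = relabel f x + relabel f y"
  and relabel_mult: "relabel f (x * y) = relabel f x * relabel f y"
  and relabel_const [simp]: "relabel f (const c) = const c"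
  and relabel_gen [simp]: "relabel f (gen i) = gen (f i)"
  and relabel_0 [simp]: "relabel f 0 = 0" and relabel_1 [simp]: "relabel f 1 = 1"
  by (simp_all add: relabel_conv const.ev_add const.ev_mult)

section \<open>Existence of reorderings and the value of the action\<close>

context hecke_data
begin

text \<open>The tower is now taken over the free algebra of the double, with generators acting by
  left multiplication. There \<open>straight_of_perm\<close> expresses the claim through entries of
  the permutation relation, which have values in the ideal.\<close>

lemma reorder_gen:
  "gen (Inr a) * (gen (Inl b) * z) - solved (\<lambda>p d. gen (Inl p) * (gen (Inr d) * z)) z a b \<in> double_ideal"
proof -
  define g :: "'n \<times> 'n + 'n \<times> 'n \<Rightarrow> (nat \<Rightarrow> 'n, 'n \<times> 'n + 'n \<times> 'n) lop"
    where "g i = pointop (\<lambda>x. gen i * x)" for i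
  have com: "lop.com (g i)" for i by (simp add: g_def com_pointop lin_mult)
  have app_g: "app (g i) f s = gen i * f s" for i f s
    by (simp add: g_def app_pointop lin_mult)
  let ?m = "\<lambda>p. g (Inl p)" and ?d = "\<lambda>p. g (Inr p)"
  let ?M1 = "leg1 2 0 (gen_mat Inl)" and ?D1 = "leg1 2 0 (gen_mat Inr)" and ?R = "lift (leg2 2 0 R)"
  let ?X = "\<lambda>u v. tprod 2 [?D1, ?R, ?M1, ?R] u v - (tprod 2 [?R, ?M1, lift (leg2 2 0 S), ?D1] u v + ?R u v)"
  let ?Z = "lop.Mt ?d * T.r 1 * lop.Mt ?m * T.r 1 - (T.r 1 * lop.Mt ?m * T.s 1 * lop.Mt ?d + T.r 1)"
  have "?X [fst a, snd a] [fst b, snd b] \<in> perm_rels R" for a b :: "'n \<times> 'n"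
    unfolding perm_rels_def entry_rels_def Let_def matrix_inv_R
    by (intro CollectI exI[of _ "[fst a, snd a]"] exI[of _ "[fst b, snd b]"]) simp
  then have X: "?X [fst a, snd a] [fst b, snd b] \<in> double_ideal" for a b :: "'n \<times> 'n"
    by (intro rel_ideal_gen) (auto simp: double_rels_def)
  have ev: "lop.ev g x = pointop (\<lambda>z. x * z)" for x
    unfolding g_def[abs_def] by (rule lop_ev_left_mult)
  have "lop.ev g (?X [fst a, snd a] [fst b, snd b]) \<in> into double_ideal" for a b :: "'n \<times> 'n"
    unfolding ev by (intro into_pointop[OF refl] lin_mult ideal_right[OF refl] X)
  moreover have "?Z = lop.Op 1 (\<lambda>a b. lop.ev g (?X [fst a, snd a] [fst b, snd b]))"
    using T.J_perm[of g, OF com] by (simp only: lop.J_2)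
  ultimately have "?Z \<in> into double_ideal"
    by (simp only:) (intro into_Op[OF refl])
  then have "lop.ent 1 (?Z * T.s 1) a b \<in> into double_ideal" for a b
    by (intro into_ent[OF refl] into_right[OF refl])
  then have "(\<Sum>j\<in>UNIV. \<Sum>l\<in>UNIV. cstop (\<Psi> $ (l, fst b) $ (j, snd a)) *
      lop.ent 1 (?Z * T.s 1) (fst a, j) (snd b, l)) \<in> into double_ideal"
    by (intro into_sum[OF refl] into_cst[OF refl])
  then have "?d a * ?m b - T.straight ?m ?d a b \<in> into double_ideal"
    by (simp only: T.straight_of_perm[OF com com])
  then have "app (?d a * ?m b - T.straight ?m ?d a b) (\<lambda>_. z) undefined \<in> double_ideal"
    by (simp add: into_def)
  then show ?thesis
    by (simp add: T.straight_def T.Yent_def solved_def app_mult app_sum app_add app_diff app_cstop app_g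
      if_distrib[of "\<lambda>T. app T _ _"] cong: if_cong)
qed

definition NF :: "('n \<times> 'n + 'n \<times> 'n) free set" where
  "NF = {z. \<exists>ps. z - normal_form ps \<in> double_ideal}"

lemma NF_add: "x \<in> NF \<Longrightarrow> y \<in> NF \<Longrightarrow> x + y \<in> NF"
proof -
  assume "x \<in> NF" "y \<in> NF"
  then obtain ps qs where "x - normal_form ps \<in> double_ideal" "y - normal_form qs \<in> double_ideal"
    by (auto simp: NF_def)
  then have "(x - normal_form ps) + (y - normal_form qs) \<in> double_ideal"
    by (intro ideal_add[OF refl])
  moreover have "normal_form (ps @ qs) = normal_form ps + normal_form qs"
    by (simp add: normal_form_def)
  ultimately have "x + y - normal_form (ps @ qs) \<in> double_ideal" by (simp add: algebra_simps)
  then show ?thesis by (auto simp: NF_def)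
qed

lemma NF_cong: "z - z' \<in> double_ideal \<Longrightarrow> z' \<in> NF \<Longrightarrow> z \<in> NF"
proof -
  assume "z - z' \<in> double_ideal" "z' \<in> NF"
  then obtain ps where "(z - z') + (z' - normal_form ps) \<in> double_ideal"
    using ideal_add[OF refl] by (fastforce simp: NF_def)
  then show ?thesis by (auto simp: NF_def)
qed

lemma NF_base: "relabel Inl b * relabel Inr a \<in> NF"
proof -
  have "relabel Inl b * relabel Inr a - normal_form [(b, a)] \<in> double_ideal"
    by (simp add: normal_form_def ideal_0[OF refl])
  then show ?thesis unfolding NF_def by blast
qed

lemma NF_Inl: "z \<in> NF \<Longrightarrow> relabel Inl b * z \<in> NF"
proof -
  assume "z \<in> NF"
  then obtain ps where "z - normal_form ps \<in> double_ideal" by (auto simp: NF_def)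
  then have "relabel Inl b * (z - normal_form ps) \<in> double_ideal" by (rule ideal_left[OF refl])
  moreover have "relabel Inl b * normal_form ps = normal_form (map (\<lambda>(b', a). (b * b', a)) ps)"
    by (induction ps) (auto simp: normal_form_def distrib_left relabel_mult mult.assoc)
  ultimately have "relabel Inl b * z - normal_form (map (\<lambda>(b', a). (b * b', a)) ps) \<in> double_ideal"
    by (simp add: right_diff_distrib)
  then show ?thesis unfolding NF_def by blast
qed

lemma NF_0: "0 \<in> NF"
  using NF_base[of 0 0] by simp

lemma NF_const: "z \<in> NF \<Longrightarrow> const c * z \<in> NF"
  using NF_Inl[of z "const c"] by simp

lemma NF_sum: "(\<And>i. i \<in> B \<Longrightarrow> f i \<in> NF) \<Longrightarrow> sum f B \<in> NF"
  by (induction B rule: infinite_finite_induct) (auto intro: NF_0 NF_add)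

text \<open>Moving the derivative past the first letter leaves derivatives of the shorter word,
  possibly with other indices; hence \<open>d\<close> is arbitrary in the induction.\<close>

lemma NF_Inr_word: "gen (Inr d) * (relabel Inl (Poly_Mapping.single w 1) * relabel Inr a) \<in> NF"
proof (induction w arbitrary: d)
  case Nil
  have "Poly_Mapping.single [] 1 = (1 :: ('n \<times> 'n) free)" by (metis const_1 const_def)
  then show ?case using NF_base[of 1 "gen d * a"] by (simp add: relabel_mult)
next
  case (Cons p w)
  let ?z = "relabel Inl (Poly_Mapping.single w 1) * relabel Inr a"
  have z: "?z \<in> NF" by (rule NF_base)
  have "gen (Inl x) * (gen (Inr y) * ?z) \<in> NF" for x y
    using NF_Inl[OF Cons, of "gen x"] by simp
  moreover have "(if P then ?z else 0) \<in> NF" for P using z NF_0 by simp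
  ultimately have "gen (Inr d) * (gen (Inl p) * ?z) \<in> NF"
    by (intro NF_cong[OF reorder_gen]) (unfold solved_def, intro NF_sum NF_const NF_add)
  then show ?case by (simp add: single_Cons_conv relabel_mult mult.assoc)
qed

lemma NF_Inr: "z \<in> NF \<Longrightarrow> gen (Inr d) * z \<in> NF"
proof -
  assume "z \<in> NF"
  then obtain ps where ps: "z - normal_form ps \<in> double_ideal" by (auto simp: NF_def)
  have 1: "gen (Inr d) * (relabel Inl b * relabel Inr a) \<in> NF" for b a
  proof (induction b rule: free_induct)
    case (monom w c)
    have "const c * (gen (Inr d) * (relabel Inl (Poly_Mapping.single w 1) * relabel Inr a)) \<in> NF"
      by (intro NF_const NF_Inr_word)
    moreover have w: "relabel Inl (Poly_Mapping.single w c) = const c * relabel Inl (Poly_Mapping.single w 1)"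
      by (subst single_conv_const) (simp only: relabel_mult relabel_const)
    ultimately show ?case
      unfolding w by (simp only: mult.assoc const.cst_left_commute[of "gen (Inr d)"])
  qed (auto simp: NF_0 relabel_add distrib_left distrib_right intro: NF_add)
  have "gen (Inr d) * normal_form ps \<in> NF"
    by (induction ps) (auto simp: normal_form_def NF_0 distrib_left intro!: NF_add 1)
  moreover have "gen (Inr d) * z - gen (Inr d) * normal_form ps \<in> double_ideal"
    using ideal_left[OF refl ps, of "gen (Inr d)"] by (simp add: right_diff_distrib)
  ultimately show ?thesis by (rule NF_cong[rotated])
qed

lemma reorder_exists: "\<exists>ps. reorders R x y ps"
proof -
  have "relabel Inr x * z \<in> NF" if "z \<in> NF" for z
    using that
  proof (induction x arbitrary: z rule: free_gen_induct)
    case (scale c x)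
    then show ?case by (simp add: relabel_mult mult.assoc NF_const)
  next
    case (gen g x)
    then show ?case by (simp add: relabel_mult mult.assoc NF_Inr)
  qed (auto simp: NF_0 relabel_add distrib_right intro: NF_add)
  moreover have "relabel Inl y \<in> NF" using NF_base[of y 1] by simp
  ultimately show ?thesis by (simp add: reorders_iff NF_def)
qed

text \<open>The definite description denotes because a reordering exists, relations of D act as
  zero, and derivatives preserve the relations of M; so neither representatives nor the reordering
  matter.\<close>

lemma act_eq: "act R (D_cls R x) (M_cls R y) = M_cls R (at_const (rhoD x) y)"
  unfolding act_def
proof (rule the_equality)
  have val: "M_cls R (\<Sum>(b, a)\<leftarrow>ps. const (counit a) * b) = M_cls R (at_const (rhoD x) y)"
    if "reorders R x y ps" for x y ps
    using ideal_diff[OF refl ideal_0[OF refl] reorders_value[OF that]]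
    by (simp add: M_cls_def cls_eq_iff)
  have self: "z \<in> cls UNIV K z" for z :: "('n \<times> 'n) free" and K
    using rel_ideal_0[of K UNIV] by (simp add: cls_conv)
  show "\<exists>x'\<in>D_cls R x. \<exists>y'\<in>M_cls R y. \<exists>ps. reorders R x' y' ps \<and>
      M_cls R (at_const (rhoD x) y) = M_cls R (\<Sum>(b, a)\<leftarrow>ps. const (counit a) * b)"
    using reorder_exists[of x y] val self unfolding D_cls_def M_cls_def by metis
  fix c
  assume "\<exists>x'\<in>D_cls R x. \<exists>y'\<in>M_cls R y. \<exists>ps. reorders R x' y' ps \<and>
      c = M_cls R (\<Sum>(b, a)\<leftarrow>ps. const (counit a) * b)"
  then obtain x' y' where xy: "x' \<in> D_cls R x" "y' \<in> M_cls R y"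
    and c: "c = M_cls R (at_const (rhoD x') y')"
    using val by blast
  have "rhoD (x' - x) = 0"
    using xy(1) by (intro rhoD_ideal) (simp add: D_cls_def cls_conv)
  then have x': "rhoD x' = rhoD x" by (simp add: rhoD_def lop.ev_diff)
  have "at_const (rho (relabel Inr x)) (y' - y) \<in> M_ideal"
    using xy(2) by (intro rho_ideal_stable) (simp add: M_cls_def cls_conv)
  then have "at_const (rhoD x) y' - at_const (rhoD x) y \<in> M_ideal"
    by (simp add: rho_relabel lin_diff[OF lin_at_const])
  then show "c = M_cls R (at_const (rhoD x) y)"
    unfolding c x' by (simp add: M_cls_def cls_eq_iff)
qed

end

section \<open>Characters and Laplace operators inside the tower\<close>

text \<open>A left inverse of \<open>J\<close>: identities proved in the tower can be read back as
  identities of matrices.\<close>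

lemma (in unit_tower) J_entry:
  assumes "\<And>u v. com (X u v)" "length u = k" "length v = k"
  shows "X u v = (\<Sum>w | length w = k. eL p w u * J p k X * eL p v w)"
proof -
  have trm: "eL p w u * (eL p a b * X a b) * eL p v w =
      (if b = v then if a = u then eL p w w * X u v else 0 else 0)"
    if "length w = k" "length a = k" "length b = k" for w a b
  proof -
    have "eL p w u * (eL p a b * X a b) * eL p v w = (eL p w u * eL p a b) * (X a b * eL p v w)"
      by (simp only: mult.assoc)
    also have "\<dots> = (eL p w u * eL p a b * eL p v w) * X a b"
      by (simp only: com_eL[OF assms(1)] mult.assoc)
    finally show ?thesis using that assms(2,3) by (auto simp: eL_mult)
  qed
  have "eL p w u * J p k X * eL p v w = eL p w w * X u v" if "length w = k" for w
  proof -
    have "eL p w u * J p k X * eL p v w = (\<Sum>a | length a = k. \<Sum>b | length b = k.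
        if b = v then if a = u then eL p w w * X u v else 0 else 0)"
      unfolding J_def sum_distrib_left sum_distrib_right
      using trm[OF that] by (intro sum.cong refl) auto
    also have "\<dots> = (\<Sum>a | length a = k. if a = u then eL p w w * X u v else 0)"
      using assms(3) by (intro sum.cong refl) (simp add: sum.delta)
    finally show ?thesis using assms(2) by simp
  qed
  then have "(\<Sum>w | length w = k. eL p w u * J p k X * eL p v w) = (\<Sum>w | length w = k. eL p w w) * X u v"
    by (simp add: sum_distrib_right)
  then show ?thesis by (simp add: eL_sum)
qed

lemma poly_at_outside:
  assumes "\<not> (length u = n \<and> length v = n)"
  shows "poly_at R n x u v = 0"
proof -
  have "tprod n (map (\<lambda>i. leg2 n i R) w) u v = 0" if "\<not> (length u = n \<and> length v = n)" for u v w
    using that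
  proof (induction w arbitrary: u)
    case (Cons i w)
    then show ?case
      by (cases "length u = n") (auto simp: tprod_def tmul_def leg2_def)
  qed (auto simp: tprod_def tid_def)
  with assms show ?thesis by (simp add: poly_at_def)
qed

context hecke_tower
begin

text \<open>Links the R-trace of the definitions to the partial traces of the tower, with tensor
  factor \<open>i\<close> at position \<open>Suc i\<close>.\<close>

lemma ev_trR:
  assumes "\<And>i. com (g i)" "C_mat R = C"
  shows "ev g (trR R n X) = Tr C 1 n (J 1 n (\<lambda>u v. ev g (X u v)))"
proof -
  have "ev g (trR R n X) = (\<Sum>u | length u = n. \<Sum>w | length w = n.
      cst (\<Prod>i<n. C (u ! i) (w ! i)) * ev g (X w u))"
    by (simp add: trR_def tmul_def lift_def ev_sum ev_mult tprod_leg1 assms(2))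
  also have "\<dots> = (\<Sum>w | length w = n. \<Sum>u | length u = n.
      cst (\<Prod>i<n. C (u ! i) (w ! i)) * ev g (X w u))"
    by (rule sum.swap)
  finally show ?thesis by (simp add: Tr_J com_ev assms(1))
qed

lemma J_bar:
  assumes "\<And>i. com (g i)"
  shows "j < k \<Longrightarrow> J 1 k (\<lambda>u v. ev g (bar k R X j u v)) = bbar (Mt (\<lambda>p. ev g (X (fst p) (snd p)))) j"
proof (induction j)
  note c = coef_ev[of g, OF assms]
  {
  case 0
  then show ?case using J_leg1_coef[OF c, of k X] by simp
next
  case (Suc j)
  have op: "op2 (1 + j) R = t j" "op2 (1 + j) S = t' j"
    by (simp_all add: t_def t'_def r_def s_def)
  have "J 1 k (\<lambda>u v. ev g (bar k R X (Suc j) u v)) =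
      J 1 k (\<lambda>u v. ev g (lift (leg2 k j R) u v)) * (J 1 k (\<lambda>u v. ev g (bar k R X j u v)) *
      J 1 k (\<lambda>u v. ev g (lift (leg2 k j S) u v)))"
    by (simp only: bar.simps matrix_inv_R J_coef_tprod[OF c] list.map
      prod_list.Nil prod_list.Cons mult_1_right)
  also have "\<dots> = t j * (bbar (Mt (\<lambda>p. ev g (X (fst p) (snd p)))) j * t' j)"
    using Suc by (simp only: J_leg2_coef[OF c] op)
  finally show ?case by (simp add: mult.assoc)
  }
qed

lemma prodb_conv: "prodb X a n = prod_list (map (bbar X) [a..<a + n])"
  by (induction n arbitrary: a) (simp_all add: upt_conv_Cons del: upt_Suc)

lemma J_poly_at:
  assumes "Q \<in> free_on (hecke_letters n)"
  shows "J 1 n (\<lambda>u v. cst (poly_at R n Q u v)) = ev t Q"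
proof -
  have w: "J 1 n (\<lambda>u v. cst (tprod n (map (\<lambda>i. leg2 n i R) w) u v)) = prod_list (map t w)"
    if "w \<in> Poly_Mapping.keys Q" for w
  proof -
    have "J 1 n (\<lambda>u v. cst (leg2 n i R u v)) = t i" if "i \<in> set w" for i
    proof -
      have "Suc i < n"
        using assms \<open>w \<in> _\<close> that by (auto simp: free_on_def hecke_letters_def)
      then show ?thesis by (simp add: J_leg2 t_def r_def)
    qed
    then have "map (\<lambda>i. J 1 n (\<lambda>u v. cst (leg2 n i R u v))) w = map t w" by simp
    then show ?thesis by (simp only: J_coef_tprod[OF coef_cst] map_map o_def)
  qed
  have "J 1 n (\<lambda>u v. cst (poly_at R n Q u v)) = (\<Sum>w\<in>Poly_Mapping.keys Q.
      cst (Poly_Mapping.lookup Q w) * J 1 n (\<lambda>u v. cst (tprod n (map (\<lambda>i. leg2 n i R) w) u v)))"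
  proof -
    have "eL 1 u v * cst (poly_at R n Q u v) = (\<Sum>w\<in>Poly_Mapping.keys Q. cst (Poly_Mapping.lookup Q w) *
        (eL 1 u v * cst (tprod n (map (\<lambda>i. leg2 n i R) w) u v)))" for u v
      by (simp add: poly_at_def cst_sum cst_mult sum_distrib_left cst_left_commute[of "eL _ _ _"])
    then have "J 1 n (\<lambda>u v. cst (poly_at R n Q u v)) = (\<Sum>u | length u = n. \<Sum>v | length v = n.
        \<Sum>w\<in>Poly_Mapping.keys Q. cst (Poly_Mapping.lookup Q w) *
        (eL 1 u v * cst (tprod n (map (\<lambda>i. leg2 n i R) w) u v)))"
      by (simp only: J_def)
    also have "\<dots> = (\<Sum>u | length u = n. \<Sum>w\<in>Poly_Mapping.keys Q. \<Sum>v | length v = n.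
        cst (Poly_Mapping.lookup Q w) *
        (eL 1 u v * cst (tprod n (map (\<lambda>i. leg2 n i R) w) u v)))"
      by (intro sum.cong refl sum.swap)
    also have "\<dots> = (\<Sum>w\<in>Poly_Mapping.keys Q. \<Sum>u | length u = n. \<Sum>v | length v = n.
        cst (Poly_Mapping.lookup Q w) *
        (eL 1 u v * cst (tprod n (map (\<lambda>i. leg2 n i R) w) u v)))"
      by (rule sum.swap)
    finally show ?thesis by (simp only: J_def sum_distrib_left)
  qed
  also have "\<dots> = ev t Q"
    unfolding ev_def by (intro sum.cong refl) (simp only: w)
  finally show ?thesis .
qed

lemma ev_trR_poly:
  assumes g: "\<And>i. com (g i)" and "C_mat R = C" and Q: "Q \<in> free_on (hecke_letters n)"
  shows "ev g (trR R n (tmul n (lift (poly_at R n Q)) (bar_prod n R (gen_mat id) n))) =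
    Tr C 1 n (ev t Q * prodb (Mt g) 0 n)"
proof -
  note c = coef_ev[of g, OF g]
  have M: "(\<lambda>p. ev g (gen_mat id (fst p) (snd p))) = g" by (simp add: gen_mat_def)
  have "map (\<lambda>X. J 1 n (\<lambda>u v. ev g (X u v))) (map (bar n R (gen_mat id)) [0..<n]) =
      map (bbar (Mt g)) [0..<n]"
    using J_bar[of g _ n "gen_mat id", OF g] by (simp add: M)
  then have bar: "J 1 n (\<lambda>u v. ev g (bar_prod n R (gen_mat id) n u v)) = prodb (Mt g) 0 n"
    by (simp only: bar_prod_def J_coef_tprod[OF c] prodb_conv add_0)
  have "J 1 n (\<lambda>u v. ev g (lift (poly_at R n Q) u v)) = ev t Q"
    using J_poly_at[OF Q] by (simp add: lift_def)
  then show ?thesis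
    by (simp only: ev_trR[of g, OF g assms(2)] J_coef_tmul[OF c] bar)
qed

text \<open>Indices of the right length are recovered from the tower by \<open>J_entry\<close>; at
  all other indices both matrices vanish.\<close>

lemma poly_at_cong:
  assumes "x \<in> free_on (hecke_letters n)" "y \<in> free_on (hecke_letters n)" "ev t x = ev t y"
    and "inj cst"
  shows "poly_at R n x = poly_at R n y"
proof (intro ext)
  fix u v
  show "poly_at R n x u v = poly_at R n y u v"
  proof (cases "length u = n \<and> length v = n")
    case True
    have "cst (poly_at R n z u v) = (\<Sum>w | length w = n. eL 1 w u * ev t z * eL 1 v w)"
      if "z \<in> free_on (hecke_letters n)" for z
      using J_entry[of "\<lambda>u v. cst (poly_at R n z u v)" u n v 1] True J_poly_at[OF that] by simp
    then have "cst (poly_at R n x u v) = cst (poly_at R n y u v)" using assms by simp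
    then show ?thesis using assms(4) by (simp add: inj_eq)
  qed (simp add: poly_at_outside)
qed

lemma hecke_rels_subset: "hecke_rels q n \<subseteq> free_on (hecke_letters n)"
proof -
  have letter: "i \<in> hecke_letters n" if "Suc i \<in> hecke_letters n" for i
    using that by (auto simp: hecke_letters_def)
  have diff: "x - y \<in> free_on A" if "x \<in> free_on A" "y \<in> free_on A" for x y :: "nat free" and A
  proof -
    have "- y \<in> free_on A" using that(2) by (simp add: free_on_def)
    then show ?thesis using free_on_add[OF that(1), of "- y"] by simp
  qed
  note closed = diff free_on_mult free_on_add gen_in_free_on const_in_free_on
  show ?thesis
    unfolding hecke_rels_def
  proof (intro Un_least subsetI; elim CollectE exE conjE)
    fix x i assume x: "x = gen i * gen (Suc i) * gen i - gen (Suc i) * gen i * gen (Suc i)"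
      and "Suc i \<in> hecke_letters n"
    with letter[of i] show "x \<in> free_on (hecke_letters n)"
      unfolding x by (intro closed)
  next
    fix x i j assume x: "x = gen i * gen j - gen j * gen i"
      and "i \<in> hecke_letters n" "j \<in> hecke_letters n"
    then show "x \<in> free_on (hecke_letters n)"
      unfolding x by (intro closed)
  next
    fix x i assume x: "x = (const q - gen i) * (const (inverse q) + gen i)"
      and "i \<in> hecke_letters n"
    then show "x \<in> free_on (hecke_letters n)"
      unfolding x by (intro closed)
  qed
qed

lemma ev_hecke_ideal:
  assumes "lam = q - inverse q" "q \<noteq> 0"
    and "x \<in> rel_ideal (hecke_letters n) (hecke_rels q n)"
  shows "x \<in> free_on (hecke_letters n) \<and> ev t x = 0"
proof -
  have rel: "ev t x = 0" if "x \<in> hecke_rels q n" for x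
  proof -
    have "(cst q - t i) * (cst (inverse q) + t i) = 0" for i
    proof -
      have "(cst q - t i) * (cst (inverse q) + t i) =
          cst q * cst (inverse q) + (cst q - cst (inverse q)) * t i - t i * t i"
        using cst_central[of "inverse q" "t i"] by (simp add: algebra_simps)
      then show ?thesis
        using assms(2) by (simp add: t_t assms(1) cst_diff cst_mult[symmetric])
    qed
    moreover have "t i * t j = t j * t i" if "i + 2 \<le> j \<or> j + 2 \<le> i" for i j
      using that far[of i j] far[of j i] by auto
    ultimately show ?thesis
      using that by (auto simp: hecke_rels_def ev_diff ev_mult ev_add braid)
  qed
  have "rel_ideal (hecke_letters n) (hecke_rels q n) \<subseteq> {x \<in> free_on (hecke_letters n). ev t x = 0}"
  proof (rule rel_ideal_minimal)
    show "hecke_rels q n \<subseteq> {x \<in> free_on (hecke_letters n). ev t x = 0}"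
      using hecke_rels_subset rel by auto
    show "0 \<in> {x \<in> free_on (hecke_letters n). ev t x = 0}" by (simp add: free_on_def)
  qed (auto simp: ev_add ev_mult free_on_add free_on_mult)
  with assms(3) show ?thesis by blast
qed

text \<open>Relations of the Hecke algebra evaluate to zero in the tower, so all representatives
  give one matrix and \<open>the_elem\<close> is applied to a singleton.\<close>

lemma hecke_rep_cls:
  assumes "lam = q - inverse q" "q \<noteq> 0" "inj cst" "x \<in> free_on (hecke_letters n)"
  shows "hecke_rep R n (cls (hecke_letters n) (hecke_rels q n) x) = poly_at R n x"
proof -
  let ?c = "cls (hecke_letters n) (hecke_rels q n) x"
  have "poly_at R n y = poly_at R n x" if "y \<in> ?c" for y
  proof -
    have d: "y - x \<in> free_on (hecke_letters n)" "ev t (y - x) = 0"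
      using ev_hecke_ideal[OF assms(1,2)] that by (auto simp: cls_conv)
    have "y \<in> free_on (hecke_letters n)"
      using free_on_add[OF d(1) assms(4)] by simp
    then show ?thesis
      using d(2) assms(3,4) by (intro poly_at_cong) (simp_all add: ev_diff)
  qed
  then have "poly_at R n ` ?c = (\<lambda>_. poly_at R n x) ` ?c"
    by (intro image_cong refl)
  moreover have "x \<in> ?c"
    using rel_ideal_0[OF hecke_rels_subset] by (simp add: cls_conv)
  ultimately have "poly_at R n ` ?c = {poly_at R n x}"
    by (simp only: image_constant)
  then show ?thesis by (simp add: hecke_rep_def)
qed

end

context hecke_data
begin

lemma inj_cstop: "inj (cstop :: complex \<Rightarrow> (nat \<Rightarrow> 'n, 'n \<times> 'n) lop)"
proof (rule injI)
  fix c d assume "cstop c = (cstop d :: (nat \<Rightarrow> 'n, 'n \<times> 'n) lop)"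
  then have "app (cstop c :: (nat \<Rightarrow> 'n, 'n \<times> 'n) lop) (\<lambda>_. 1) undefined =
      app (cstop d :: (nat \<Rightarrow> 'n, 'n \<times> 'n) lop) (\<lambda>_. 1) undefined"
    by simp
  then show "c = d" by (simp add: app_cstop const_def) (metis lookup_single_eq)
qed

abbreviation ch_poly :: "nat \<Rightarrow> nat free \<Rightarrow> ('n \<times> 'n) free" where
  "ch_poly n x \<equiv> trR R n (tmul n (lift (poly_at R n x)) (bar_prod n R (gen_mat id) n))"

lemma ch_cls:
  assumes "lam = q - inverse q" "q \<noteq> 0" "x \<in> free_on (hecke_letters n)"
  shows "ch R n (cls (hecke_letters n) (hecke_rels q n) x) = M_cls R (ch_poly n x)"
  using T.hecke_rep_cls[OF assms(1,2) inj_cstop assms(3)] by (simp add: ch_def)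

text \<open>Both sides of \<open>laplace_product\<close> are applied to the vacuum 1, where
  \<open>rhoM y\<close> has the value \<open>y\<close> and \<open>kills 1\<close> the value 0. For
  \<open>p = 0\<close> no Hecke generator is available, so \<open>z\<close> is a scalar.\<close>

lemma laplace_ch_poly:
  assumes "C_mat R = T.C" "Q \<in> free_on (hecke_letters m)" "x \<in> free_on (hecke_letters n)"
  shows "(\<exists>p y. 1 \<le> p \<and> y \<in> free_on (hecke_letters p) \<and>
      at_const (rhoD (ch_poly m Q)) (ch_poly n x) = ch_poly p y) \<or>
    (\<exists>c. at_const (rhoD (ch_poly m Q)) (ch_poly n x) = const c)"
proof -
  let ?D = "rhoD (ch_poly m Q)" and ?x = "ch_poly n x"
  have D: "?D = lop.Tr T.C 1 m (lop.ev T.t Q * T.prodb DD 0 m)"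
    unfolding rhoD_def by (rule T.ev_trR_poly[of dd, OF com_dd assms(1,2)])
  have M: "rhoM (ch_poly n x) = lop.Tr T.C 1 n (lop.ev T.t x * T.prodb MM 0 n)"
    if "x \<in> free_on (hecke_letters n)" for n x
    unfolding rhoM_def by (rule T.ev_trR_poly[of mm, OF com_mm assms(1) that])
  have "lop.ev T.t Q \<in> T.H 0 m" using assms(2) by (simp add: T.H_0_conv)
  then obtain p z where z: "z \<in> T.H 0 p"
    and "?D * rhoM ?x - lop.Tr T.C 1 p (z * T.prodb MM 0 p) \<in> kills 1"
    using L.laplace_product[OF _ assms(3)] unfolding D M[OF assms(3)] by blast
  then have "app (?D * rhoM ?x - lop.Tr T.C 1 p (z * T.prodb MM 0 p)) (\<lambda>_. 1) undefined = 0"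
    by (intro kills_value)
  moreover have "app (?D * rhoM ?x) (\<lambda>_. 1) undefined = at_const ?D ?x"
    by (simp add: app_mult app_rhoM at_const[OF pointwise_rhoD])
  ultimately have eq: "at_const ?D ?x = app (lop.Tr T.C 1 p (z * T.prodb MM 0 p)) (\<lambda>_. 1) undefined"
    by (simp add: app_diff)
  show ?thesis
  proof (cases p)
    case 0
    have "\<exists>c. z = cstop c"
      using z unfolding 0
    proof (induction z rule: T.H_induct)
      case one
      show ?case by (metis lop.cst_1)
    next
      case (scale c x)
      then show ?case by (metis lop.cst_mult)
    next
      case (add x y)
      then show ?case by (metis lop.cst_add)
    qed auto
    then obtain c where "z = cstop c" by blast
    then have "at_const ?D ?x = const c" unfolding eq 0 by (simp add: app_cstop)
    then show ?thesis by blast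
  next
    case (Suc p')
    obtain y where y: "y \<in> free_on (hecke_letters p)" "z = lop.ev T.t y"
      using z by (auto simp: T.H_0_conv)
    have "at_const ?D ?x = ch_poly p y"
      unfolding eq y(2) M[OF y(1), symmetric] by (simp add: app_rhoM)
    with y Suc show ?thesis by (intro disjI1) auto
  qed
qed

end

lemma matrix_diff_distrib:
  fixes A B C :: "complex ^ 'a :: finite ^ 'a"
  shows "A ** (B - C) = A ** B - A ** C" "(B - C) ** A = B ** A - C ** A"
  by (simp_all add: matrix_matrix_mult_def vec_eq_iff algebra_simps sum_subtractf)

theorem theorem8:
  fixes R :: "complex ^ ('n :: finite \<times> 'n) ^ ('n \<times> 'n)"
    and q :: complex and m :: nat and Q :: "nat list \<Rightarrow>\<^sub>0 complex"
  assumes "generic q"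
    and "hecke_symmetry q R"
    and "skew_invertible R"
    and "skew_invertible (matrix_inv R)"
    and "has_involutive_limit q R"
    and "m \<ge> 1"
    and "Q \<in> free_on (hecke_letters m)"
  shows "\<forall>b \<in> char_subalg q R. act R (laplace R m Q) b \<in> char_subalg q R"
proof -
  have q: "q \<noteq> 0" using assms(1) by (simp add: generic_def)
  define lam where "lam = q - inverse q"
  have mat_mult: "mat c ** A = (\<chi> i j. c * A $ i $ j)" "A ** mat c = (\<chi> i j. A $ i $ j * c)"
    for c and A :: "complex ^ ('n \<times> 'n) ^ ('n \<times> 'n)"
    by (simp_all add: vec_eq_iff matrix_matrix_mult_def mat_def if_distrib[of "\<lambda>x. x * _"]
      if_distrib[of "(*) _"] cong: if_cong)
  have "(mat q - R) ** (mat (inverse q) + R) = 0"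
    using assms(2) by (simp add: hecke_symmetry_def)
  then have "((mat q - R) ** (mat (inverse q) + R)) $ a $ b = 0" for a b by simp
  then have "(R ** R) $ a $ b + R $ a $ b * inverse q =
      q * R $ a $ b + inverse q * (mat q :: complex ^ ('n \<times> 'n) ^ ('n \<times> 'n)) $ a $ b" for a b
    by (simp add: matrix_diff_distrib matrix_add_ldistrib mat_mult algebra_simps)
  then have RR: "(R ** R) $ a $ b = lam * R $ a $ b + (if a = b then 1 else 0)" for a b
    using q by (simp add: lam_def mat_def algebra_simps eq_diff_eq split: if_splits)
  \<comment> \<open>The Hecke relation reads R^2 = \<open>lam\<close> R + 1, which exhibits R -
    \<open>lam\<close> as the inverse of R.\<close>
  have quad: "R ** (R - mat lam) = mat 1" "(R - mat lam) ** R = mat 1"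
    using RR by (simp_all add: vec_eq_iff matrix_diff_distrib mat_mult
        algebra_simps) (simp_all add: mat_def)
  have skew: "is_skew_inverse R (skew_inv R)"
    using assms(3) unfolding skew_invertible_def skew_inv_def by (rule someI_ex)
  interpret hecke_data R "R - mat lam" "skew_inv R" lam
    using quad skew assms(2) by unfold_locales (auto simp: hecke_symmetry_def)
  have C: "C_mat R = T.C" by (intro ext) (simp add: C_mat_def T.C_def)
  define D where "D = rhoD (ch_poly m Q)"
  have M_ops: "M_cls R x \<oplus>\<^bsub>M_alg R\<^esub> M_cls R y = M_cls R (x + y)"
    "M_cls R x \<otimes>\<^bsub>M_alg R\<^esub> M_cls R y = M_cls R (x * y)" "\<one>\<^bsub>M_alg R\<^esub> = M_cls R 1" for x y
    by (simp_all add: M_cls_def M_alg_def presented_add presented_mult presented_one)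
  have const: "M_cls R (const c) \<in> char_subalg q R" for c
  proof -
    have "M_cls R (const c) \<otimes>\<^bsub>M_alg R\<^esub> \<one>\<^bsub>M_alg R\<^esub> \<in> char_subalg q R"
      by (intro char_subalg.scale char_subalg.unit)
    then show ?thesis by (simp add: M_ops)
  qed
  have ch: "M_cls R (ch_poly n x) \<in> char_subalg q R"
    if "1 \<le> n" "x \<in> free_on (hecke_letters n)" for n x
    unfolding ch_cls[OF lam_def q that(2), symmetric]
    using that by (intro char_subalg.char) (auto simp: hecke_alg_def presented_carrier)
  \<comment> \<open>The induction carries a representative in the free algebra, where the action is
    the linear map \<open>at_const D\<close>.\<close>
  have "\<exists>y. b = M_cls R y \<and> M_cls R (at_const D y) \<in> char_subalg q R" if "b \<in> char_subalg q R" for b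
    using that
  proof (induction b rule: char_subalg.induct)
    case unit
    show ?case by (intro exI[of _ 1]) (simp add: M_ops D_def at_const_rhoD_1 const)
  next
    case (char n z)
    then obtain x where x: "x \<in> free_on (hecke_letters n)"
      "z = cls (hecke_letters n) (hecke_rels q n) x"
      by (auto simp: hecke_alg_def presented_carrier)
    have "M_cls R (at_const D (ch_poly n x)) \<in> char_subalg q R"
      using laplace_ch_poly[OF C assms(7) x(1)] const ch unfolding D_def[symmetric] by auto
    moreover have "ch R n z = M_cls R (ch_poly n x)"
      unfolding x(2) by (rule ch_cls[OF lam_def q x(1)])
    ultimately show ?case by blast
  next
    case (add x y)
    then obtain x' y' where *: "x = M_cls R x'" "M_cls R (at_const D x') \<in> char_subalg q R"
      "y = M_cls R y'" "M_cls R (at_const D y') \<in> char_subalg q R" by blast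
    have "M_cls R (at_const D x') \<oplus>\<^bsub>M_alg R\<^esub> M_cls R (at_const D y') \<in> char_subalg q R"
      by (intro char_subalg.add *)
    with * show ?case
      by (intro exI[of _ "x' + y'"]) (simp add: M_ops linD(1)[OF lin_at_const])
  next
    case (scale x c)
    then obtain x' where *: "x = M_cls R x'" "M_cls R (at_const D x') \<in> char_subalg q R" by blast
    have "M_cls R (const c) \<otimes>\<^bsub>M_alg R\<^esub> M_cls R (at_const D x') \<in> char_subalg q R"
      by (intro char_subalg.scale *)
    with * show ?case
      by (intro exI[of _ "const c * x'"]) (simp add: M_ops linD(2)[OF lin_at_const])
  qed
  then show ?thesis
    using act_eq[of "ch_poly m Q"] unfolding laplace_def D_def by metis
qed

end
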